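(* Let $d\ge2$, let $\Omega\subset\mathbb{R}^d$ be a domain and let $W$ be a subharmonic function on $\Omega$. Suppose that there is an increasing sequence $(u_j)$ of subharmonic functions on $\Omega$, each bounded above on $\Omega$, with $u_j\le W$ and $u_j\to W$ quasi-everywhere on $\Omega$. Then $$W(x)=\sup\{u(x): u\text{ subharmonic on }\Omega,\ u\le W \text{ on }\Omega,\ \sup_\Omega u<+\infty\}\qquad\text{for every }x\in\Omega.$$ The same holds with two-sided boundedness throughout: if the $u_j$ are bounded both above and below on $\Omega$, then for every $x\in\Omega$, $W(x)$ is the supremum of $u(x)$ over all subharmonic $u\le W$ on $\Omega$ that are bounded both above and below on $\Omega$.
   Context: A domain is a nonempty connected open set. Subharmonic functions take values in $[-\infty,+\infty)$, and the function identically $-\infty$ is allowed. A property holds quasi-everywhere on $\Omega$ if it holds outside a polar subset of $\Omega$ (in the sense of classical potential theory). *)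

theory Defs
  imports "HOL-Analysis.Analysis"
begin

(* Normalised surface measure on the unit sphere: the measure of a Borel set A of unit vectors is
   the proportion of the unit ball occupied by the cone {t y | 0 < t < 1, y in A}.  Here sgn x is
   x / norm x; the point 0, which is not sent to the sphere, is a null set. *)
definition sphere_prob :: "'a::euclidean_space measure" where
  "sphere_prob = distr (uniform_measure lborel (ball 0 1)) borel sgn"

(* Mean of u over the sphere of centre a and radius r, as integral of the positive part minus
   integral of the negative part (e2ennreal sends negative values to 0).  If u is upper
   semicontinuous and < \<infinity> on the sphere, the first term is finite, so the difference is meaningful
   and lies in [-\<infinity>, \<infinity>). *)
definition sphere_mean :: "('a::euclidean_space \<Rightarrow> ereal) \<Rightarrow> 'a \<Rightarrow> real \<Rightarrow> ereal" where
  "sphere_mean u a r =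
     enn2ereal (\<integral>\<^sup>+ y\<in>sphere 0 1. e2ennreal (u (a + r *\<^sub>R y)) \<partial>sphere_prob) -
     enn2ereal (\<integral>\<^sup>+ y\<in>sphere 0 1. e2ennreal (- u (a + r *\<^sub>R y)) \<partial>sphere_prob)"

definition usc_on :: "'a::topological_space set \<Rightarrow> ('a \<Rightarrow> ereal) \<Rightarrow> bool" where
  "usc_on \<Omega> u \<longleftrightarrow> (\<forall>c. openin (top_of_set \<Omega>) {x \<in> \<Omega>. u x < c})"

(* Meant for open \<Omega>; the values of u outside \<Omega> are irrelevant.  The function identically -\<infinity> is
   subharmonic. *)
definition subharmonic_on :: "'a::euclidean_space set \<Rightarrow> ('a \<Rightarrow> ereal) \<Rightarrow> bool" where
  "subharmonic_on \<Omega> u \<longleftrightarrow>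
     (\<forall>x\<in>\<Omega>. u x < \<infinity>) \<and> usc_on \<Omega> u \<and>
     (\<forall>a r. 0 < r \<longrightarrow> cball a r \<subseteq> \<Omega> \<longrightarrow> u a \<le> sphere_mean u a r)"

(* The requirement on components excludes functions that are identically -\<infinity> near part of E. *)
definition polar :: "'a::euclidean_space set \<Rightarrow> bool" where
  "polar E \<longleftrightarrow>
     (\<exists>U v. open U \<and> E \<subseteq> U \<and> subharmonic_on U v \<and>
        (\<forall>C\<in>components U. \<exists>y\<in>C. v y \<noteq> -\<infinity>) \<and>
        (\<forall>x\<in>E. v x = -\<infinity>))"

definition quasi_everywhere_on :: "'a::euclidean_space set \<Rightarrow> ('a \<Rightarrow> bool) \<Rightarrow> bool" where
  "quasi_everywhere_on \<Omega> P \<longleftrightarrow> (\<exists>E\<subseteq>\<Omega>. polar E \<and> (\<forall>x\<in>\<Omega> - E. P x))"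

definition bdd_above_on :: "'a set \<Rightarrow> ('a \<Rightarrow> ereal) \<Rightarrow> bool" where
  "bdd_above_on \<Omega> u \<longleftrightarrow> (SUP x\<in>\<Omega>. u x) < \<infinity>"

definition bdd_below_on :: "'a set \<Rightarrow> ('a \<Rightarrow> ereal) \<Rightarrow> bool" where
  "bdd_below_on \<Omega> u \<longleftrightarrow> -\<infinity> < (INF x\<in>\<Omega>. u x)"

end

theory Submission
  imports Defs "HOL-Probability.Probability_Measure"
begin

text \<open>
Only the inequality \<open>W x \<le> Sup \<dots>\<close> needs an argument, and only at points with \<open>W x > -\<infinity>\<close>. At such a
point the \<open>u\<^sub>j\<close> need not converge to \<open>W\<close>, since the point may lie in the exceptional polar set. But
\<open>W\<close> is upper semicontinuous and less than \<open>\<infinity>\<close>, hence bounded above near \<open>x\<close>; so a bounded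
competitor may use \<open>W\<close> itself near \<open>x\<close> and has to use \<open>u\<^sub>j\<close> only far away. Passing from one to the
other costs a harmonic correction that is paid on a sphere. Let \<open>B\<close> be a small ball with centre \<open>x\<close>
and let \<open>h\<^sub>j \<ge> 0\<close> be the Poisson integral on \<open>B\<close> of the boundary values of \<open>W - u\<^sub>j\<close>. Put
\<open>v\<^sub>j = max u\<^sub>j (W - h\<^sub>j)\<close> in \<open>B\<close> and \<open>v\<^sub>j = u\<^sub>j\<close> outside \<open>B\<close>. Write \<open>P[f]\<close> for a Poisson integral.
Since \<open>W \<le> P[W]\<close> in \<open>B\<close>, there \<open>W - h\<^sub>j \<le> P[u\<^sub>j]\<close>, and the upper limit of \<open>P[u\<^sub>j]\<close> at a boundary
point is at most the value of \<open>u\<^sub>j\<close> there. Hence \<open>v\<^sub>j\<close> is upper semicontinuous, and it is subharmonic.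
Moreover \<open>u\<^sub>j \<le> v\<^sub>j \<le> W\<close>, so \<open>v\<^sub>j\<close> is bounded above because \<open>W\<close> is bounded above on \<open>B\<close>, and it is
bounded below if \<open>u\<^sub>j\<close> is. Finally \<open>v\<^sub>j x \<ge> W x - h\<^sub>j x\<close>, where \<open>h\<^sub>j x\<close> is the mean of \<open>W - u\<^sub>j\<close> over the
boundary sphere, and this mean tends to \<open>0\<close> by dominated convergence. The construction is
\<open>subharmonic_poisson_gluing\<close>; the limit is taken in \<open>approximation_at_point\<close>.

The dominated convergence needs \<open>u\<^sub>j \<rightarrow> W\<close> almost everywhere on the sphere, and one \<open>u\<^sub>j\<close> that is
integrable on it. Polar sets are Lebesgue null (\<open>polar_negligible\<close>) and a subharmonic function is
integrable on a closed ball in its domain if it is finite at the centre, so by polar coordinates both conditions hold for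
almost every radius (\<open>generic_radius\<close>).

Three devices keep the potential theory elementary. First, the mean of an upper semicontinuous
function over a sphere is the infimum of the means of its continuous majorants, so that a
sub-mean-value inequality can be read as a family of inequalities between real numbers
(\<open>sphere_mean_le_integral\<close>, \<open>le_sphere_meanI\<close>); functions can then be added and subtracted without
arithmetic on infinite values. Second, in the maximum principle an error \<open>O(\<rho>\<^sup>3)\<close> in the mean over
a sphere of radius \<open>\<rho>\<close> is harmless, because the means of the perturbation \<open>\<epsilon> |x|\<^sup>2\<close> exceed its value at
the centre by \<open>\<epsilon> \<rho>\<^sup>2\<close>. So all that is needed of the Poisson kernel is that its means over small spheres agree with
its value at the centre up to \<open>O(\<rho>\<^sup>3)\<close>, which a Taylor expansion shows. Third, comparing with Poisson
integrals of continuous functions turns the inequality on small spheres into the inequality on all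
spheres (\<open>subharmonic_on_local\<close>), which is what the glued function requires.
\<close>

section \<open>The uniform distribution on the sphere\<close>

abbreviation unit_ball_prob :: "'a::euclidean_space measure" where
  "unit_ball_prob \<equiv> uniform_measure lborel (ball 0 1)"

lemma emeasure_unit_ball: "emeasure lborel (ball (0::'a::euclidean_space) 1) \<noteq> 0"
  "emeasure lborel (ball (0::'a::euclidean_space) 1) \<noteq> \<infinity>"
proof -
  have "ball (0::'a) 1 \<notin> null_sets lborel"
    using open_not_negligible[of "ball (0::'a) 1"] by (auto simp: negligible_iff_null_sets null_sets_completionI)
  then show "emeasure lborel (ball (0::'a::euclidean_space) 1) \<noteq> 0" by auto
qed (use emeasure_lborel_ball_finite[of "0::'a" 1] in auto)

lemma prob_space_unit_ball: "prob_space (unit_ball_prob :: 'a::euclidean_space measure)"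
  using emeasure_unit_ball by (intro prob_space_uniform_measure) auto

lemma sets_sphere_prob [measurable_cong, simp]: "sets sphere_prob = sets borel"
  by (simp add: sphere_prob_def)

lemma space_sphere_prob [simp]: "space sphere_prob = UNIV"
  by (simp add: sphere_prob_def)

lemma prob_space_sphere_prob: "prob_space (sphere_prob :: 'a::euclidean_space measure)"
  unfolding sphere_prob_def by (rule prob_space.prob_space_distr[OF prob_space_unit_ball]) simp

interpretation sphere_prob: prob_space "sphere_prob :: 'a::euclidean_space measure"
  by (rule prob_space_sphere_prob)

lemma AE_unit_ball: "AE x in (unit_ball_prob :: 'a::euclidean_space measure). norm x < 1 \<and> x \<noteq> 0"
proof -
  have "AE x in lborel. x \<noteq> (0::'a)"
    by (rule AE_lborel_singleton)
  then have "AE x in lborel. x \<in> ball 0 1 \<longrightarrow> norm x < 1 \<and> x \<noteq> (0::'a)"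
    by eventually_elim auto
  then show ?thesis
    by (rule AE_uniform_measureI[rotated]) simp
qed

lemma AE_sphere_prob: "AE y in sphere_prob. norm (y::'a::euclidean_space) = 1"
  unfolding sphere_prob_def
  by (subst AE_distr_iff) (use AE_unit_ball in \<open>auto simp: norm_sgn\<close>)

lemma nn_integral_sphere_indicator:
  "(\<integral>\<^sup>+ y\<in>sphere (0::'a::euclidean_space) 1. f y \<partial>sphere_prob) = (\<integral>\<^sup>+ y. f y \<partial>sphere_prob)"
  by (rule nn_integral_cong_AE) (use AE_sphere_prob in \<open>auto simp: indicator_def\<close>)

lemma sphere_integrable_bounded:
  fixes f :: "'a::euclidean_space \<Rightarrow> real"
  assumes [measurable]: "f \<in> borel_measurable borel" and "\<And>y. norm y = 1 \<Longrightarrow> \<bar>f y\<bar> \<le> B"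
  shows "integrable sphere_prob f"
  by (rule sphere_prob.integrable_const_bound[where B=B]) (use AE_sphere_prob assms in auto)

text \<open>Uniqueness of Lebesgue measure up to a factor, which the unit ball \<open>B\<close> fixes: by Tonelli and
invariance, both \<open>M A * lborel B\<close> and \<open>lborel A * M B\<close> are the integral of \<open>1\<^sub>A(x) 1\<^sub>B(y - x)\<close> against
\<open>M \<Otimes> lborel\<close>. Applied to an image of Lebesgue measure, it gives rotation invariance without
determinants.\<close>

lemma translation_invariant_eq_lborel:
  fixes M :: "'a::euclidean_space measure"
  assumes sM [measurable_cong]: "sets M = sets borel" and "sigma_finite_measure M"
    and inv: "\<And>y. distr M borel (\<lambda>x. x + y) = M"
    and ball: "emeasure M (ball 0 1) = emeasure lborel (ball (0::'a) 1)"
  shows "M = lborel"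
proof (rule measure_eqI)
  interpret M: sigma_finite_measure M by fact
  interpret P: pair_sigma_finite M lborel
    by (intro pair_sigma_finite.intro lborel.sigma_finite_measure_axioms) fact
  fix A assume "A \<in> sets M"
  then have [measurable]: "A \<in> sets borel" by (simp add: sM)
  let ?B = "ball (0::'a) 1"
  have [measurable]: "?B \<in> sets borel" by simp
  have tr: "(\<integral>\<^sup>+ x. f (x + y) \<partial>M) = (\<integral>\<^sup>+ x. f x \<partial>M)" if [measurable]: "f \<in> borel_measurable borel" for f y
  proof -
    have "(\<integral>\<^sup>+ x. f x \<partial>distr M borel (\<lambda>x. x + y)) = (\<integral>\<^sup>+ x. f (x + y) \<partial>M)"
      by (rule nn_integral_distr) auto
    then show ?thesis by (simp add: inv)
  qed
  have trL: "(\<integral>\<^sup>+ x. f (y + x) \<partial>lborel) = (\<integral>\<^sup>+ x. f x \<partial>lborel)"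
    if [measurable]: "f \<in> borel_measurable borel" for f :: "'a \<Rightarrow> ennreal" and y
    using nn_integral_distr[of "(+) y" lborel borel f] lborel_distr_plus[of y] by simp
  have "emeasure M A * emeasure lborel ?B = (\<integral>\<^sup>+ x. indicator A x * (\<integral>\<^sup>+ y. indicator ?B (- x + y) \<partial>lborel) \<partial>M)"
    by (subst trL, measurable) (auto simp: nn_integral_multc sM)
  also have "\<dots> = (\<integral>\<^sup>+ x. \<integral>\<^sup>+ y. indicator A x * indicator ?B (y - x) \<partial>lborel \<partial>M)"
    by (simp, intro nn_integral_cong nn_integral_cmult[symmetric]) simp_all
  also have "\<dots> = (\<integral>\<^sup>+ y. \<integral>\<^sup>+ x. indicator A x * indicator ?B (y - x) \<partial>M \<partial>lborel)"
    by (rule P.Fubini'[symmetric]) measurable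
  also have "\<dots> = (\<integral>\<^sup>+ y. \<integral>\<^sup>+ x. indicator A (x + y) * indicator ?B x \<partial>M \<partial>lborel)"
  proof (rule nn_integral_cong)
    fix y
    show "(\<integral>\<^sup>+ x. indicator A x * indicator ?B (y - x) \<partial>M) = (\<integral>\<^sup>+ x. indicator A (x + y) * indicator ?B x \<partial>M)"
      using tr[of "\<lambda>x. indicator A x * indicator ?B (y - x)" y] by (simp add: indicator_def)
  qed
  also have "\<dots> = (\<integral>\<^sup>+ x. \<integral>\<^sup>+ y. indicator A (x + y) * indicator ?B x \<partial>lborel \<partial>M)"
    by (rule P.Fubini') measurable
  also have "\<dots> = (\<integral>\<^sup>+ x. (\<integral>\<^sup>+ y. indicator A (x + y) \<partial>lborel) * indicator ?B x \<partial>M)"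
    by (simp add: nn_integral_multc)
  also have "\<dots> = emeasure lborel A * emeasure M ?B"
    by (subst trL, measurable) (auto simp: nn_integral_cmult sM)
  finally have "emeasure M A * emeasure lborel ?B / emeasure lborel ?B = emeasure lborel A * emeasure lborel ?B / emeasure lborel ?B"
    unfolding ball by (rule arg_cong)
  then show "emeasure M A = emeasure lborel A"
    using emeasure_unit_ball[where 'a='a] by (simp add: mult_divide_eq_ennreal)
qed (simp add: sM)

lemma orthogonal_transformation_borel:
  fixes f :: "'a::euclidean_space \<Rightarrow> 'a"
  assumes "orthogonal_transformation f"
  shows "f \<in> borel_measurable borel"
  by (rule borel_measurable_continuous_onI)
    (use assms linear_continuous_on linear_conv_bounded_linear orthogonal_transformation_linear in blast)

lemma distr_orthogonal_lborel:
  fixes f :: "'a::euclidean_space \<Rightarrow> 'a"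
  assumes f: "orthogonal_transformation f"
  shows "distr lborel borel f = lborel"
proof (rule translation_invariant_eq_lborel)
  note [measurable] = orthogonal_transformation_borel[OF f]
  have lin: "linear f" and norm: "\<And>x. norm (f x) = norm x"
    using f by (auto simp: orthogonal_transformation_linear orthogonal_transformation)
  have pre: "f -` ball 0 r = ball 0 r" for r by (auto simp: norm)
  show "emeasure (distr lborel borel f) (ball 0 1) = emeasure lborel (ball (0::'a) 1)"
    by (subst emeasure_distr) (auto simp: pre)
  show "sigma_finite_measure (distr lborel borel f)"
  proof
    show "\<exists>A. countable A \<and> A \<subseteq> sets (distr lborel borel f) \<and> \<Union> A = space (distr lborel borel f) \<and>
        (\<forall>a\<in>A. emeasure (distr lborel borel f) a \<noteq> \<infinity>)"
    proof (intro exI[of _ "range (\<lambda>n::nat. ball 0 (real n))"] conjI ballI)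
      show "\<Union> (range (\<lambda>n::nat. ball 0 (real n))) = space (distr lborel borel f)"
        using reals_Archimedean2 by auto
      fix a assume "a \<in> range (\<lambda>n::nat. ball (0::'a) (real n))"
      then show "emeasure (distr lborel borel f) a \<noteq> \<infinity>"
        using emeasure_lborel_ball_finite[of "0::'a"] by (auto simp: emeasure_distr pre simp flip: less_top)
    qed auto
  qed
  fix y
  obtain z where z: "f z = y"
    using orthogonal_transformation_surj[OF f] by (metis surj_def)
  have "distr (distr lborel borel f) borel (\<lambda>x. x + y) = distr lborel borel (\<lambda>x. f (z + x))"
    by (subst distr_distr) (auto simp: o_def linear_add[OF lin] z add.commute)
  also have "\<dots> = distr (distr lborel borel ((+) z)) borel f"
    by (subst distr_distr) (auto simp: o_def)
  finally show "distr (distr lborel borel f) borel (\<lambda>x. x + y) = distr lborel borel f"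
    by (simp add: lborel_distr_plus)
qed simp

text \<open>The reflection in the hyperplane orthogonal to \<open>a - b\<close> does it.\<close>

lemma orthogonal_transformation_exists_general:
  fixes a b :: "'a::euclidean_space"
  assumes "norm a = norm b"
  shows "\<exists>f. orthogonal_transformation f \<and> f a = b"
proof (cases "a = b")
  case True
  then show ?thesis using orthogonal_transformation_id by (intro exI[of _ id]) (auto simp: id_def)
next
  case False
  define d where "d = a - b"
  define f where "f = (\<lambda>x. x - (2 * (x \<bullet> d) / (d \<bullet> d)) *\<^sub>R d)"
  have d: "d \<bullet> d \<noteq> 0" using False by (simp add: d_def)
  have "linear f"
    unfolding f_def by (rule linearI) (auto simp: algebra_simps inner_add_left add_divide_distrib)
  moreover have "f v \<bullet> f w = v \<bullet> w" for v w
    unfolding f_def using d by (simp add: inner_diff_left inner_diff_right inner_commute field_simps)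
  moreover have "2 * (a \<bullet> d) = d \<bullet> d"
    using assms by (simp add: d_def inner_diff_left inner_diff_right inner_commute norm_eq)
  then have "f a = b"
    unfolding f_def using d by (simp add: d_def)
  ultimately show ?thesis by (auto simp: orthogonal_transformation_def)
qed

lemma distr_orthogonal_sphere_prob:
  fixes f :: "'a::euclidean_space \<Rightarrow> 'a"
  assumes f: "orthogonal_transformation f"
  shows "distr sphere_prob borel f = sphere_prob"
proof -
  have lin: "linear f" and norm: "\<And>x. norm (f x) = norm x"
    using f by (auto simp: orthogonal_transformation_linear orthogonal_transformation)
  have [measurable]: "f \<in> borel_measurable borel"
    by (rule borel_measurable_continuous_onI) (use lin linear_continuous_on linear_conv_bounded_linear in blast)
  have fsgn: "f \<circ> sgn = sgn \<circ> f"
    by (auto simp: fun_eq_iff sgn_div_norm linear_cmul[OF lin] norm)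
  have "distr unit_ball_prob borel f = unit_ball_prob"
  proof (rule measure_eqI)
    fix A assume "A \<in> sets (distr unit_ball_prob borel f)"
    then have [measurable]: "A \<in> sets borel" by simp
    have A': "f -` A \<in> sets borel" using measurable_sets[of f borel borel A] by simp
    have "ball 0 1 \<inter> f -` A = f -` (ball 0 1 \<inter> A)" by (auto simp: norm)
    moreover have "emeasure lborel (f -` (ball 0 1 \<inter> A)) = emeasure (distr lborel borel f) (ball 0 1 \<inter> A)"
      by (subst emeasure_distr) auto
    ultimately show "emeasure (distr unit_ball_prob borel f) A = emeasure unit_ball_prob A"
      by (subst emeasure_distr) (auto simp: distr_orthogonal_lborel[OF f] A')
  qed simp
  note inv = this
  have "distr sphere_prob borel f = distr unit_ball_prob borel (f \<circ> sgn)"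
    unfolding sphere_prob_def by (subst distr_distr) auto
  also have "\<dots> = distr (distr unit_ball_prob borel f) borel sgn"
    unfolding fsgn by (subst distr_distr) auto
  finally show ?thesis by (simp add: inv sphere_prob_def)
qed

lemma integral_sphere_rotate:
  fixes f :: "'a::euclidean_space \<Rightarrow> 'a" and g :: "'a \<Rightarrow> real"
  assumes f: "orthogonal_transformation f" and [measurable]: "g \<in> borel_measurable borel"
  shows "(\<integral>y. g (f y) \<partial>sphere_prob) = (\<integral>y. g y \<partial>sphere_prob)"
proof -
  have [measurable]: "f \<in> borel_measurable borel"
    by (rule borel_measurable_continuous_onI)
      (use f linear_continuous_on linear_conv_bounded_linear orthogonal_transformation_linear in blast)
  have "(\<integral>y. g y \<partial>distr sphere_prob borel f) = (\<integral>y. g (f y) \<partial>sphere_prob)"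
    by (rule integral_distr) auto
  then show ?thesis by (simp add: distr_orthogonal_sphere_prob[OF f])
qed

lemma integrable_sphere_inner:
  "integrable sphere_prob (\<lambda>y::'a::euclidean_space. y \<bullet> v)"
  "integrable sphere_prob (\<lambda>y::'a::euclidean_space. (y \<bullet> v) * (y \<bullet> w))"
proof -
  have "\<bar>y \<bullet> v\<bar> \<le> norm v" if "norm y = 1" for y v :: 'a
    using Cauchy_Schwarz_ineq2[of y v] that by simp
  note bound = this
  show "integrable sphere_prob (\<lambda>y::'a. y \<bullet> v)"
    by (rule sphere_integrable_bounded[where B="norm v"]) (auto simp: bound)
  show "integrable sphere_prob (\<lambda>y::'a. (y \<bullet> v) * (y \<bullet> w))"
    by (rule sphere_integrable_bounded[where B="norm v * norm w"]) (auto simp: bound abs_mult intro!: mult_mono)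
qed

lemma sphere_first_moment: "(\<integral>y. y \<bullet> v \<partial>sphere_prob) = 0" for v :: "'a::euclidean_space"
proof -
  have "orthogonal_transformation (\<lambda>x::'a. - x)"
    by (simp add: orthogonal_transformation_neg orthogonal_transformation_id[unfolded id_def])
  from integral_sphere_rotate[OF this, of "\<lambda>y. y \<bullet> v"] show ?thesis by simp
qed

text \<open>By rotation invariance \<open>q v = \<integral> (y \<bullet> v)\<^sup>2\<close> depends only on \<open>norm v\<close>. Its values at the vectors of
\<open>Basis\<close> are therefore equal, and they add up to \<open>\<integral> |y|\<^sup>2 = 1\<close>. The mixed moments follow by
polarization.\<close>

lemma sphere_second_moment:
  "(\<integral>y. (y \<bullet> v) * (y \<bullet> w) \<partial>sphere_prob) = (v \<bullet> w) / real DIM('a)" for v w :: "'a::euclidean_space"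
proof -
  define q where "q = (\<lambda>v::'a. \<integral>y. (y \<bullet> v) * (y \<bullet> v) \<partial>sphere_prob)"
  have eq: "q v = q w" if vw: "norm v = norm w" for v w
  proof -
    obtain f where f: "orthogonal_transformation f" "f v = w"
      using orthogonal_transformation_exists_general[OF vw] by auto
    have "q w = (\<integral>y. (f y \<bullet> w) * (f y \<bullet> w) \<partial>sphere_prob)"
      unfolding q_def using integral_sphere_rotate[OF f(1), of "\<lambda>y. (y \<bullet> w) * (y \<bullet> w)"] by simp
    also have "\<dots> = q v" unfolding q_def
      by (metis (no_types, lifting) f orthogonal_transformation_def)
    finally show ?thesis by simp
  qed
  obtain e :: "'a" where e: "e \<in> Basis" using nonempty_Basis by blast
  have "real DIM('a) * q e = (\<Sum>b\<in>Basis. q (b::'a))"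
    using eq[OF trans[OF norm_Basis norm_Basis[symmetric]], OF _ e] by simp
  also have "\<dots> = (\<integral>y. (\<Sum>b\<in>Basis. (y \<bullet> b) * (y \<bullet> (b::'a))) \<partial>sphere_prob)"
    unfolding q_def by (rule Bochner_Integration.integral_sum[symmetric]) (rule integrable_sphere_inner)
  also have "\<dots> = (\<integral>y. 1 \<partial>(sphere_prob :: ('a) measure))"
    by (rule integral_cong_AE)
       (use AE_sphere_prob in \<open>auto simp: euclidean_inner[symmetric] power2_norm_eq_inner[symmetric]\<close>)
  also have "\<dots> = 1" by (simp add: sphere_prob.prob_space[simplified])
  finally have qe: "q e = 1 / real DIM('a)" by (simp add: field_simps)
  have q: "q v = (v \<bullet> v) / real DIM('a)" for v
  proof -
    have "q v = q (norm v *\<^sub>R e)" by (rule eq) (simp add: e norm_Basis)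
    also have "\<dots> = (\<integral>y. (norm v)\<^sup>2 * ((y \<bullet> e) * (y \<bullet> e)) \<partial>sphere_prob)"
      unfolding q_def by (rule Bochner_Integration.integral_cong) (auto simp: power2_eq_square)
    also have "\<dots> = (norm v)\<^sup>2 * q e"
      unfolding q_def by (rule integral_mult_right_zero)
    finally show ?thesis by (simp add: qe power2_norm_eq_inner)
  qed
  have "q (v + w) = (\<integral>y. (y \<bullet> v) * (y \<bullet> v) + 2 * ((y \<bullet> v) * (y \<bullet> w)) + (y \<bullet> w) * (y \<bullet> w) \<partial>sphere_prob)"
    unfolding q_def by (rule Bochner_Integration.integral_cong) (auto simp: algebra_simps)
  also have "\<dots> = q v + 2 * (\<integral>y. (y \<bullet> v) * (y \<bullet> w) \<partial>sphere_prob) + q w"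
    unfolding q_def by (simp add: integrable_sphere_inner)
  finally have "2 * (\<integral>y. (y \<bullet> v) * (y \<bullet> w) \<partial>sphere_prob) = 2 * ((v \<bullet> w) / real DIM('a))"
    unfolding q by (simp add: inner_add_left inner_add_right inner_commute add_divide_distrib)
  then show ?thesis by simp
qed

section \<open>Upper semicontinuous functions and sphere means\<close>

lemma usc_on_iff:
  fixes u :: "'a::metric_space \<Rightarrow> ereal"
  shows "usc_on S u \<longleftrightarrow> (\<forall>x\<in>S. \<forall>c. u x < c \<longrightarrow> (\<exists>d>0. \<forall>y\<in>S. dist y x < d \<longrightarrow> u y < c))"
  unfolding usc_on_def openin_euclidean_subtopology_iff by auto

lemma usc_on_subset:
  fixes u :: "'a::metric_space \<Rightarrow> ereal"
  shows "usc_on S u \<Longrightarrow> T \<subseteq> S \<Longrightarrow> usc_on T u"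
  unfolding usc_on_iff by (meson subset_iff)

lemma usc_on_add_continuous:
  fixes u :: "'a::metric_space \<Rightarrow> ereal"
  assumes u: "usc_on S u" and g: "continuous_on S g"
  shows "usc_on S (\<lambda>x. u x + ereal (g x))"
  unfolding usc_on_iff
proof (intro ballI allI impI)
  fix x c assume x: "x \<in> S" and c: "u x + ereal (g x) < c"
  then have "u x < c - ereal (g x)" by (cases "u x"; cases c) auto
  then obtain b where b: "u x < ereal b" "ereal b < c - ereal (g x)"
    using ereal_dense2 by blast
  then have "ereal (g x) < c - ereal b" by (cases c) auto
  then obtain e where e: "ereal (g x) < ereal e" "ereal e < c - ereal b"
    using ereal_dense2 by blast
  obtain d1 where d1: "d1 > 0" "\<And>y. y \<in> S \<Longrightarrow> dist y x < d1 \<Longrightarrow> u y < ereal b"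
    using u x b unfolding usc_on_iff by blast
  have "0 < e - g x" using e by simp
  then obtain d2 where d2: "d2 > 0" "\<And>y. y \<in> S \<Longrightarrow> dist y x < d2 \<Longrightarrow> dist (g y) (g x) < e - g x"
    using g x unfolding continuous_on_iff by blast
  show "\<exists>d>0. \<forall>y\<in>S. dist y x < d \<longrightarrow> u y + ereal (g y) < c"
  proof (intro exI[of _ "min d1 d2"] conjI ballI impI)
    fix y assume y: "y \<in> S" "dist y x < min d1 d2"
    have "u y < ereal b" "g y < e" using d1(2)[of y] d2(2)[of y] y by (auto simp: dist_real_def)
    then have "u y + ereal (g y) \<le> ereal (b + e)" by (cases "u y") auto
    also have "\<dots> < c" using e by (cases c) auto
    finally show "u y + ereal (g y) < c" .
  qed (use d1 d2 in auto)
qed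

lemma usc_on_continuous: "continuous_on S f \<Longrightarrow> usc_on S (\<lambda>x::'a::metric_space. ereal (f x))"
proof -
  assume "continuous_on S f"
  moreover have "usc_on S (\<lambda>_. 0)" unfolding usc_on_iff by (auto intro: exI[of _ 1])
  ultimately show ?thesis using usc_on_add_continuous[of S "\<lambda>_. 0" f] by simp
qed

lemma usc_on_compose:
  fixes u :: "'b::metric_space \<Rightarrow> ereal" and f :: "'a::metric_space \<Rightarrow> 'b"
  assumes u: "usc_on S u" and f: "continuous_on T f" "\<And>x. x \<in> T \<Longrightarrow> f x \<in> S"
  shows "usc_on T (\<lambda>x. u (f x))"
  unfolding usc_on_iff
proof (intro ballI allI impI)
  fix x c assume x: "x \<in> T" and c: "u (f x) < c"
  obtain e where e: "e > 0" "\<And>y. y \<in> S \<Longrightarrow> dist y (f x) < e \<Longrightarrow> u y < c"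
    using u f(2)[OF x] c unfolding usc_on_iff by blast
  obtain d where "d > 0" "\<And>y. y \<in> T \<Longrightarrow> dist y x < d \<Longrightarrow> dist (f y) (f x) < e"
    using f(1) x e(1) unfolding continuous_on_iff by blast
  then show "\<exists>d>0. \<forall>y\<in>T. dist y x < d \<longrightarrow> u (f y) < c" using e(2) f(2) by blast
qed

lemma usc_on_max:
  fixes u v :: "'a::metric_space \<Rightarrow> ereal"
  assumes "usc_on S u" "usc_on S v"
  shows "usc_on S (\<lambda>x. max (u x) (v x))"
proof -
  have "{x\<in>S. max (u x) (v x) < c} = {x\<in>S. u x < c} \<inter> {x\<in>S. v x < c}" for c by auto
  then show ?thesis using assms unfolding usc_on_def by auto
qed

lemma usc_on_borel:
  fixes u :: "'a::metric_space \<Rightarrow> ereal"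
  assumes u: "usc_on S u" and [measurable]: "S \<in> sets borel"
  shows "(\<lambda>x. if x \<in> S then u x else 0) \<in> borel_measurable borel"
proof (rule borel_measurableI_less)
  fix c
  obtain T where T: "open T" "{x\<in>S. u x < c} = S \<inter> T"
    using u unfolding usc_on_def openin_open by blast
  have "{x \<in> space borel. (if x \<in> S then u x else 0) < c} = (S \<inter> T) \<union> (if 0 < c then - S else {})"
    using T(2) by (auto split: if_splits)
  also have "\<dots> \<in> sets borel" using T(1) by auto
  finally show "{x \<in> space borel. (if x \<in> S then u x else 0) < c} \<in> sets borel" .
qed

lemma usc_on_compact_attains_max:
  fixes u :: "'a::metric_space \<Rightarrow> ereal"
  assumes u: "usc_on K u" and K: "compact K" "K \<noteq> {}"
  shows "\<exists>x\<in>K. \<forall>y\<in>K. u y \<le> u x"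
proof (rule ccontr)
  assume "\<not> ?thesis"
  then have *: "\<forall>x\<in>K. \<exists>y\<in>K. u x < u y" by (auto simp: not_le)
  have "\<forall>y. \<exists>T. open T \<and> {x\<in>K. u x < u y} = K \<inter> T"
    using u unfolding usc_on_def openin_open by blast
  then obtain T where T: "\<And>y. open (T y)" "\<And>y. {x\<in>K. u x < u y} = K \<inter> T y" by metis
  have "K \<subseteq> (\<Union>y\<in>K. T y)" using * T(2) by blast
  then obtain D where D: "D \<subseteq> K" "finite D" "K \<subseteq> (\<Union>y\<in>D. T y)"
    using compactE_image[OF K(1)] T(1) by metis
  have "D \<noteq> {}" using D K by auto
  then obtain m where m: "m \<in> D" "\<And>y. y \<in> D \<Longrightarrow> u y \<le> u m"
  proof -
    have "Max (u ` D) \<in> u ` D" using \<open>D \<noteq> {}\<close> D(2) by (intro Max_in) auto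
    then obtain m where "m \<in> D" "u m = Max (u ` D)" by auto
    then show ?thesis using that[of m] D(2) by (metis Max_ge finite_imageI imageI)
  qed
  then obtain y where y: "y \<in> D" "m \<in> T y" using D by blast
  then have "u m < u y" using T(2)[of y] m D by blast
  then show False using m(2)[OF y(1)] by simp
qed

lemma usc_on_compact_bounded:
  fixes u :: "'a::metric_space \<Rightarrow> ereal"
  assumes u: "usc_on K u" "compact K" "\<And>x. x \<in> K \<Longrightarrow> u x < \<infinity>"
  obtains M where "M \<ge> 0" "\<And>x. x \<in> K \<Longrightarrow> u x \<le> ereal M"
proof (cases "K = {}")
  case False
  obtain x where x: "x \<in> K" "\<And>y. y \<in> K \<Longrightarrow> u y \<le> u x"
    using usc_on_compact_attains_max[OF u(1,2) False] by blast
  have "u x < \<infinity>" by (rule u) fact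
  then have "u x \<le> ereal (max 0 (real_of_ereal (u x)))" by (cases "u x") auto
  then show ?thesis using that[of "max 0 (real_of_ereal (u x))"] x(2) by (meson max.cobounded1 order_trans)
qed (use that[of 0] in auto)

text \<open>The sup-convolutions \<open>G k y = sup\<^sub>z (max (u z) (- k) - k |y - z|)\<close> are Lipschitz and decrease
to \<open>u\<close>; cutting off at \<open>- k\<close> keeps them real where \<open>u\<close> is \<open>-\<infinity>\<close>.\<close>

lemma usc_on_compact_approx:
  fixes u :: "'a::metric_space \<Rightarrow> ereal"
  assumes u: "usc_on K u" "compact K" "\<And>x. x \<in> K \<Longrightarrow> u x < \<infinity>"
  obtains G :: "nat \<Rightarrow> 'a \<Rightarrow> real" where
    "\<And>k. continuous_on UNIV (G k)" "\<And>k y. G (Suc k) y \<le> G k y"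
    "\<And>k y. y \<in> K \<Longrightarrow> u y \<le> ereal (G k y)"
    "\<And>y. y \<in> K \<Longrightarrow> (\<lambda>k. ereal (G k y)) \<longlonglongrightarrow> u y"
proof (cases "K = {}")
  case True
  then show ?thesis using that[of "\<lambda>_ _. 0"] by auto
next
  case False
  obtain M where M: "M \<ge> 0" "\<And>x. x \<in> K \<Longrightarrow> u x \<le> ereal M"
    using usc_on_compact_bounded[OF u] by blast
  define w where "w = (\<lambda>k z. real_of_ereal (max (u z) (ereal (- real k))))"
  have we: "ereal (w k z) = max (u z) (ereal (- real k))" if "z \<in> K" for k z
    using u(3)[OF that] unfolding w_def by (cases "u z") (auto simp: max_def)
  have wM: "w k z \<le> M" if "z \<in> K" for k z
  proof -
    have "ereal (w k z) \<le> ereal M" unfolding we[OF that] using M(1) M(2)[OF that] by auto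
    then show ?thesis by simp
  qed
  have wmono: "w (Suc k) z \<le> w k z" if "z \<in> K" for k z
  proof -
    have "ereal (w (Suc k) z) \<le> ereal (w k z)" unfolding we[OF that] by (intro max.mono) auto
    then show ?thesis by simp
  qed
  define G where "G = (\<lambda>k y. SUP z\<in>K. w k z - real k * dist y z)"
  have bdd: "bdd_above ((\<lambda>z. w k z - real k * dist y z) ` K)" for k y
  proof (rule bdd_aboveI2)
    fix z assume "z \<in> K"
    then have "w k z \<le> M" "0 \<le> real k * dist y z" using wM by auto
    then show "w k z - real k * dist y z \<le> M" by linarith
  qed
  have upper: "w k z - real k * dist y z \<le> G k y" if "z \<in> K" for k y z
    unfolding G_def by (rule cSUP_upper[OF that bdd])
  have least: "G k y \<le> b" if "\<And>z. z \<in> K \<Longrightarrow> w k z - real k * dist y z \<le> b" for k y b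
    unfolding G_def by (rule cSUP_least[OF False that])
  have lip: "G k y \<le> G k y' + real k * dist y y'" for k y y'
  proof (rule least)
    fix z assume "z \<in> K"
    have "real k * dist y' z \<le> real k * (dist y z + dist y y')"
      by (intro mult_left_mono) (metis dist_commute dist_triangle add.commute, simp)
    with upper[OF \<open>z \<in> K\<close>, of k y'] show "w k z - real k * dist y z \<le> G k y' + real k * dist y y'"
      by (simp add: distrib_left)
  qed
  show ?thesis
  proof (rule that[of G])
    fix k
    have "(real k)-lipschitz_on UNIV (G k)"
    proof (rule lipschitz_onI)
      fix x y show "dist (G k x) (G k y) \<le> real k * dist x y"
        using lip[of k x y] lip[of k y x] by (auto simp: dist_real_def dist_commute abs_le_iff)
    qed simp
    then show "continuous_on UNIV (G k)" by (rule lipschitz_on_continuous_on)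
  next
    fix k y show "G (Suc k) y \<le> G k y"
    proof (rule least)
      fix z assume z: "z \<in> K"
      have "real k * dist y z \<le> real (Suc k) * dist y z" by (intro mult_right_mono) auto
      then show "w (Suc k) z - real (Suc k) * dist y z \<le> G k y"
        using upper[OF z, of k y] wmono[OF z, of k] by linarith
    qed
  next
    fix k y assume y: "y \<in> K"
    have "u y \<le> ereal (w k y)" unfolding we[OF y] by simp
    also have "\<dots> \<le> ereal (G k y)" using upper[OF y, of k y] by simp
    finally show "u y \<le> ereal (G k y)" .
  next
    fix y assume y: "y \<in> K"
    have lower: "u y \<le> ereal (G k y)" for k
    proof -
      have "u y \<le> ereal (w k y)" unfolding we[OF y] by simp
      also have "\<dots> \<le> ereal (G k y)" using upper[OF y, of k y] by simp
      finally show ?thesis .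
    qed
    show "(\<lambda>k. ereal (G k y)) \<longlonglongrightarrow> u y"
    proof (rule order_tendstoI)
      fix a assume "a < u y"
      then show "\<forall>\<^sub>F k in sequentially. a < ereal (G k y)"
        using lower by (intro always_eventually) (auto intro: less_le_trans)
    next
      fix a assume "u y < a"
      then obtain b where b: "u y < ereal b" "ereal b < a" using ereal_dense2 by blast
      obtain d where d: "d > 0" "\<And>z. z \<in> K \<Longrightarrow> dist z y < d \<Longrightarrow> u z < ereal b"
        using u(1) y b(1) unfolding usc_on_iff by blast
      obtain k0 where k0: "(M + \<bar>b\<bar>) / d + \<bar>b\<bar> < real k0" using reals_Archimedean2 by blast
      have "\<forall>\<^sub>F k in sequentially. k \<ge> k0" by (rule eventually_ge_at_top)
      then show "\<forall>\<^sub>F k in sequentially. ereal (G k y) < a"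
      proof eventually_elim
        case (elim k)
        have q: "0 \<le> (M + \<bar>b\<bar>) / d" using M(1) d(1) by simp
        have kb: "\<bar>b\<bar> \<le> real k" and kd: "(M + \<bar>b\<bar>) / d \<le> real k" using k0 elim q by linarith+
        have kd': "M + \<bar>b\<bar> \<le> real k * d" using kd d(1) by (simp add: divide_le_eq)
        have "G k y \<le> b"
        proof (rule least)
          fix z assume z: "z \<in> K"
          show "w k z - real k * dist y z \<le> b"
          proof (cases "dist z y < d")
            case True
            then have "ereal (w k z) \<le> ereal b"
              unfolding we[OF z] using d(2)[OF z] kb by auto
            then have "w k z \<le> b" by simp
            moreover have "0 \<le> real k * dist y z" by simp
            ultimately show ?thesis by linarith
          next
            case False
            then have "real k * d \<le> real k * dist y z" by (intro mult_left_mono) (auto simp: dist_commute)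
            then show ?thesis using wM[OF z, of k] kd' by linarith
          qed
        qed
        then show ?case using b(2) by (meson ereal_less_eq(3) le_less_trans)
      qed
    qed
  qed
qed

lemma ereal_integral_eq:
  assumes "integrable M (G :: _ \<Rightarrow> real)"
  shows "ereal (\<integral>y. G y \<partial>M) = enn2ereal (\<integral>\<^sup>+ y. ennreal (G y) \<partial>M) - enn2ereal (\<integral>\<^sup>+ y. ennreal (- G y) \<partial>M)"
proof -
  have "(\<integral>\<^sup>+ y. ennreal (G y) \<partial>M) < \<infinity>" "(\<integral>\<^sup>+ y. ennreal (- G y) \<partial>M) < \<infinity>"
    using assms unfolding real_integrable_def by (auto simp: less_top)
  then show ?thesis
    unfolding real_lebesgue_integral_def[OF assms]
    by (cases "\<integral>\<^sup>+ y. ennreal (G y) \<partial>M"; cases "\<integral>\<^sup>+ y. ennreal (- G y) \<partial>M")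
       (auto simp: enn2ereal_ennreal)
qed

text \<open>This and \<open>le_sphere_meanI\<close> together say that \<open>c \<le> sphere_mean u a r\<close> means \<open>c \<le> \<integral> G\<close> for all
real majorants \<open>G\<close> of \<open>u\<close> on the sphere: integrable ones when the inequality is used, continuous
ones when it is to be proved.\<close>

lemma sphere_mean_le_integral:
  assumes c: "c \<le> sphere_mean u a r" and G: "integrable sphere_prob G"
    and le: "\<And>y. norm y = 1 \<Longrightarrow> u (a + r *\<^sub>R y) \<le> ereal (G y)"
  shows "c \<le> ereal (\<integral>y. G y \<partial>sphere_prob)"
proof -
  have "(\<integral>\<^sup>+ y. e2ennreal (u (a + r *\<^sub>R y)) \<partial>sphere_prob) \<le> (\<integral>\<^sup>+ y. ennreal (G y) \<partial>sphere_prob)"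
  proof (rule nn_integral_mono_AE)
    show "AE y in sphere_prob. e2ennreal (u (a + r *\<^sub>R y)) \<le> ennreal (G y)"
      using AE_sphere_prob
    proof eventually_elim
      case (elim y) then show ?case using e2ennreal_mono[OF le[of y]] by simp
    qed
  qed
  moreover have "(\<integral>\<^sup>+ y. ennreal (- G y) \<partial>sphere_prob) \<le> (\<integral>\<^sup>+ y. e2ennreal (- u (a + r *\<^sub>R y)) \<partial>sphere_prob)"
  proof (rule nn_integral_mono_AE)
    have "ennreal (- G y) \<le> e2ennreal (- u (a + r *\<^sub>R y))" if "norm y = 1" for y
      unfolding e2ennreal_ereal[symmetric] uminus_ereal.simps(1)[symmetric]
      by (intro e2ennreal_mono) (simp only: ereal_minus_le_minus le[OF that])
    then show "AE y in sphere_prob. ennreal (- G y) \<le> e2ennreal (- u (a + r *\<^sub>R y))"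
      using AE_sphere_prob by auto
  qed
  ultimately have "sphere_mean u a r \<le> ereal (\<integral>y. G y \<partial>sphere_prob)"
    unfolding sphere_mean_def nn_integral_sphere_indicator ereal_integral_eq[OF G]
    by (intro ereal_minus_mono) (auto simp: less_eq_ennreal.rep_eq)
  with c show ?thesis by simp
qed

lemma integrable_sphere_continuous:
  fixes G :: "'a::euclidean_space \<Rightarrow> real"
  assumes "continuous_on UNIV G"
  shows "integrable sphere_prob G"
proof -
  have "compact (G ` sphere 0 1)"
    by (intro compact_continuous_image continuous_on_subset[OF assms]) auto
  from compact_imp_bounded[OF this] obtain B where "\<And>y. norm y = 1 \<Longrightarrow> \<bar>G y\<bar> \<le> B"
    by (auto simp: bounded_iff) (metis mem_sphere_0)
  then show ?thesis
    using assms by (intro sphere_integrable_bounded[where B=B] borel_measurable_continuous_onI) auto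
qed

text \<open>Let continuous \<open>G k\<close> decrease to \<open>u\<close> on the sphere. The integrals of the positive parts are finite
and decrease, those of the negative parts increase, so \<open>\<integral> G k\<close> tends to the mean of \<open>u\<close> even if that
mean is \<open>-\<infinity>\<close>.\<close>

lemma le_sphere_meanI:
  fixes u :: "'a::euclidean_space \<Rightarrow> ereal"
  assumes usc: "usc_on (sphere 0 1) (\<lambda>y. u (a + r *\<^sub>R y))"
    and fin: "\<And>y. norm y = 1 \<Longrightarrow> u (a + r *\<^sub>R y) < \<infinity>"
    and le: "\<And>G. continuous_on UNIV G \<Longrightarrow> (\<And>y. norm y = 1 \<Longrightarrow> u (a + r *\<^sub>R y) \<le> ereal (G y)) \<Longrightarrow>
                 c \<le> ereal (\<integral>y. G y \<partial>sphere_prob)"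
  shows "c \<le> sphere_mean u a r"
proof -
  let ?f = "\<lambda>y. u (a + r *\<^sub>R y)"
  obtain G :: "nat \<Rightarrow> 'a \<Rightarrow> real" where G: "\<And>k. continuous_on UNIV (G k)" "\<And>k y. G (Suc k) y \<le> G k y"
    "\<And>k y. y \<in> sphere 0 1 \<Longrightarrow> ?f y \<le> ereal (G k y)"
    "\<And>y. y \<in> sphere 0 1 \<Longrightarrow> (\<lambda>k. ereal (G k y)) \<longlonglongrightarrow> ?f y"
    by (rule usc_on_compact_approx[OF usc]) (use fin in auto)
  have Gm [measurable]: "G k \<in> borel_measurable borel" for k
    using G(1) by (rule borel_measurable_continuous_onI)
  have int: "integrable sphere_prob (G k)" for k by (rule integrable_sphere_continuous) fact
  have dec: "decseq (\<lambda>k. G k y)" for y using G(2) by (simp add: decseq_SucI)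
  have lim1: "(\<lambda>k. ennreal (G k y)) \<longlonglongrightarrow> e2ennreal (?f y)" if "norm y = 1" for y
    using tendsto_e2ennrealI[OF G(4)[of y]] that by (simp add: e2ennreal_ereal)
  have lim2: "(\<lambda>k. ennreal (- G k y)) \<longlonglongrightarrow> e2ennreal (- ?f y)" if "norm y = 1" for y
  proof -
    have "(\<lambda>k. - ereal (G k y)) \<longlonglongrightarrow> - ?f y" using G(4)[of y] that by (intro tendsto_uminus_ereal) auto
    from tendsto_e2ennrealI[OF this] show ?thesis by (simp add: e2ennreal_ereal)
  qed
  have A: "(\<lambda>k. \<integral>\<^sup>+ y. ennreal (G k y) \<partial>sphere_prob) \<longlonglongrightarrow> (\<integral>\<^sup>+ y. (INF k. ennreal (G k y)) \<partial>sphere_prob)"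
  proof -
    have fin: "(\<integral>\<^sup>+ y. ennreal (G 0 y) \<partial>sphere_prob) < \<infinity>"
      using int[of 0] unfolding real_integrable_def by (auto simp: less_top)
    have decl: "decseq (\<lambda>k y. ennreal (G k y))"
      using G(2) by (intro decseq_SucI le_funI ennreal_leI)
    have "(\<integral>\<^sup>+ y. (INF k. ennreal (G k y)) \<partial>sphere_prob) = (INF k. \<integral>\<^sup>+ y. ennreal (G k y) \<partial>sphere_prob)"
      by (rule nn_integral_monotone_convergence_INF_decseq[OF decl _ fin]) measurable
    moreover have "decseq (\<lambda>k. \<integral>\<^sup>+ y. ennreal (G k y) \<partial>sphere_prob)"
      using decl by (intro decseq_SucI nn_integral_mono) (metis decseq_SucD le_funD)
    ultimately show ?thesis by (metis LIMSEQ_INF)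
  qed
  have A': "(\<integral>\<^sup>+ y. (INF k. ennreal (G k y)) \<partial>sphere_prob) = (\<integral>\<^sup>+ y. e2ennreal (?f y) \<partial>sphere_prob)"
  proof (rule nn_integral_cong_AE)
    have "(INF k. ennreal (G k y)) = e2ennreal (?f y)" if "norm y = 1" for y
    proof (rule LIMSEQ_unique[OF _ lim1[OF that]])
      show "(\<lambda>k. ennreal (G k y)) \<longlonglongrightarrow> (INF k. ennreal (G k y))"
        by (intro LIMSEQ_INF decseq_SucI ennreal_leI G(2))
    qed
    then show "AE y in sphere_prob. (INF k. ennreal (G k y)) = e2ennreal (?f y)"
      using AE_sphere_prob by auto
  qed
  have B: "(\<lambda>k. \<integral>\<^sup>+ y. ennreal (- G k y) \<partial>sphere_prob) \<longlonglongrightarrow> (\<integral>\<^sup>+ y. (SUP k. ennreal (- G k y)) \<partial>sphere_prob)"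
  proof -
    have incl: "incseq (\<lambda>k y. ennreal (- G k y))"
      using G(2) by (intro incseq_SucI le_funI ennreal_leI) simp
    have "(\<integral>\<^sup>+ y. (SUP k. ennreal (- G k y)) \<partial>sphere_prob) = (SUP k. \<integral>\<^sup>+ y. ennreal (- G k y) \<partial>sphere_prob)"
      by (rule nn_integral_monotone_convergence_SUP[OF incl]) measurable
    moreover have "incseq (\<lambda>k. \<integral>\<^sup>+ y. ennreal (- G k y) \<partial>sphere_prob)"
      using incl by (intro incseq_SucI nn_integral_mono) (metis incseq_SucD le_funD)
    ultimately show ?thesis by (metis LIMSEQ_SUP)
  qed
  have B': "(\<integral>\<^sup>+ y. (SUP k. ennreal (- G k y)) \<partial>sphere_prob) = (\<integral>\<^sup>+ y. e2ennreal (- ?f y) \<partial>sphere_prob)"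
  proof (rule nn_integral_cong_AE)
    have "(SUP k. ennreal (- G k y)) = e2ennreal (- ?f y)" if "norm y = 1" for y
    proof (rule LIMSEQ_unique[OF _ lim2[OF that]])
      show "(\<lambda>k. ennreal (- G k y)) \<longlonglongrightarrow> (SUP k. ennreal (- G k y))"
        by (intro LIMSEQ_SUP incseq_SucI ennreal_leI) (simp add: G(2))
    qed
    then show "AE y in sphere_prob. (SUP k. ennreal (- G k y)) = e2ennreal (- ?f y)"
      using AE_sphere_prob by auto
  qed
  have fin: "(\<integral>\<^sup>+ y. e2ennreal (?f y) \<partial>sphere_prob) \<noteq> \<infinity>"
  proof -
    have "(\<integral>\<^sup>+ y. e2ennreal (?f y) \<partial>sphere_prob) \<le> (\<integral>\<^sup>+ y. ennreal (G 0 y) \<partial>sphere_prob)"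
    proof (rule nn_integral_mono_AE)
      show "AE y in sphere_prob. e2ennreal (?f y) \<le> ennreal (G 0 y)"
        using AE_sphere_prob
      proof eventually_elim
        case (elim y) then show ?case using e2ennreal_mono[OF G(3)[of y 0]] by simp
      qed
    qed
    also have "\<dots> < \<infinity>" using int[of 0] unfolding real_integrable_def by (auto simp: less_top)
    finally show ?thesis by auto
  qed
  have "(\<lambda>k. ereal (\<integral>y. G k y \<partial>sphere_prob)) \<longlonglongrightarrow> sphere_mean u a r"
    unfolding sphere_mean_def nn_integral_sphere_indicator ereal_integral_eq[OF int]
    using A B fin unfolding A' B'
    by (intro tendsto_diff_ereal_general tendsto_enn2erealI) auto
  then show ?thesis
    by (rule LIMSEQ_le_const) (use le[OF G(1)] G(3) in auto)
qed

section \<open>A maximum principle for asymptotic mean values\<close>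

text \<open>The sub-mean-value inequality on small spheres around \<open>x\<close>, stated through integrable majorants \<open>G\<close>
and up to an error \<open>O(\<rho>\<^sup>3)\<close>. For smooth \<open>u\<close> the mean exceeds \<open>u x\<close> by a multiple of \<open>\<rho>\<^sup>2\<close> times the
Laplacian plus \<open>O(\<rho>\<^sup>3)\<close>, so this error does not hide a negative Laplacian.\<close>

definition submean_at :: "('a::euclidean_space \<Rightarrow> ereal) \<Rightarrow> 'a \<Rightarrow> bool" where
  "submean_at u x \<longleftrightarrow> (\<exists>C d. 0 < d \<and> (\<forall>\<rho> G. 0 < \<rho> \<longrightarrow> \<rho> < d \<longrightarrow> integrable sphere_prob G \<longrightarrow>
     (\<forall>y. norm y = 1 \<longrightarrow> u (x + \<rho> *\<^sub>R y) \<le> ereal (G y)) \<longrightarrow>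
     u x \<le> ereal ((\<integral>y. G y \<partial>sphere_prob) + C * \<rho> ^ 3)))"

definition supermean_at :: "('a::euclidean_space \<Rightarrow> real) \<Rightarrow> 'a \<Rightarrow> bool" where
  "supermean_at H x \<longleftrightarrow> (\<exists>C d. 0 < d \<and> (\<forall>\<rho>. 0 < \<rho> \<longrightarrow> \<rho> < d \<longrightarrow>
     (\<integral>y. H (x + \<rho> *\<^sub>R y) \<partial>sphere_prob) \<le> H x + C * \<rho> ^ 3))"

lemma sphere_mean_norm_square:
  fixes x :: "'a::euclidean_space"
  shows "integrable sphere_prob (\<lambda>y. (norm (x + \<rho> *\<^sub>R y))\<^sup>2)" (is ?I)
    and "(\<integral>y. (norm (x + \<rho> *\<^sub>R y))\<^sup>2 \<partial>sphere_prob) = (norm x)\<^sup>2 + \<rho>\<^sup>2" (is ?E)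
proof -
  show ?I
    by (intro integrable_sphere_continuous continuous_intros)
  have "(\<integral>y. (norm (x + \<rho> *\<^sub>R y))\<^sup>2 \<partial>sphere_prob) = (\<integral>y. (norm x)\<^sup>2 + \<rho>\<^sup>2 + 2 * \<rho> * (y \<bullet> x) \<partial>sphere_prob)"
  proof (rule integral_cong_AE)
    show "AE y in sphere_prob. (norm (x + \<rho> *\<^sub>R y))\<^sup>2 = (norm x)\<^sup>2 + \<rho>\<^sup>2 + 2 * \<rho> * (y \<bullet> x)"
      using AE_sphere_prob
    proof eventually_elim
      case (elim y)
      then have "y \<bullet> y = 1" by (simp add: norm_eq_1)
      then show ?case
        unfolding power2_norm_eq_inner
        by (simp add: inner_add_left inner_add_right inner_commute power2_eq_square)
    qed
  qed auto
  also have "\<dots> = (norm x)\<^sup>2 + \<rho>\<^sup>2"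
    using integrable_sphere_inner(1)[of x] sphere_first_moment[of x]
    by (simp add: sphere_prob.prob_space[simplified])
  finally show ?E .
qed

text \<open>Suppose that \<open>\<Phi> = u - H + \<epsilon> |x|\<^sup>2\<close> attains its maximum at an interior point \<open>m\<close> with \<open>\<Phi> m \<noteq> -\<infinity>\<close>. Then
\<open>\<Phi> m + H - \<epsilon> |x|\<^sup>2\<close> is a real majorant of \<open>u\<close> on every small sphere around \<open>m\<close>; its mean is at most
\<open>u m - \<epsilon> \<rho>\<^sup>2 + O(\<rho>\<^sup>3)\<close>, while the inequality for \<open>u\<close> makes it at least \<open>u m - O(\<rho>\<^sup>3)\<close>. This is absurd for
small \<open>\<rho>\<close>. So the maximum lies on the boundary, where \<open>u \<le> H\<close>, and \<open>\<epsilon> \<rightarrow> 0\<close> gives the claim.\<close>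

lemma maximum_principle:
  fixes u :: "'a::euclidean_space \<Rightarrow> ereal"
  assumes K: "compact K"
    and u: "usc_on K u" "\<And>x. x \<in> K \<Longrightarrow> u x < \<infinity>" "\<And>x. x \<in> interior K \<Longrightarrow> submean_at u x"
    and H: "H \<in> borel_measurable borel" "continuous_on K H" "\<And>x. x \<in> interior K \<Longrightarrow> supermean_at H x"
    and le: "\<And>x. x \<in> K \<Longrightarrow> x \<notin> interior K \<Longrightarrow> u x \<le> ereal (H x)"
    and x: "x \<in> K"
  shows "u x \<le> ereal (H x)"
proof -
  obtain B where B: "\<And>x. x \<in> K \<Longrightarrow> norm x \<le> B" using compact_imp_bounded[OF K] by (auto simp: bounded_iff)
  have main: "u x \<le> ereal (H x + \<epsilon> * B\<^sup>2)" if \<epsilon>: "\<epsilon> > 0" for \<epsilon>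
  proof -
    define \<Phi> where "\<Phi> = (\<lambda>x. u x + ereal (\<epsilon> * (norm x)\<^sup>2 - H x))"
    have "usc_on K \<Phi>" unfolding \<Phi>_def
      by (intro usc_on_add_continuous u continuous_intros H)
    then obtain m where m: "m \<in> K" "\<And>y. y \<in> K \<Longrightarrow> \<Phi> y \<le> \<Phi> m"
      using usc_on_compact_attains_max K x by blast
    have sq: "(norm y)\<^sup>2 \<le> B\<^sup>2" if "y \<in> K" for y using B[OF that] by (intro power_mono) auto
    have "\<Phi> m \<le> ereal (\<epsilon> * B\<^sup>2)"
    proof (cases "m \<in> interior K")
      case False
      then have "\<Phi> m \<le> ereal (H m) + ereal (\<epsilon> * (norm m)\<^sup>2 - H m)"
        unfolding \<Phi>_def by (intro add_right_mono le m)
      also have "\<dots> \<le> ereal (\<epsilon> * B\<^sup>2)" using \<epsilon> sq[OF m(1)] by simp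
      finally show ?thesis .
    next
      case True
      show ?thesis
      proof (cases "u m")
        case MInf
        then show ?thesis by (simp add: \<Phi>_def)
      next
        case PInf
        then show ?thesis using u(2)[OF m(1)] by simp
      next
        case (real t)
        define p where "p = t + \<epsilon> * (norm m)\<^sup>2 - H m"
        have \<Phi>m: "\<Phi> m = ereal p" by (simp add: \<Phi>_def p_def real)
        obtain C1 d1 where 1: "0 < d1" "\<And>\<rho> G. 0 < \<rho> \<Longrightarrow> \<rho> < d1 \<Longrightarrow> integrable sphere_prob G \<Longrightarrow>
           (\<And>y. norm y = 1 \<Longrightarrow> u (m + \<rho> *\<^sub>R y) \<le> ereal (G y)) \<Longrightarrow>
           u m \<le> ereal ((\<integral>y. G y \<partial>sphere_prob) + C1 * \<rho> ^ 3)"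
          using u(3)[OF True] unfolding submean_at_def by metis
        obtain C2 d2 where 2: "0 < d2" "\<And>\<rho>. 0 < \<rho> \<Longrightarrow> \<rho> < d2 \<Longrightarrow>
           (\<integral>y. H (m + \<rho> *\<^sub>R y) \<partial>sphere_prob) \<le> H m + C2 * \<rho> ^ 3"
          using H(3)[OF True] unfolding supermean_at_def by metis
        obtain d3 where d3: "d3 > 0" "cball m d3 \<subseteq> K"
          using True unfolding mem_interior_cball by auto
        \<comment> \<open>so small that the gain \<open>\<epsilon> \<rho>\<^sup>2\<close> exceeds both errors of order \<open>\<rho>\<^sup>3\<close>\<close>
        define q where "q = \<epsilon> / (\<bar>C1\<bar> + \<bar>C2\<bar> + 1)"
        have "q > 0" unfolding q_def using \<epsilon> by (intro divide_pos_pos) auto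
        define \<rho> where "\<rho> = min (min d1 d2) (min d3 q) / 2"
        from \<open>q > 0\<close> have \<rho>: "0 < \<rho>" "\<rho> < d1" "\<rho> < d2" "\<rho> \<le> d3" "\<rho> < q"
          using 1(1) 2(1) d3(1) unfolding \<rho>_def by (auto simp: min_def)
        define G where "G = (\<lambda>y. p + H (m + \<rho> *\<^sub>R y) - \<epsilon> * (norm (m + \<rho> *\<^sub>R y))\<^sup>2)"
        have inK: "m + \<rho> *\<^sub>R y \<in> K" if "norm y = 1" for y
          using d3(2) \<rho> that by (auto simp: subset_iff dist_norm)
        have "compact (H ` K)" using H(2) K by (rule compact_continuous_image)
        from compact_imp_bounded[OF this] obtain BH where BH: "\<And>x. x \<in> K \<Longrightarrow> \<bar>H x\<bar> \<le> BH"
          by (auto simp: bounded_iff)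
        have HI: "integrable sphere_prob (\<lambda>y. H (m + \<rho> *\<^sub>R y))"
          by (rule sphere_integrable_bounded[where B=BH]) (use H(1) BH inK in measurable)
        have GI: "integrable sphere_prob G"
          unfolding G_def using HI sphere_mean_norm_square(1)[of m \<rho>] by simp
        have "u m \<le> ereal ((\<integral>y. G y \<partial>sphere_prob) + C1 * \<rho> ^ 3)"
        proof (rule 1(2)[OF \<rho>(1,2) GI])
          fix y :: 'a assume y: "norm y = 1"
          have "\<Phi> (m + \<rho> *\<^sub>R y) \<le> ereal p" using m(2)[OF inK[OF y]] \<Phi>m by simp
          then show "u (m + \<rho> *\<^sub>R y) \<le> ereal (G y)"
            unfolding \<Phi>_def G_def by (cases "u (m + \<rho> *\<^sub>R y)") auto
        qed
        then have "t \<le> (\<integral>y. G y \<partial>sphere_prob) + C1 * \<rho> ^ 3" by (simp add: real)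
        also have "(\<integral>y. G y \<partial>sphere_prob) = p + (\<integral>y. H (m + \<rho> *\<^sub>R y) \<partial>sphere_prob) - \<epsilon> * ((norm m)\<^sup>2 + \<rho>\<^sup>2)"
          unfolding G_def using HI sphere_mean_norm_square[of m \<rho>]
          by (simp add: sphere_prob.prob_space[simplified])
        also have "(\<integral>y. H (m + \<rho> *\<^sub>R y) \<partial>sphere_prob) \<le> H m + C2 * \<rho> ^ 3" by (rule 2(2)[OF \<rho>(1,3)])
        finally have "\<epsilon> * \<rho>\<^sup>2 \<le> ((C1 + C2) * \<rho>) * \<rho>\<^sup>2"
          by (simp add: p_def algebra_simps power2_eq_square power3_eq_cube)
        then have "\<epsilon> \<le> (C1 + C2) * \<rho>" using \<rho>(1) by simp
        also have "\<dots> \<le> (\<bar>C1\<bar> + \<bar>C2\<bar> + 1) * \<rho>" using \<rho>(1) by (intro mult_right_mono) auto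
        also have "\<dots> < \<epsilon>" using \<rho>(5) unfolding q_def by (simp add: less_divide_eq mult.commute)
        finally show ?thesis by simp
      qed
    qed
    then have "\<Phi> x \<le> ereal (\<epsilon> * B\<^sup>2)" using m(2)[OF x] by simp
    then have "u x \<le> ereal (H x + \<epsilon> * B\<^sup>2 - \<epsilon> * (norm x)\<^sup>2)"
      unfolding \<Phi>_def by (cases "u x") auto
    also have "\<dots> \<le> ereal (H x + \<epsilon> * B\<^sup>2)" using \<epsilon> by simp
    finally show ?thesis .
  qed
  show ?thesis
  proof (rule ereal_le_epsilon2)
    fix e :: real assume e: "0 < e"
    have "u x \<le> ereal (H x + e / (B\<^sup>2 + 1) * B\<^sup>2)"
      by (rule main) (use e in \<open>auto intro!: divide_pos_pos add_nonneg_pos\<close>)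
    also have "e / (B\<^sup>2 + 1) * B\<^sup>2 \<le> e"
      using e by (simp add: divide_le_eq add_nonneg_pos)
    finally show "u x \<le> ereal (H x) + ereal e" by simp
  qed
qed

section \<open>The Poisson kernel\<close>

definition poisson_kernel :: "'a::euclidean_space \<Rightarrow> 'a \<Rightarrow> real" where
  "poisson_kernel x y = (1 - (norm x)\<^sup>2) / norm (x - y) ^ DIM('a)"

lemma powr_neg_taylor:
  fixes \<kappa> :: real
  assumes "\<kappa> > 0"
  obtains A where "A \<ge> 0" "\<And>s. \<bar>s\<bar> \<le> 1/2 \<Longrightarrow>
     \<bar>(1 + s) powr (- \<kappa>) - (1 - \<kappa> * s + \<kappa> * (\<kappa> + 1) / 2 * s\<^sup>2)\<bar> \<le> A * \<bar>s\<bar> ^ 3"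
proof -
  define diff where "diff = (\<lambda>m::nat. \<lambda>t::real. (-1) ^ m * pochhammer \<kappa> m * (1 + t) powr (- \<kappa> - real m))"
  define A where "A = pochhammer \<kappa> 3 * (1/2) powr (- \<kappa> - 3) / 6"
  have p: "pochhammer \<kappa> 3 \<ge> 0" using assms by (simp add: pochhammer_nonneg)
  have "\<bar>(1 + s) powr (- \<kappa>) - (1 - \<kappa> * s + \<kappa> * (\<kappa> + 1) / 2 * s\<^sup>2)\<bar> \<le> A * \<bar>s\<bar> ^ 3" if s: "\<bar>s\<bar> \<le> 1/2" for s
  proof -
    have D: "\<forall>m t. m < 3 \<and> \<bar>t\<bar> \<le> \<bar>s\<bar> \<longrightarrow> DERIV (diff m) t :> diff (Suc m) t"
    proof (intro allI impI)
      fix m t assume "m < (3::nat) \<and> \<bar>t\<bar> \<le> \<bar>s\<bar>"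
      then have "1 + t > 0" using s by auto
      then show "DERIV (diff m) t :> diff (Suc m) t"
        unfolding diff_def
        by (auto intro!: derivative_eq_intros simp: pochhammer_Suc algebra_simps)
    qed
    obtain t where t: "\<bar>t\<bar> \<le> \<bar>s\<bar>"
      "diff 0 s = (\<Sum>m<3. diff m 0 / fact m * s ^ m) + diff 3 t / fact 3 * s ^ 3"
      using Maclaurin_bi_le[of diff "diff 0" 3 s] D by blast
    have "(1 + s) powr (- \<kappa>) - (1 - \<kappa> * s + \<kappa> * (\<kappa> + 1) / 2 * s\<^sup>2) = diff 3 t / 6 * s ^ 3"
      using t(2) by (simp add: diff_def eval_nat_numeral pochhammer_Suc algebra_simps)
    moreover have bound: "\<bar>diff 3 t\<bar> \<le> pochhammer \<kappa> 3 * (1/2) powr (- \<kappa> - 3)"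
    proof -
      have "(1 + t) powr (- \<kappa> - 3) \<le> (1/2) powr (- \<kappa> - 3)"
        by (rule powr_mono2') (use t s assms in auto)
      then show ?thesis unfolding diff_def using p by (auto simp: abs_mult intro!: mult_left_mono)
    qed
    ultimately have "\<bar>(1 + s) powr (- \<kappa>) - (1 - \<kappa> * s + \<kappa> * (\<kappa> + 1) / 2 * s\<^sup>2)\<bar> = \<bar>diff 3 t\<bar> / 6 * \<bar>s\<bar> ^ 3"
      by (simp only: abs_mult abs_divide power_abs abs_numeral)
    also have "\<dots> \<le> A * \<bar>s\<bar> ^ 3"
      unfolding A_def by (intro mult_right_mono divide_right_mono) (use bound in auto)
    finally show ?thesis .
  qed
  moreover have "A \<ge> 0" using p by (simp add: A_def)
  ultimately show ?thesis using that by blast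
qed

text \<open>The left factor is the numerator of the Poisson kernel at \<open>x + \<rho> \<theta>\<close>, with \<open>N = 1 - |x|\<^sup>2\<close> and
\<open>a = x \<bullet> \<theta>\<close>; the right factor is the expansion of its denominator, with remainder \<open>E\<close>. Every term
other than those of degree at most \<open>2\<close> in \<open>\<rho>\<close> carries a factor \<open>\<rho>\<^sup>3\<close>.\<close>

lemma expansion_remainder:
  fixes T1 T2 T3 E B \<rho> N a :: real
  assumes \<rho>: "0 < \<rho>" "\<rho> \<le> 1" and b: "\<bar>T1\<bar> \<le> B" "\<bar>T2\<bar> \<le> B" "\<bar>T3\<bar> \<le> B" "\<bar>E\<bar> \<le> B * \<rho>^3"
    and N: "\<bar>N\<bar> \<le> 1" and a: "\<bar>a\<bar> \<le> 1"
  shows "\<bar>(N - 2 * \<rho> * a - \<rho>\<^sup>2) * (1 + \<rho> * T1 + \<rho>\<^sup>2 * T2 + \<rho>^3 * T3 + E)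
      - (N + \<rho> * (N * T1 - 2 * a) + \<rho>\<^sup>2 * (N * T2 - 2 * a * T1 - 1))\<bar> \<le> 12 * B * \<rho>^3"
proof -
  define e where "e = E / \<rho>^3"
  have E: "E = \<rho>^3 * e" using \<rho> by (simp add: e_def)
  have e: "\<bar>e\<bar> \<le> B" using b(4) \<rho> unfolding e_def abs_divide by (subst pos_divide_le_eq) auto
  have m: "\<bar>u * v\<bar> \<le> B" if "\<bar>u\<bar> \<le> 1" "\<bar>v\<bar> \<le> B" for u v :: real
    using mult_mono[OF that] that by (simp add: abs_mult)
  have r: "\<bar>\<rho>\<bar> \<le> 1" "\<bar>\<rho>\<^sup>2\<bar> \<le> 1" using \<rho> by (auto simp: power_le_one)
  have ra: "\<bar>\<rho> * a\<bar> \<le> 1" using mult_mono[OF r(1) a] by (simp add: abs_mult)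
  define F where "F = N - 2 * (\<rho> * a) - \<rho>\<^sup>2"
  have FN: "N - 2 * \<rho> * a - \<rho>\<^sup>2 = F" by (simp add: F_def)
  have F: "\<bar>F\<bar> \<le> 4" unfolding F_def using N ra r by linarith
  have "F * (1 + \<rho> * T1 + \<rho>\<^sup>2 * T2)
      - (N + \<rho> * (N * T1 - 2 * a) + \<rho>\<^sup>2 * (N * T2 - 2 * a * T1 - 1)) = \<rho>^3 * (- 2 * (a * T2) - T1 - \<rho> * T2)"
    unfolding F_def by (simp add: algebra_simps power2_eq_square power3_eq_cube)
  then have *: "(N - 2 * \<rho> * a - \<rho>\<^sup>2) * (1 + \<rho> * T1 + \<rho>\<^sup>2 * T2 + \<rho>^3 * T3 + E)
      - (N + \<rho> * (N * T1 - 2 * a) + \<rho>\<^sup>2 * (N * T2 - 2 * a * T1 - 1))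
     = \<rho>^3 * (- 2 * (a * T2) - T1 - \<rho> * T2 + F * (T3 + e))"
    unfolding E FN by (simp add: ring_distribs mult_ac)
  have "\<bar>T3 + e\<bar> \<le> 2 * B" using b(3) e by linarith
  then have "\<bar>F * (T3 + e)\<bar> \<le> 4 * (2 * B)" unfolding abs_mult using F by (intro mult_mono) auto
  then have "\<bar>- 2 * (a * T2) - T1 - \<rho> * T2 + F * (T3 + e)\<bar> \<le> 12 * B"
    using m[OF a b(2)] b(1) m[OF r(1) b(2)] by linarith
  then show ?thesis unfolding * using \<rho> by (simp add: abs_mult)
qed

text \<open>With \<open>z = x - y\<close>, \<open>Z = |z|\<^sup>2\<close> and \<open>\<kappa> = DIM('a) / 2\<close>, the denominator at \<open>x + \<rho> \<theta>\<close> is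
\<open>(Z (1 + s)) powr \<kappa>\<close> with \<open>s = (2 \<rho> (z \<bullet> \<theta>) + \<rho>\<^sup>2) / Z\<close>. Expand to second order in \<open>\<rho>\<close> and average over
\<open>\<theta>\<close>: the first moments vanish, and by the second moments the coefficient of \<open>\<rho>\<^sup>2\<close> is a multiple of
\<open>1 - |x|\<^sup>2 + 2 (x \<bullet> z) - Z\<close>, which is \<open>0\<close> because \<open>|y| = 1\<close>. The remainder is uniform in \<open>y\<close> because
\<open>norm z \<ge> 1 - norm x\<close>; this uniformity makes the estimate pass to Poisson integrals.\<close>

lemma poisson_kernel_local_mean:
  fixes x :: "'a::euclidean_space"
  assumes x: "norm x < 1"
  obtains C d where "C \<ge> 0" "0 < d" "d < 1 - norm x"
    "\<And>\<rho> y. 0 < \<rho> \<Longrightarrow> \<rho> < d \<Longrightarrow> norm y = 1 \<Longrightarrow>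
       \<bar>(\<integral>\<theta>. poisson_kernel (x + \<rho> *\<^sub>R \<theta>) y \<partial>sphere_prob) - poisson_kernel x y\<bar> \<le> C * \<rho> ^ 3"
proof -
  define n where "n = DIM('a)"
  define \<kappa> where "\<kappa> = real n / 2"
  have \<kappa>: "\<kappa> > 0" by (simp add: \<kappa>_def n_def)
  obtain A where A: "A \<ge> 0" "\<And>s. \<bar>s\<bar> \<le> 1/2 \<Longrightarrow>
     \<bar>(1 + s) powr (- \<kappa>) - (1 - \<kappa> * s + \<kappa> * (\<kappa> + 1) / 2 * s\<^sup>2)\<bar> \<le> A * \<bar>s\<bar> ^ 3"
    using powr_neg_taylor[OF \<kappa>] by blast
  define \<delta> where "\<delta> = 1 - norm x"
  have \<delta>: "0 < \<delta>" "\<delta> \<le> 1" using x by (auto simp: \<delta>_def)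
  define D where "D = 1 / \<delta>"
  have D: "D \<ge> 1" using \<delta> by (simp add: D_def)
  \<comment> \<open>for \<open>\<rho> < d\<close> this ensures \<open>\<bar>s\<bar> \<le> 3 D \<rho> \<le> 1/2\<close> below\<close>
  define d where "d = \<delta> / 6"
  have d: "0 < d" "d < 1 - norm x" "d \<le> 1" using \<delta> by (auto simp: d_def simp flip: \<delta>_def)
  \<comment> \<open>the sum of the bounds of \<open>T1\<close>, \<open>T2\<close>, \<open>T3\<close> and \<open>E / \<rho>\<^sup>3\<close> below\<close>
  define B where "B = 2 * \<kappa> * D + \<kappa> * D\<^sup>2 + 2 * \<kappa> * (\<kappa> + 1) * D\<^sup>2 + \<kappa> * (\<kappa> + 1) / 2 * (4 * D^3 + D^4) + A * (3 * D)^3"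
  have B0: "B \<ge> 0" using \<kappa> D A(1) by (auto simp: B_def intro!: add_nonneg_nonneg mult_nonneg_nonneg)
  define C where "C = 12 * B * D ^ n"
  have C0: "C \<ge> 0" using B0 D by (simp add: C_def)
  have "\<bar>(\<integral>\<theta>. poisson_kernel (x + \<rho> *\<^sub>R \<theta>) y \<partial>sphere_prob) - poisson_kernel x y\<bar> \<le> C * \<rho> ^ 3"
    if \<rho>: "0 < \<rho>" "\<rho> < d" and y: "norm y = 1" for \<rho> y
  proof -
    define z where "z = x - y"
    define Z where "Z = (norm z)\<^sup>2"
    define N where "N = 1 - (norm x)\<^sup>2"
    have \<rho>1: "\<rho> \<le> 1" using \<rho> d by simp
    have nz: "norm z \<ge> \<delta>" unfolding z_def \<delta>_def using norm_triangle_ineq2[of y x] y by (simp add: norm_minus_commute)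
    then have z0: "norm z > 0" using \<delta> by linarith
    have Z0: "Z > 0" using z0 by (simp add: Z_def)
    have Zdot: "Z = z \<bullet> z" by (simp add: Z_def power2_norm_eq_inner)
    have nzD: "1 / norm z \<le> D" unfolding D_def using nz \<delta> by (simp add: frac_le)
    have qD: "1 / Z \<le> D\<^sup>2"
    proof -
      have "(1 / norm z)\<^sup>2 \<le> D\<^sup>2" using nzD by (intro power_mono) auto
      then show ?thesis by (simp add: Z_def power_divide)
    qed
    have N1: "\<bar>N\<bar> \<le> 1" using x by (simp add: N_def power_le_one abs_le_iff)
    have Npos: "N \<ge> 0" using x by (simp add: N_def power_le_one)
    define a where "a = (\<lambda>\<theta>. x \<bullet> \<theta>)"
    define p where "p = (\<lambda>\<theta>. (z \<bullet> \<theta>) / Z)"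
    define q where "q = 1 / Z"
    define T1 where "T1 = (\<lambda>\<theta>. - 2 * \<kappa> * p \<theta>)"
    define T2 where "T2 = (\<lambda>\<theta>. - \<kappa> * q + 2 * \<kappa> * (\<kappa> + 1) * (p \<theta>)\<^sup>2)"
    define P where "P = (\<lambda>\<theta>. N + \<rho> * (N * T1 \<theta> - 2 * a \<theta>) + \<rho>\<^sup>2 * (N * T2 \<theta> - 2 * a \<theta> * T1 \<theta> - 1))"
    have pw: "\<bar>poisson_kernel (x + \<rho> *\<^sub>R \<theta>) y * norm z ^ n - P \<theta>\<bar> \<le> 12 * B * \<rho> ^ 3"
      if \<theta>: "norm \<theta> = 1" for \<theta>
    proof -
      define s where "s = 2 * \<rho> * p \<theta> + \<rho>\<^sup>2 * q"
      define T3 where "T3 = \<kappa> * (\<kappa> + 1) / 2 * (4 * p \<theta> * q + \<rho> * q\<^sup>2)"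
      define E where "E = (1 + s) powr (- \<kappa>) - (1 - \<kappa> * s + \<kappa> * (\<kappa> + 1) / 2 * s\<^sup>2)"
      have T: "(1 + s) powr (- \<kappa>) = 1 + \<rho> * T1 \<theta> + \<rho>\<^sup>2 * T2 \<theta> + \<rho>^3 * T3 + E"
        unfolding E_def s_def T1_def T2_def T3_def
        by (simp add: field_simps power2_eq_square power3_eq_cube)
      have a1: "\<bar>a \<theta>\<bar> \<le> 1" unfolding a_def using Cauchy_Schwarz_ineq2[of x \<theta>] \<theta> x by simp
      have pD: "\<bar>p \<theta>\<bar> \<le> D"
      proof -
        have "\<bar>p \<theta>\<bar> \<le> norm z / Z" unfolding p_def
          using Cauchy_Schwarz_ineq2[of z \<theta>] \<theta> Z0 by (simp add: divide_right_mono)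
        also have "\<dots> = 1 / norm z" using z0 by (simp add: Z_def power2_eq_square)
        finally show ?thesis using nzD by simp
      qed
      have q0: "0 \<le> q" "\<bar>q\<bar> \<le> D\<^sup>2" using qD Z0 by (auto simp: q_def)
      have p2: "\<bar>(p \<theta>)\<^sup>2\<bar> \<le> D\<^sup>2" using power_mono[OF pD, of 2] by simp
      have sD: "\<bar>s\<bar> \<le> 3 * D * \<rho>"
      proof -
        have "\<bar>2 * \<rho> * p \<theta>\<bar> \<le> 2 * (\<rho> * D)" using pD \<rho> by (simp add: abs_mult)
        moreover have "\<bar>\<rho>\<^sup>2 * q\<bar> \<le> \<rho>\<^sup>2 * D\<^sup>2" using q0 by (simp add: abs_mult mult_left_mono)
        moreover have "\<rho>\<^sup>2 * D\<^sup>2 \<le> \<rho> * D"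
        proof -
          have "\<rho> * D \<le> 1" using \<rho> \<delta> by (simp add: D_def d_def divide_le_eq)
          then have "(\<rho> * D) * (\<rho> * D) \<le> 1 * (\<rho> * D)" using \<rho> D by (intro mult_right_mono) auto
          then show ?thesis by (simp add: power2_eq_square algebra_simps)
        qed
        ultimately have "\<bar>s\<bar> \<le> 3 * (\<rho> * D)" unfolding s_def by linarith
        then show ?thesis by (simp add: mult_ac)
      qed
      have s2: "\<bar>s\<bar> \<le> 1/2"
      proof -
        have "3 * D * \<rho> \<le> 3 * D * d" using \<rho> D by simp
        also have "\<dots> = 1/2" using \<delta> by (simp add: D_def d_def)
        finally show ?thesis using sD by simp
      qed
      have k: "\<kappa> * D \<ge> 0" "\<kappa> * D\<^sup>2 \<ge> 0" "\<kappa> * (\<kappa> + 1) * D\<^sup>2 \<ge> 0" "\<kappa> * (\<kappa> + 1) / 2 * (4 * D^3 + D^4) \<ge> 0"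
        "A * (3 * D)^3 \<ge> 0"
        using \<kappa> D A(1) by (auto intro!: mult_nonneg_nonneg add_nonneg_nonneg)
      have E: "\<bar>E\<bar> \<le> B * \<rho> ^ 3"
      proof -
        have "\<bar>E\<bar> \<le> A * \<bar>s\<bar> ^ 3" unfolding E_def by (rule A(2)[OF s2])
        also have "\<dots> \<le> A * (3 * D * \<rho>) ^ 3" using sD A(1) by (intro mult_left_mono power_mono) auto
        also have "\<dots> = A * (3 * D)^3 * \<rho> ^ 3" by (simp add: power_mult_distrib)
        also have "\<dots> \<le> B * \<rho> ^ 3" using k \<rho> by (intro mult_right_mono) (auto simp: B_def)
        finally show ?thesis .
      qed
      have t1: "\<bar>T1 \<theta>\<bar> \<le> B"
      proof -
        have "\<bar>T1 \<theta>\<bar> \<le> 2 * \<kappa> * D" unfolding T1_def using pD \<kappa> by (simp add: abs_mult)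
        then show ?thesis using k unfolding B_def by linarith
      qed
      have t2: "\<bar>T2 \<theta>\<bar> \<le> B"
      proof -
        have "\<bar>- \<kappa> * q\<bar> \<le> \<kappa> * D\<^sup>2" using q0 \<kappa> by (simp add: abs_mult)
        moreover have "\<bar>2 * \<kappa> * (\<kappa> + 1) * (p \<theta>)\<^sup>2\<bar> \<le> 2 * \<kappa> * (\<kappa> + 1) * D\<^sup>2"
          using p2 \<kappa> by (simp add: abs_mult)
        ultimately show ?thesis using k unfolding B_def T2_def by linarith
      qed
      have t3: "\<bar>T3\<bar> \<le> B"
      proof -
        have "\<bar>4 * p \<theta> * q\<bar> \<le> 4 * D^3"
        proof -
          have "\<bar>p \<theta>\<bar> * \<bar>q\<bar> \<le> D * D\<^sup>2" by (rule mult_mono[OF pD q0(2)]) (use D in auto)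
          then show ?thesis by (simp add: abs_mult power2_eq_square power3_eq_cube)
        qed
        moreover have "\<bar>\<rho> * q\<^sup>2\<bar> \<le> D^4"
        proof -
          have "\<bar>q\<bar> * \<bar>q\<bar> \<le> D\<^sup>2 * D\<^sup>2" by (rule mult_mono[OF q0(2) q0(2)]) (use D in auto)
          then have "\<rho> * (\<bar>q\<bar> * \<bar>q\<bar>) \<le> 1 * (D\<^sup>2 * D\<^sup>2)" using \<rho> \<rho>1 q0(2) by (intro mult_mono) auto
          then show ?thesis using \<rho> by (simp add: abs_mult power2_eq_square power4_eq_xxxx)
        qed
        ultimately have "\<bar>4 * p \<theta> * q + \<rho> * q\<^sup>2\<bar> \<le> 4 * D^3 + D^4" by linarith
        then have "\<bar>T3\<bar> \<le> \<kappa> * (\<kappa> + 1) / 2 * (4 * D^3 + D^4)"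
          unfolding T3_def abs_mult using \<kappa> by (simp add: mult_left_mono)
        then show ?thesis using k unfolding B_def by linarith
      qed
      have Nx: "1 - (norm (x + \<rho> *\<^sub>R \<theta>))\<^sup>2 = N - 2 * \<rho> * a \<theta> - \<rho>\<^sup>2"
      proof -
        have "\<theta> \<bullet> \<theta> = 1" using \<theta> by (simp add: norm_eq_1)
        then show ?thesis unfolding N_def a_def power2_norm_eq_inner
          by (simp add: inner_add_left inner_add_right inner_commute power2_eq_square)
      qed
      have w2: "(norm (x + \<rho> *\<^sub>R \<theta> - y))\<^sup>2 = Z * (1 + s)"
      proof -
        have "\<theta> \<bullet> \<theta> = 1" using \<theta> by (simp add: norm_eq_1)
        have zz: "x + \<rho> *\<^sub>R \<theta> - y = z + \<rho> *\<^sub>R \<theta>" by (simp add: z_def)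
        have "Z * s = 2 * \<rho> * (z \<bullet> \<theta>) + \<rho>\<^sup>2" using Z0 by (simp add: s_def p_def q_def distrib_left)
        then show ?thesis unfolding power2_norm_eq_inner distrib_left zz using \<open>\<theta> \<bullet> \<theta> = 1\<close>
          by (simp add: inner_add_left inner_add_right inner_commute power2_eq_square Zdot)
      qed
      have s1: "1 + s > 0" using s2 by auto
      have wpos: "norm (x + \<rho> *\<^sub>R \<theta> - y) > 0"
        using w2 Z0 s1 by (metis mult_pos_pos power2_eq_square norm_ge_zero order_le_less mult_zero_left less_irrefl)
      have pn: "norm w ^ n = ((norm w)\<^sup>2) powr \<kappa>" if "norm w > 0" for w :: 'a
      proof -
        have "norm w ^ n = norm w powr (2 * \<kappa>)" unfolding \<kappa>_def by (simp add: powr_realpow[OF that])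
        also have "\<dots> = (norm w powr 2) powr \<kappa>" by (simp only: powr_powr)
        also have "norm w powr 2 = (norm w)\<^sup>2" using that by (simp only: powr_numeral)
        finally show ?thesis .
      qed
      have "norm (x + \<rho> *\<^sub>R \<theta> - y) ^ n = norm z ^ n * (1 + s) powr \<kappa>"
        unfolding pn[OF wpos] pn[OF z0] w2 using Z0 s1 by (simp add: powr_mult Z_def)
      then have "poisson_kernel (x + \<rho> *\<^sub>R \<theta>) y * norm z ^ n = (N - 2 * \<rho> * a \<theta> - \<rho>\<^sup>2) * (1 + s) powr (- \<kappa>)"
        unfolding poisson_kernel_def Nx n_def[symmetric] using z0 s1 by (simp add: powr_minus divide_inverse)
      then show ?thesis
        unfolding T P_def using expansion_remainder[OF \<rho>(1) \<rho>1 t1 t2 t3 E N1 a1] by simp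
    qed
    have p_alt: "p = (\<lambda>\<theta>. (\<theta> \<bullet> z) * q)" "a = (\<lambda>\<theta>. \<theta> \<bullet> x)"
      by (auto simp: p_def q_def a_def inner_commute)
    have moments: "integrable sphere_prob P" "(\<integral>\<theta>. P \<theta> \<partial>sphere_prob) = N"
    proof -
      \<comment> \<open>\<open>P\<close> as a polynomial in the inner products whose moments are known\<close>
      define c1 where "c1 = \<rho> * N * (- 2 * \<kappa>) * q"
      define c2 where "c2 = \<rho>\<^sup>2 * N * (2 * \<kappa> * (\<kappa> + 1)) * q\<^sup>2"
      define c3 where "c3 = \<rho>\<^sup>2 * 4 * \<kappa> * q"
      define c0 where "c0 = N + \<rho>\<^sup>2 * (N * (- \<kappa> * q) - 1)"
      have Peq: "P = (\<lambda>\<theta>. c0 + c1 * (\<theta> \<bullet> z) - 2 * \<rho> * (\<theta> \<bullet> x) + c2 * ((\<theta> \<bullet> z) * (\<theta> \<bullet> z)) + c3 * ((\<theta> \<bullet> x) * (\<theta> \<bullet> z)))"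
        unfolding P_def T1_def T2_def p_alt c0_def c1_def c2_def c3_def
        by (auto simp: fun_eq_iff algebra_simps power2_eq_square)
      have "y \<bullet> y = 1" using y by (simp add: norm_eq_1)
      then have NZ: "N + 2 * (x \<bullet> z) - Z = 0"
        unfolding N_def Z_def z_def power2_norm_eq_inner
        by (simp add: inner_diff_left inner_diff_right inner_commute)
      have "c0 + c2 * ((z \<bullet> z) / real n) + c3 * ((x \<bullet> z) / real n) = N + \<rho>\<^sup>2 * ((N + 2 * (x \<bullet> z) - Z) / Z)"
        unfolding c0_def c2_def c3_def q_def \<kappa>_def Zdot[symmetric] using Z0
        by (simp add: field_simps power2_eq_square n_def)
      then have val: "c0 + c2 * ((z \<bullet> z) / real n) + c3 * ((x \<bullet> z) / real n) = N"
        unfolding NZ by simp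
      have m1: "has_bochner_integral sphere_prob (\<lambda>\<theta>. \<theta> \<bullet> v) 0" for v :: 'a
        by (simp add: has_bochner_integral_iff integrable_sphere_inner sphere_first_moment)
      have m2: "has_bochner_integral sphere_prob (\<lambda>\<theta>. (\<theta> \<bullet> v) * (\<theta> \<bullet> w)) ((v \<bullet> w) / real n)" for v w :: 'a
        by (simp add: has_bochner_integral_iff integrable_sphere_inner sphere_second_moment n_def)
      have m0: "has_bochner_integral (sphere_prob :: 'a measure) (\<lambda>\<theta>. c) c" for c :: real
        by (simp add: has_bochner_integral_iff sphere_prob.prob_space[simplified])
      have "has_bochner_integral sphere_prob P
        (c0 + c1 * 0 - 2 * \<rho> * 0 + c2 * ((z \<bullet> z) / real n) + c3 * ((x \<bullet> z) / real n))"
        unfolding Peq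
        by (intro has_bochner_integral_add has_bochner_integral_diff has_bochner_integral_mult_right m0 m1 m2)
      then show "integrable sphere_prob P" and
        "(\<integral>\<theta>. P \<theta> \<partial>sphere_prob) = N"
        unfolding has_bochner_integral_iff using val by auto
    qed
    let ?K = "\<lambda>\<theta>. poisson_kernel (x + \<rho> *\<^sub>R \<theta>) y * norm z ^ n"
    have diffI: "integrable sphere_prob (\<lambda>\<theta>. ?K \<theta> - P \<theta>)"
      by (rule sphere_integrable_bounded[OF _ pw]) 
         (auto simp: poisson_kernel_def P_def T1_def T2_def p_def a_def)
    have "(\<integral>\<theta>. ?K \<theta> \<partial>sphere_prob) = (\<integral>\<theta>. (?K \<theta> - P \<theta>) + P \<theta> \<partial>sphere_prob)" by simp
    also have "\<dots> = (\<integral>\<theta>. ?K \<theta> - P \<theta> \<partial>sphere_prob) + N"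
      using diffI moments by (subst Bochner_Integration.integral_add) auto
    finally have eq: "(\<integral>\<theta>. ?K \<theta> \<partial>sphere_prob) - N = (\<integral>\<theta>. ?K \<theta> - P \<theta> \<partial>sphere_prob)" by simp
    have "\<bar>\<integral>\<theta>. ?K \<theta> - P \<theta> \<partial>sphere_prob\<bar> \<le> 12 * B * \<rho> ^ 3"
    proof -
      have "\<bar>\<integral>\<theta>. ?K \<theta> - P \<theta> \<partial>sphere_prob\<bar> \<le> (\<integral>\<theta>. \<bar>?K \<theta> - P \<theta>\<bar> \<partial>sphere_prob)"
        by (rule integral_abs_bound)
      also have "\<dots> \<le> (\<integral>\<theta>. 12 * B * \<rho> ^ 3 \<partial>(sphere_prob :: 'a measure))"
        by (rule integral_mono_AE) (use AE_sphere_prob pw diffI in auto)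
      finally show ?thesis by (simp add: sphere_prob.prob_space[simplified])
    qed
    then have *: "\<bar>(\<integral>\<theta>. poisson_kernel (x + \<rho> *\<^sub>R \<theta>) y \<partial>sphere_prob) * norm z ^ n - N\<bar> \<le> 12 * B * \<rho> ^ 3"
      using eq by simp
    have "(\<integral>\<theta>. poisson_kernel (x + \<rho> *\<^sub>R \<theta>) y \<partial>sphere_prob) - poisson_kernel x y =
       ((\<integral>\<theta>. poisson_kernel (x + \<rho> *\<^sub>R \<theta>) y \<partial>sphere_prob) * norm z ^ n - N) * (1 / norm z) ^ n"
      using z0 by (simp add: poisson_kernel_def N_def z_def n_def field_simps)
    also have "\<bar>\<dots>\<bar> \<le> 12 * B * \<rho> ^ 3 * D ^ n"
      unfolding abs_mult by (intro mult_mono *) (use nzD B0 \<rho> in \<open>auto simp: power_mono\<close>)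
    finally show ?thesis by (simp add: C_def mult_ac)
  qed
  then show ?thesis using that[OF C0 d(1,2)] by blast
qed

section \<open>The Poisson integral\<close>

definition poisson_integral :: "('a::euclidean_space \<Rightarrow> real) \<Rightarrow> 'a \<Rightarrow> real" where
  "poisson_integral g x = (\<integral>y. poisson_kernel x y * g y \<partial>sphere_prob)"

lemma poisson_kernel_nonneg: "norm x < 1 \<Longrightarrow> 0 \<le> poisson_kernel x y"
  by (simp add: poisson_kernel_def power_le_one)

lemma poisson_kernel_0: "norm y = 1 \<Longrightarrow> poisson_kernel 0 y = 1"
  by (simp add: poisson_kernel_def)

lemma poisson_kernel_le:
  fixes x y :: "'a::euclidean_space"
  assumes "norm x \<le> r" "r < 1" "norm y = 1"
  shows "poisson_kernel x y \<le> 1 / (1 - r) ^ DIM('a)"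
proof -
  have "1 - r \<le> norm (x - y)"
    using norm_triangle_ineq2[of y x] assms by (simp add: norm_minus_commute)
  then have "(1 - r) ^ DIM('a) \<le> norm (x - y) ^ DIM('a)"
    using assms by (intro power_mono) auto
  moreover have "(1 - r) ^ DIM('a) > 0" using assms by simp
  ultimately show ?thesis unfolding poisson_kernel_def by (intro frac_le) auto
qed

lemma poisson_kernel_measurable [measurable]:
  assumes [measurable]: "f \<in> M \<rightarrow>\<^sub>M borel" "g \<in> M \<rightarrow>\<^sub>M borel"
  shows "(\<lambda>p. poisson_kernel (f p) (g p)) \<in> borel_measurable M"
  unfolding poisson_kernel_def by measurable

lemma poisson_integral_measurable [measurable]:
  fixes g :: "'a::euclidean_space \<Rightarrow> real"
  assumes [measurable]: "g \<in> borel_measurable borel"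
  shows "poisson_integral g \<in> borel_measurable borel"
  unfolding poisson_integral_def[abs_def] by measurable

lemma poisson_integrable:
  fixes x :: "'a::euclidean_space"
  assumes g: "integrable sphere_prob g" and x: "norm x < 1"
  shows "integrable sphere_prob (\<lambda>y. poisson_kernel x y * g y)"
proof -
  define B where "B = 1 / (1 - norm x) ^ DIM('a)"
  have [measurable]: "g \<in> borel_measurable borel" using g by simp
  show ?thesis
  proof (rule Bochner_Integration.integrable_bound[where f="\<lambda>y. B * g y"])
    show "AE y in sphere_prob. norm (poisson_kernel x y * g y) \<le> norm (B * g y)"
      using AE_sphere_prob
    proof eventually_elim
      case (elim y)
      have "\<bar>poisson_kernel x y\<bar> \<le> \<bar>B\<bar>"
        using poisson_kernel_le[of x "norm x" y] poisson_kernel_nonneg[OF x, of y] x elim by (simp add: B_def)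
      then show ?case by (simp add: abs_mult mult_right_mono)
    qed
  qed (use g in auto)
qed

lemma poisson_integral_local_mean:
  fixes x :: "'a::euclidean_space"
  assumes g: "integrable sphere_prob g" and x: "norm x < 1"
  obtains C d where "0 < d" "d < 1 - norm x"
    "\<And>\<rho>. 0 < \<rho> \<Longrightarrow> \<rho> < d \<Longrightarrow> integrable sphere_prob (\<lambda>\<theta>. poisson_integral g (x + \<rho> *\<^sub>R \<theta>))"
    "\<And>\<rho>. 0 < \<rho> \<Longrightarrow> \<rho> < d \<Longrightarrow>
      \<bar>(\<integral>\<theta>. poisson_integral g (x + \<rho> *\<^sub>R \<theta>) \<partial>sphere_prob) - poisson_integral g x\<bar> \<le> C * \<rho> ^ 3"
proof -
  have [measurable]: "g \<in> borel_measurable borel" using g by simp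
  interpret P: pair_sigma_finite "sphere_prob :: 'a measure" "sphere_prob :: 'a measure" ..
  obtain C d where Cd: "C \<ge> 0" "0 < d" "d < 1 - norm x"
    "\<And>\<rho> y. 0 < \<rho> \<Longrightarrow> \<rho> < d \<Longrightarrow> norm y = 1 \<Longrightarrow>
       \<bar>(\<integral>\<theta>. poisson_kernel (x + \<rho> *\<^sub>R \<theta>) y \<partial>sphere_prob) - poisson_kernel x y\<bar> \<le> C * \<rho> ^ 3"
    using poisson_kernel_local_mean[OF x] by blast
  have *: "integrable sphere_prob (\<lambda>\<theta>. poisson_integral g (x + \<rho> *\<^sub>R \<theta>)) \<and>
      \<bar>(\<integral>\<theta>. poisson_integral g (x + \<rho> *\<^sub>R \<theta>) \<partial>sphere_prob) - poisson_integral g x\<bar>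
        \<le> (C * (\<integral>y. \<bar>g y\<bar> \<partial>sphere_prob)) * \<rho> ^ 3"
    if \<rho>: "0 < \<rho>" "\<rho> < d" for \<rho>
  proof -
    define r where "r = norm x + \<rho>"
    have r: "r < 1" "r \<ge> 0" using \<rho> Cd(3) by (auto simp: r_def)
    define B where "B = 1 / (1 - r) ^ DIM('a)"
    have B0: "B \<ge> 0" using r by (simp add: B_def)
    have in_ball: "norm (x + \<rho> *\<^sub>R \<theta>) \<le> r" if "norm \<theta> = 1" for \<theta>
      using norm_triangle_ineq[of x "\<rho> *\<^sub>R \<theta>"] that \<rho> by (simp add: r_def)
    have KB: "\<bar>poisson_kernel (x + \<rho> *\<^sub>R \<theta>) y\<bar> \<le> B" if "norm \<theta> = 1" "norm y = 1" for \<theta> y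
      using poisson_kernel_le[OF in_ball[OF that(1)] r(1) that(2)]
        poisson_kernel_nonneg[of "x + \<rho> *\<^sub>R \<theta>" y] in_ball[OF that(1)] r(1) by (simp add: B_def)
    let ?f = "\<lambda>\<theta> y. poisson_kernel (x + \<rho> *\<^sub>R \<theta>) y * g y"
    have fint: "integrable sphere_prob (?f \<theta>)" if "norm \<theta> = 1" for \<theta>
      using in_ball[OF that] r by (intro poisson_integrable[OF g]) auto
    have prod: "integrable (sphere_prob \<Otimes>\<^sub>M sphere_prob) (\<lambda>(\<theta>, y). ?f \<theta> y)"
    proof (rule P.Fubini_integrable)
      show "integrable sphere_prob (\<lambda>\<theta>. \<integral>y. norm (case (\<theta>, y) of (\<theta>, y) \<Rightarrow> ?f \<theta> y) \<partial>sphere_prob)"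
      proof (rule sphere_integrable_bounded[where B="B * (\<integral>y. \<bar>g y\<bar> \<partial>sphere_prob)"])
        fix \<theta> :: 'a assume \<theta>: "norm \<theta> = 1"
        have "(\<integral>y. \<bar>?f \<theta> y\<bar> \<partial>sphere_prob) \<le> (\<integral>y. B * \<bar>g y\<bar> \<partial>sphere_prob)"
        proof (rule integral_mono_AE)
          show "AE y in sphere_prob. \<bar>?f \<theta> y\<bar> \<le> B * \<bar>g y\<bar>"
            using AE_sphere_prob by eventually_elim (auto simp: abs_mult intro!: mult_right_mono KB \<theta>)
        qed (use fint[OF \<theta>] g in auto)
        then show "\<bar>\<integral>y. norm (case (\<theta>, y) of (\<theta>, y) \<Rightarrow> ?f \<theta> y) \<partial>sphere_prob\<bar> \<le> B * (\<integral>y. \<bar>g y\<bar> \<partial>sphere_prob)"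
          by simp
      qed simp
      show "AE \<theta> in sphere_prob. integrable sphere_prob (\<lambda>y. case (\<theta>, y) of (\<theta>, y) \<Rightarrow> ?f \<theta> y)"
        using AE_sphere_prob by eventually_elim (use fint in auto)
    qed simp
    have int: "integrable sphere_prob (\<lambda>\<theta>. poisson_integral g (x + \<rho> *\<^sub>R \<theta>))"
      using P.integrable_fst[OF prod] by (simp add: poisson_integral_def)
    have int2: "integrable sphere_prob (\<lambda>y. \<integral>\<theta>. ?f \<theta> y \<partial>sphere_prob)"
      by (rule P.integrable_snd[OF prod])
    have "(\<integral>\<theta>. poisson_integral g (x + \<rho> *\<^sub>R \<theta>) \<partial>sphere_prob) = (\<integral>y. (\<integral>\<theta>. ?f \<theta> y \<partial>sphere_prob) \<partial>sphere_prob)"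
      unfolding poisson_integral_def by (rule P.Fubini_integral[OF prod, symmetric])
    then have "(\<integral>\<theta>. poisson_integral g (x + \<rho> *\<^sub>R \<theta>) \<partial>sphere_prob) - poisson_integral g x
       = (\<integral>y. (\<integral>\<theta>. ?f \<theta> y \<partial>sphere_prob) - poisson_kernel x y * g y \<partial>sphere_prob)"
      unfolding poisson_integral_def using int2 poisson_integrable[OF g x]
      by (simp add: Bochner_Integration.integral_diff)
    also have "\<bar>\<dots>\<bar> \<le> (\<integral>y. \<bar>(\<integral>\<theta>. ?f \<theta> y \<partial>sphere_prob) - poisson_kernel x y * g y\<bar> \<partial>sphere_prob)"
      by (rule integral_abs_bound)
    also have "\<dots> \<le> (\<integral>y. C * \<rho> ^ 3 * \<bar>g y\<bar> \<partial>sphere_prob)"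
    proof (rule integral_mono_AE)
      show "integrable sphere_prob (\<lambda>y. \<bar>(\<integral>\<theta>. ?f \<theta> y \<partial>sphere_prob) - poisson_kernel x y * g y\<bar>)"
        using int2 poisson_integrable[OF g x] by (intro integrable_abs Bochner_Integration.integrable_diff)
      show "integrable sphere_prob (\<lambda>y. C * \<rho> ^ 3 * \<bar>g y\<bar>)" using g by simp
      show "AE y in sphere_prob. \<bar>(\<integral>\<theta>. ?f \<theta> y \<partial>sphere_prob) - poisson_kernel x y * g y\<bar> \<le> C * \<rho> ^ 3 * \<bar>g y\<bar>"
        using AE_sphere_prob
      proof eventually_elim
        case (elim y)
        have "(\<integral>\<theta>. ?f \<theta> y \<partial>sphere_prob) - poisson_kernel x y * g y
          = ((\<integral>\<theta>. poisson_kernel (x + \<rho> *\<^sub>R \<theta>) y \<partial>sphere_prob) - poisson_kernel x y) * g y"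
          by (simp add: left_diff_distrib)
        then show ?case using Cd(4)[OF \<rho> elim] by (simp add: abs_mult mult_right_mono)
      qed
    qed
    finally show ?thesis using int by (simp add: mult_ac)
  qed
  show ?thesis
    by (rule that[of d "C * (\<integral>y. \<bar>g y\<bar> \<partial>sphere_prob)"]) (use * Cd(2,3) in auto)
qed

lemma continuous_on_poisson_integral:
  fixes g :: "'a::euclidean_space \<Rightarrow> real"
  assumes g: "integrable sphere_prob g"
  shows "continuous_on (ball 0 1) (poisson_integral g)"
proof -
  have [measurable]: "g \<in> borel_measurable borel" using g by simp
  have *: "continuous_on (cball 0 r) (poisson_integral g)" if r: "r < 1" for r
  proof (rule continuous_on_sequentiallyI)
    fix X :: "nat \<Rightarrow> 'a" and a assume X: "\<forall>n. X n \<in> cball 0 r" "a \<in> cball 0 r" "X \<longlonglongrightarrow> a"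
    define B where "B = 1 / (1 - r) ^ DIM('a)"
    show "(\<lambda>n. poisson_integral g (X n)) \<longlonglongrightarrow> poisson_integral g a"
      unfolding poisson_integral_def
    proof (rule integral_dominated_convergence[where w="\<lambda>y. B * \<bar>g y\<bar>"])
      show "AE y in sphere_prob. (\<lambda>n. poisson_kernel (X n) y * g y) \<longlonglongrightarrow> poisson_kernel a y * g y"
        using AE_sphere_prob
      proof eventually_elim
        case (elim y)
        have "norm (a - y) \<noteq> 0" using X(2) r elim by auto
        then show ?case unfolding poisson_kernel_def
          by (intro tendsto_intros X) auto
      qed
      show "AE y in sphere_prob. norm (poisson_kernel (X n) y * g y) \<le> B * \<bar>g y\<bar>" for n
        using AE_sphere_prob
      proof eventually_elim
        case (elim y)
        have "norm (X n) \<le> r" using X(1) by simp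
        then have "\<bar>poisson_kernel (X n) y\<bar> \<le> B"
          using poisson_kernel_le[of "X n" r y] poisson_kernel_nonneg[of "X n" y] r elim by (simp add: B_def)
        then show ?case by (simp add: abs_mult mult_right_mono)
      qed
    qed (use g in auto)
  qed
  show ?thesis
  proof (rule continuous_at_imp_continuous_on, rule ballI)
    fix x :: 'a assume x: "x \<in> ball 0 1"
    have "x \<in> interior (cball 0 ((1 + norm x) / 2))" using x by simp
    moreover have "continuous_on (cball 0 ((1 + norm x) / 2)) (poisson_integral g)"
      by (rule *) (use x in simp)
    ultimately show "isCont (poisson_integral g) x" by (meson continuous_on_interior)
  qed
qed

lemma submean_at_poisson:
  assumes g: "integrable sphere_prob g" and x: "norm x < 1"
  shows "submean_at (\<lambda>x. ereal (poisson_integral g x)) x"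
proof -
  obtain C d where Cd: "0 < d" "d < 1 - norm x"
    "\<And>\<rho>. 0 < \<rho> \<Longrightarrow> \<rho> < d \<Longrightarrow> integrable sphere_prob (\<lambda>\<theta>. poisson_integral g (x + \<rho> *\<^sub>R \<theta>))"
    "\<And>\<rho>. 0 < \<rho> \<Longrightarrow> \<rho> < d \<Longrightarrow>
      \<bar>(\<integral>\<theta>. poisson_integral g (x + \<rho> *\<^sub>R \<theta>) \<partial>sphere_prob) - poisson_integral g x\<bar> \<le> C * \<rho> ^ 3"
    by (rule poisson_integral_local_mean[OF assms]) (rule that)
  show ?thesis unfolding submean_at_def
  proof (intro exI conjI allI impI)
    fix \<rho> G assume \<rho>: "0 < \<rho>" "\<rho> < d" and G: "integrable sphere_prob G"
      and le: "\<forall>y. norm y = 1 \<longrightarrow> ereal (poisson_integral g (x + \<rho> *\<^sub>R y)) \<le> ereal (G y)"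
    have "(\<integral>\<theta>. poisson_integral g (x + \<rho> *\<^sub>R \<theta>) \<partial>sphere_prob) \<le> (\<integral>\<theta>. G \<theta> \<partial>sphere_prob)"
      by (rule integral_mono_AE) (use Cd(3)[OF \<rho>] G AE_sphere_prob le in auto)
    then show "ereal (poisson_integral g x) \<le> ereal ((\<integral>\<theta>. G \<theta> \<partial>sphere_prob) + C * \<rho> ^ 3)"
      using Cd(4)[OF \<rho>] by simp
  qed (rule Cd)
qed

lemma supermean_at_poisson:
  assumes g: "integrable sphere_prob g" and x: "norm x < 1"
  shows "supermean_at (poisson_integral g) x"
proof -
  obtain C d where Cd: "0 < d" "\<And>\<rho>. 0 < \<rho> \<Longrightarrow> \<rho> < d \<Longrightarrow>
      \<bar>(\<integral>\<theta>. poisson_integral g (x + \<rho> *\<^sub>R \<theta>) \<partial>sphere_prob) - poisson_integral g x\<bar> \<le> C * \<rho> ^ 3"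
    by (rule poisson_integral_local_mean[OF assms]) (rule that)
  show ?thesis unfolding supermean_at_def
  proof (rule exI[of _ C], rule exI[of _ d], intro conjI allI impI Cd(1))
    fix \<rho> :: real assume "0 < \<rho>" "\<rho> < d"
    from Cd(2)[OF this] show "(\<integral>\<theta>. poisson_integral g (x + \<rho> *\<^sub>R \<theta>) \<partial>sphere_prob) \<le> poisson_integral g x + C * \<rho> ^ 3"
      by linarith
  qed
qed

text \<open>The integral is invariant under rotations, hence constant on the sphere through \<open>x\<close>. By the maximum
principle, applied to it and to the constant from both sides, its value there equals its value \<open>1\<close>
at the origin.\<close>

lemma poisson_integral_1:
  fixes x :: "'a::euclidean_space"
  assumes x: "norm x < 1"
  shows "poisson_integral (\<lambda>_. 1) x = 1"
proof -
  let ?H = "poisson_integral (\<lambda>_. 1) :: 'a \<Rightarrow> real"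
  have I: "integrable sphere_prob (\<lambda>_::'a. 1 :: real)" by simp
  have H0: "?H 0 = 1"
  proof -
    have "?H 0 = (\<integral>y. 1 \<partial>(sphere_prob :: 'a measure))"
      unfolding poisson_integral_def
      by (rule integral_cong_AE) (use AE_sphere_prob in \<open>auto simp: poisson_kernel_0\<close>)
    then show ?thesis by (simp add: sphere_prob.prob_space[simplified])
  qed
  have rot: "?H z = ?H x" if z: "norm z = norm x" for z
  proof -
    obtain f where f: "orthogonal_transformation f" "f x = z"
      using orthogonal_transformation_exists_general[of x z] z by auto
    have n: "norm (f x - f y) = norm (x - y)" for y
      using f(1) by (simp add: orthogonal_transformation_linear linear_diff[symmetric] orthogonal_transformation)
    have "?H z = (\<integral>y. poisson_kernel z (f y) \<partial>sphere_prob)"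
      unfolding poisson_integral_def using integral_sphere_rotate[OF f(1), of "poisson_kernel z"] by simp
    also have "\<dots> = ?H x"
      unfolding poisson_integral_def poisson_kernel_def z using n f(2) by simp
    finally show ?thesis .
  qed
  have cont: "continuous_on (cball 0 (norm x)) ?H"
    by (rule continuous_on_subset[OF continuous_on_poisson_integral[OF I]]) (use x in auto)
  have const_sub: "submean_at (\<lambda>_. ereal c) z" for c :: real and z :: 'a
    unfolding submean_at_def
  proof (rule exI[of _ 0], rule exI[of _ 1], intro conjI allI impI)
    fix \<rho> and G :: "'a \<Rightarrow> real"
    assume G: "integrable sphere_prob G" "\<forall>y. norm y = 1 \<longrightarrow> ereal c \<le> ereal (G y)"
    have "(\<integral>y. c \<partial>(sphere_prob :: 'a measure)) \<le> (\<integral>y. G y \<partial>sphere_prob)"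
      by (rule integral_mono_AE) (use G AE_sphere_prob in auto)
    then show "ereal c \<le> ereal (integral\<^sup>L sphere_prob G + 0 * \<rho> ^ 3)"
      by (simp add: sphere_prob.prob_space[simplified])
  qed simp
  have const_super: "supermean_at (\<lambda>_. c) z" for c :: real and z :: 'a
    unfolding supermean_at_def
    by (rule exI[of _ 0], rule exI[of _ 1]) (simp add: sphere_prob.prob_space[simplified])
  have "ereal (?H 0) \<le> ereal (?H x)"
  proof (rule maximum_principle[where K="cball 0 (norm x)" and u="\<lambda>z. ereal (?H z)" and H="\<lambda>_. ?H x"])
    show "usc_on (cball 0 (norm x)) (\<lambda>z. ereal (?H z))" by (rule usc_on_continuous[OF cont])
    show "submean_at (\<lambda>z. ereal (?H z)) z" if "z \<in> interior (cball 0 (norm x))" for z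
      using that x by (intro submean_at_poisson I) simp
    show "supermean_at (\<lambda>_. ?H x) z" for z :: 'a by (rule const_super)
    fix z :: 'a assume "z \<in> cball 0 (norm x)" "z \<notin> interior (cball 0 (norm x))"
    then have "norm z = norm x" by simp
    from rot[OF this] show "ereal (?H z) \<le> ereal (?H x)" by simp
  qed auto
  moreover have "ereal (?H x) \<le> ereal (?H 0)"
  proof (rule maximum_principle[where K="cball 0 (norm x)" and u="\<lambda>_. ereal (?H x)" and H="?H"])
    show "usc_on (cball 0 (norm x)) (\<lambda>_. ereal (?H x))" by (intro usc_on_continuous continuous_intros)
    show "submean_at (\<lambda>_. ereal (?H x)) z" for z :: 'a by (rule const_sub)
    show "supermean_at ?H z" if "z \<in> interior (cball 0 (norm x))" for z
      using that x by (intro supermean_at_poisson I) simp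
    show "continuous_on (cball 0 (norm x)) ?H" by (rule cont)
    fix z :: 'a assume "z \<in> cball 0 (norm x)" "z \<notin> interior (cball 0 (norm x))"
    then have "norm z = norm x" by simp
    from rot[OF this] show "ereal (?H x) \<le> ereal (?H z)" by simp
  qed auto
  ultimately show ?thesis using H0 by simp
qed

text \<open>The solution of the Dirichlet problem on the unit ball with boundary values \<open>G\<close>. It continues as
\<open>G\<close> outside the ball so that it is Borel measurable on the whole space.\<close>

definition dirichlet_solution :: "('a::euclidean_space \<Rightarrow> real) \<Rightarrow> 'a \<Rightarrow> real" where
  "dirichlet_solution G x = (if norm x < 1 then poisson_integral G x else G x)"

text \<open>Near a boundary point \<open>\<xi>\<close> the kernel has total mass \<open>1\<close>, and away from \<open>\<xi>\<close> it tends uniformly to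
\<open>0\<close> because of the factor \<open>1 - |x|\<^sup>2\<close>. So the Poisson integral of \<open>G\<close> averages values close to \<open>G \<xi>\<close>.\<close>

lemma continuous_on_dirichlet_solution:
  fixes G :: "'a::euclidean_space \<Rightarrow> real"
  assumes G: "continuous_on UNIV G"
  shows "continuous_on (cball 0 1) (dirichlet_solution G)"
  unfolding continuous_on_eq_continuous_within
proof
  fix \<xi> :: 'a assume \<xi>: "\<xi> \<in> cball 0 1"
  have I: "integrable sphere_prob G" by (rule integrable_sphere_continuous[OF G])
  have [measurable]: "G \<in> borel_measurable borel" using G by (rule borel_measurable_continuous_onI)
  show "continuous (at \<xi> within cball 0 1) (dirichlet_solution G)"
  proof (cases "norm \<xi> < 1")
    case True
    have "continuous_on (ball 0 1) (dirichlet_solution G)"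
      by (rule continuous_on_eq[OF continuous_on_poisson_integral[OF I]]) (simp add: dirichlet_solution_def)
    then have "isCont (dirichlet_solution G) \<xi>"
      using True by (simp add: continuous_on_eq_continuous_at)
    then show ?thesis by (rule continuous_at_imp_continuous_at_within)
  next
    case False
    then have n\<xi>: "norm \<xi> = 1" using \<xi> by simp
    have "compact (G ` sphere 0 1)"
      by (intro compact_continuous_image continuous_on_subset[OF G]) auto
    from compact_imp_bounded[OF this] obtain B where B: "\<And>y. norm y = 1 \<Longrightarrow> \<bar>G y\<bar> \<le> B"
      by (auto simp: bounded_iff) (metis mem_sphere_0)
    have B0: "B \<ge> 0" using B[OF n\<xi>] by simp
    show ?thesis unfolding continuous_within_eps_delta
    proof (intro allI impI)
      fix e :: real assume e: "e > 0"
      obtain \<delta> where \<delta>: "\<delta> > 0" "\<And>y. dist y \<xi> < \<delta> \<Longrightarrow> dist (G y) (G \<xi>) < e / 2"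
        using G e unfolding continuous_on_iff by (meson UNIV_I half_gt_zero)
      define L where "L = 4 * B * (2 / \<delta>) ^ DIM('a)"
      have L0: "L \<ge> 0" using B0 \<delta> by (simp add: L_def)
      define d where "d = min (\<delta> / 2) (e / (2 * (L + 1)))"
      have d: "d > 0" unfolding d_def using \<delta> e L0 by (auto intro!: divide_pos_pos)
      have d': "d \<le> \<delta> / 2" unfolding d_def by (rule min.cobounded1)
      have Ld: "L * d < e / 2"
      proof -
        have "L * d \<le> L * (e / (2 * (L + 1)))" using L0 by (intro mult_left_mono) (auto simp: d_def)
        also have "\<dots> < e / 2" using L0 e by (simp add: field_simps)
        finally show ?thesis .
      qed
      have "dist (dirichlet_solution G x) (dirichlet_solution G \<xi>) < e"
        if x: "x \<in> cball 0 1" "dist x \<xi> < d" for x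
      proof (cases "norm x < 1")
        case False
        then have "dist (G x) (G \<xi>) < e / 2" using \<delta> x d d' by auto
        then show ?thesis using False n\<xi> e by (simp add: dirichlet_solution_def)
      next
        case True
        define N where "N = 1 - (norm x)\<^sup>2"
        have N: "0 \<le> N" "N \<le> 2 * d"
        proof -
          have "1 - norm x \<le> norm (\<xi> - x)" using norm_triangle_ineq2[of \<xi> x] n\<xi> by simp
          then have "1 - norm x \<le> d" using x(2) by (simp add: dist_norm norm_minus_commute)
          moreover have "N = (1 - norm x) * (1 + norm x)" by (simp add: N_def power2_eq_square algebra_simps)
          moreover have "(1 - norm x) * (1 + norm x) \<le> d * 2"
            using True calculation(1) d by (intro mult_mono) auto
          ultimately show "N \<le> 2 * d" by simp
          show "0 \<le> N" using True by (simp add: N_def power_le_one)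
        qed
        have KI: "integrable sphere_prob (poisson_kernel x)" "(\<integral>y. poisson_kernel x y \<partial>sphere_prob) = 1"
          using poisson_integrable[of "\<lambda>_. 1" x] poisson_integral_1[OF True] True
          by (auto simp: poisson_integral_def)
        have pw: "\<bar>poisson_kernel x y * (G y - G \<xi>)\<bar> \<le> poisson_kernel x y * (e / 2) + 2 * B * (N * (2 / \<delta>) ^ DIM('a))"
          if y: "norm y = 1" for y
        proof (cases "dist y \<xi> < \<delta>")
          case T: True
          have "\<bar>poisson_kernel x y * (G y - G \<xi>)\<bar> \<le> poisson_kernel x y * (e / 2)"
            using \<delta>(2)[OF T] poisson_kernel_nonneg[OF True, of y]
            unfolding abs_mult by (intro mult_mono) (auto simp: dist_real_def)
          moreover have "0 \<le> 2 * B * (N * (2 / \<delta>) ^ DIM('a))" using B0 N \<delta> by simp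
          ultimately show ?thesis by linarith
        next
          case F: False
          have "\<delta> / 2 \<le> norm (x - y)"
            using F x(2) d' dist_triangle[of y \<xi> x] by (simp add: dist_norm norm_minus_commute)
          then have "(\<delta> / 2) ^ DIM('a) \<le> norm (x - y) ^ DIM('a)" using \<delta> by (intro power_mono) auto
          then have "poisson_kernel x y \<le> N / (\<delta> / 2) ^ DIM('a)"
            unfolding poisson_kernel_def N_def[symmetric] using N \<delta> by (intro frac_le) auto
          also have "\<dots> = N * (2 / \<delta>) ^ DIM('a)" by (simp add: power_divide)
          finally have "poisson_kernel x y \<le> N * (2 / \<delta>) ^ DIM('a)" .
          moreover have "\<bar>G y - G \<xi>\<bar> \<le> 2 * B" using B[OF y] B[OF n\<xi>] by linarith
          ultimately have "poisson_kernel x y * \<bar>G y - G \<xi>\<bar> \<le> N * (2 / \<delta>) ^ DIM('a) * (2 * B)"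
            using poisson_kernel_nonneg[OF True, of y] N \<delta> by (intro mult_mono) auto
          moreover have "0 \<le> poisson_kernel x y * (e / 2)" using poisson_kernel_nonneg[OF True, of y] e by simp
          ultimately show ?thesis using poisson_kernel_nonneg[OF True, of y]
            by (simp add: abs_mult mult_ac)
        qed
        have "poisson_integral G x - G \<xi> = (\<integral>y. poisson_kernel x y * (G y - G \<xi>) \<partial>sphere_prob)"
          unfolding poisson_integral_def right_diff_distrib
          using poisson_integrable[OF I True] KI by (simp add: Bochner_Integration.integral_diff)
        also have "\<bar>\<dots>\<bar> \<le> (\<integral>y. \<bar>poisson_kernel x y * (G y - G \<xi>)\<bar> \<partial>sphere_prob)"
          by (rule integral_abs_bound)
        also have "\<dots> \<le> (\<integral>y. poisson_kernel x y * (e / 2) + 2 * B * (N * (2 / \<delta>) ^ DIM('a)) \<partial>sphere_prob)"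
        proof (rule integral_mono_AE)
          show "integrable sphere_prob (\<lambda>y. \<bar>poisson_kernel x y * (G y - G \<xi>)\<bar>)"
            by (intro integrable_abs poisson_integrable True Bochner_Integration.integrable_diff I) simp
          show "AE y in sphere_prob. \<bar>poisson_kernel x y * (G y - G \<xi>)\<bar> \<le> poisson_kernel x y * (e / 2) + 2 * B * (N * (2 / \<delta>) ^ DIM('a))"
            using AE_sphere_prob by eventually_elim (rule pw)
        qed (use KI in auto)
        also have "\<dots> = e / 2 + 2 * B * (N * (2 / \<delta>) ^ DIM('a))"
          using KI by (simp add: sphere_prob.prob_space[simplified])
        also have "2 * B * (N * (2 / \<delta>) ^ DIM('a)) \<le> 2 * B * (2 * d * (2 / \<delta>) ^ DIM('a))"
          using B0 N \<delta> by (intro mult_left_mono mult_right_mono) auto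
        also have "2 * B * (2 * d * (2 / \<delta>) ^ DIM('a)) = L * d" by (simp add: L_def)
        finally have "\<bar>poisson_integral G x - G \<xi>\<bar> < e" using Ld by simp
        then show ?thesis using True n\<xi> by (simp add: dirichlet_solution_def dist_real_def)
      qed
      then show "\<exists>d>0. \<forall>x'\<in>cball 0 1. dist x' \<xi> < d \<longrightarrow> dist (dirichlet_solution G x') (dirichlet_solution G \<xi>) < e"
        using d(1) by blast
    qed
  qed
qed

section \<open>From small spheres to all spheres\<close>

lemma subharmonic_on_submean_at:
  assumes "subharmonic_on \<Omega> u" "open \<Omega>" "x \<in> \<Omega>"
  shows "submean_at u x"
proof -
  obtain d where d: "d > 0" "cball x d \<subseteq> \<Omega>" using assms open_contains_cball by blast
  show ?thesis unfolding submean_at_def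
  proof (rule exI[of _ 0], rule exI[of _ d], intro conjI allI impI d(1))
    fix \<rho> G assume \<rho>: "0 < \<rho>" "\<rho> < d" and G: "integrable sphere_prob G"
      "\<forall>y. norm y = 1 \<longrightarrow> u (x + \<rho> *\<^sub>R y) \<le> ereal (G y)"
    have "cball x \<rho> \<subseteq> \<Omega>" using d(2) \<rho> by auto
    then have "u x \<le> sphere_mean u x \<rho>" using assms(1) \<rho> unfolding subharmonic_on_def by blast
    from sphere_mean_le_integral[OF this G(1)] G(2)
    show "u x \<le> ereal ((\<integral>y. G y \<partial>sphere_prob) + 0 * \<rho> ^ 3)" by simp
  qed
qed

lemma submean_at_affine:
  fixes u :: "'a::euclidean_space \<Rightarrow> ereal"
  assumes "submean_at u (a + r *\<^sub>R x)" "r > 0"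
  shows "submean_at (\<lambda>x. u (a + r *\<^sub>R x)) x"
proof -
  obtain C d where Cd: "0 < d" "\<And>\<rho> G. 0 < \<rho> \<Longrightarrow> \<rho> < d \<Longrightarrow> integrable sphere_prob G \<Longrightarrow>
     (\<And>y. norm y = 1 \<Longrightarrow> u (a + r *\<^sub>R x + \<rho> *\<^sub>R y) \<le> ereal (G y)) \<Longrightarrow>
     u (a + r *\<^sub>R x) \<le> ereal ((\<integral>y. G y \<partial>sphere_prob) + C * \<rho> ^ 3)"
    using assms(1) unfolding submean_at_def by metis
  show ?thesis unfolding submean_at_def
  proof (rule exI[of _ "C * r ^ 3"], rule exI[of _ "d / r"], intro conjI allI impI)
    show "0 < d / r" using Cd(1) assms(2) by simp
    fix \<rho> G assume \<rho>: "0 < \<rho>" "\<rho> < d / r" and G: "integrable sphere_prob G"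
      "\<forall>y. norm y = 1 \<longrightarrow> u (a + r *\<^sub>R (x + \<rho> *\<^sub>R y)) \<le> ereal (G y)"
    have "u (a + r *\<^sub>R x) \<le> ereal ((\<integral>y. G y \<partial>sphere_prob) + C * (r * \<rho>) ^ 3)"
    proof (rule Cd(2)[OF _ _ G(1)])
      show "0 < r * \<rho>" "r * \<rho> < d" using \<rho> assms(2) by (auto simp: less_divide_eq mult.commute)
      fix y :: 'a assume "norm y = 1"
      then show "u (a + r *\<^sub>R x + (r * \<rho>) *\<^sub>R y) \<le> ereal (G y)"
        using G(2) by (simp add: scaleR_add_right add.assoc)
    qed
    then show "u (a + r *\<^sub>R x) \<le> ereal ((\<integral>y. G y \<partial>sphere_prob) + C * r ^ 3 * \<rho> ^ 3)"
      by (simp add: power_mult_distrib mult_ac)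
  qed
qed

lemma supermean_at_dirichlet:
  fixes G :: "'a::euclidean_space \<Rightarrow> real"
  assumes G: "continuous_on UNIV G" and x: "norm x < 1"
  shows "supermean_at (dirichlet_solution G) x"
proof -
  have [measurable]: "G \<in> borel_measurable borel" using G by (rule borel_measurable_continuous_onI)
  have [measurable]: "dirichlet_solution G \<in> borel_measurable borel"
    unfolding dirichlet_solution_def[abs_def] by measurable
  obtain C d where Cd: "0 < d" "d < 1 - norm x" "\<And>\<rho>. 0 < \<rho> \<Longrightarrow> \<rho> < d \<Longrightarrow>
      \<bar>(\<integral>\<theta>. poisson_integral G (x + \<rho> *\<^sub>R \<theta>) \<partial>sphere_prob) - poisson_integral G x\<bar> \<le> C * \<rho> ^ 3"
    by (rule poisson_integral_local_mean[OF integrable_sphere_continuous[OF G] x]) (rule that)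
  show ?thesis unfolding supermean_at_def
  proof (rule exI[of _ C], rule exI[of _ d], intro conjI allI impI Cd(1))
    fix \<rho> :: real assume \<rho>: "0 < \<rho>" "\<rho> < d"
    have "(\<integral>\<theta>. dirichlet_solution G (x + \<rho> *\<^sub>R \<theta>) \<partial>sphere_prob) = (\<integral>\<theta>. poisson_integral G (x + \<rho> *\<^sub>R \<theta>) \<partial>sphere_prob)"
    proof (rule integral_cong_AE)
      show "AE \<theta> in sphere_prob. dirichlet_solution G (x + \<rho> *\<^sub>R \<theta>) = poisson_integral G (x + \<rho> *\<^sub>R \<theta>)"
        using AE_sphere_prob
      proof eventually_elim
        case (elim \<theta>)
        have "norm (x + \<rho> *\<^sub>R \<theta>) < 1"
          using norm_triangle_ineq[of x "\<rho> *\<^sub>R \<theta>"] elim \<rho> Cd(2) by simp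
        then show ?case by (simp add: dirichlet_solution_def)
      qed
    qed measurable
    with Cd(3)[OF \<rho>] show "(\<integral>\<theta>. dirichlet_solution G (x + \<rho> *\<^sub>R \<theta>) \<partial>sphere_prob) \<le> dirichlet_solution G x + C * \<rho> ^ 3"
      using x by (simp add: dirichlet_solution_def abs_le_iff)
  qed
qed

lemma le_dirichlet_solution:
  fixes v :: "'a::euclidean_space \<Rightarrow> ereal"
  assumes v: "usc_on (cball 0 1) v" "\<And>x. norm x \<le> 1 \<Longrightarrow> v x < \<infinity>" "\<And>x. norm x < 1 \<Longrightarrow> submean_at v x"
    and G: "continuous_on UNIV G" "\<And>y. norm y = 1 \<Longrightarrow> v y \<le> ereal (G y)"
    and x: "norm x \<le> 1"
  shows "v x \<le> ereal (dirichlet_solution G x)"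
proof (rule maximum_principle[where K="cball 0 1" and u=v and H="dirichlet_solution G"])
  have [measurable]: "G \<in> borel_measurable borel" using G(1) by (rule borel_measurable_continuous_onI)
  show "dirichlet_solution G \<in> borel_measurable borel"
    unfolding dirichlet_solution_def[abs_def] by measurable
  show "continuous_on (cball 0 1) (dirichlet_solution G)" by (rule continuous_on_dirichlet_solution[OF G(1)])
qed (use v G x supermean_at_dirichlet[OF G(1)] in \<open>auto simp: dirichlet_solution_def\<close>)

lemma poisson_integral_at_0: "continuous_on UNIV G \<Longrightarrow> poisson_integral G 0 = (\<integral>y. G y \<partial>sphere_prob)"
  for G :: "'a::euclidean_space \<Rightarrow> real"
  unfolding poisson_integral_def
proof (rule integral_cong_AE)
  assume "continuous_on UNIV G"
  then have [measurable]: "G \<in> borel_measurable borel" by (rule borel_measurable_continuous_onI)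
  show "(\<lambda>y. poisson_kernel 0 y * G y) \<in> borel_measurable sphere_prob" "G \<in> borel_measurable sphere_prob"
    by measurable
  show "AE y in sphere_prob. poisson_kernel 0 y * G y = G y"
    using AE_sphere_prob by eventually_elim (simp add: poisson_kernel_0)
qed

text \<open>Rescale a closed ball in \<open>\<Omega>\<close> to the unit ball. A continuous majorant \<open>G\<close> of \<open>u\<close> on the sphere has a
Poisson integral that dominates \<open>u\<close> in the ball; at the centre its value is the mean of \<open>G\<close>.\<close>

theorem subharmonic_on_local:
  fixes u :: "'a::euclidean_space \<Rightarrow> ereal"
  assumes usc: "usc_on \<Omega> u" and fin: "\<And>x. x \<in> \<Omega> \<Longrightarrow> u x < \<infinity>"
    and sub: "\<And>x. x \<in> \<Omega> \<Longrightarrow> submean_at u x"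
  shows "subharmonic_on \<Omega> u"
  unfolding subharmonic_on_def
proof (intro conjI ballI allI impI usc fin)
  fix a r assume r: "0 < (r::real)" and cb: "cball a r \<subseteq> \<Omega>"
  define v where "v = (\<lambda>x. u (a + r *\<^sub>R x))"
  have inO: "a + r *\<^sub>R x \<in> \<Omega>" if "norm x \<le> 1" for x
    using cb r that by (auto simp: subset_iff dist_norm intro!: mult_left_le)
  have usc_v: "usc_on (cball 0 1) v" unfolding v_def
    by (rule usc_on_compose[OF usc]) (auto intro!: continuous_intros inO)
  show "u a \<le> sphere_mean u a r"
  proof (rule le_sphere_meanI)
    show "usc_on (sphere 0 1) (\<lambda>y. u (a + r *\<^sub>R y))"
      using usc_on_subset[OF usc_v, of "sphere 0 1"] by (auto simp: v_def)
    show "u (a + r *\<^sub>R y) < \<infinity>" if "norm y = 1" for y using fin inO that by auto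
    fix G :: "'a \<Rightarrow> real"
    assume G: "continuous_on UNIV G" "\<And>y. norm y = 1 \<Longrightarrow> u (a + r *\<^sub>R y) \<le> ereal (G y)"
    have "v 0 \<le> ereal (dirichlet_solution G 0)"
    proof (rule le_dirichlet_solution[OF usc_v _ _ G(1)])
      show "v x < \<infinity>" if "norm x \<le> 1" for x using fin inO[OF that] by (simp add: v_def)
      show "submean_at v x" if "norm x < 1" for x
        unfolding v_def by (rule submean_at_affine[OF sub r]) (use inO that in auto)
    qed (use G in \<open>auto simp: v_def\<close>)
    then show "u a \<le> ereal (\<integral>y. G y \<partial>sphere_prob)"
      using poisson_integral_at_0[OF G(1)] by (simp add: v_def dirichlet_solution_def)
  qed
qed

text \<open>Let continuous \<open>G k\<close> decrease to \<open>v\<close> on the sphere; \<open>v\<close> is at most the Poisson integral of each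
\<open>G k\<close>, and dominated convergence applies because \<open>w \<le> G k \<le> G 0\<close> almost everywhere.\<close>

lemma le_poisson_integral:
  fixes v :: "'a::euclidean_space \<Rightarrow> ereal"
  assumes v: "usc_on (cball 0 1) v" "\<And>x. norm x \<le> 1 \<Longrightarrow> v x < \<infinity>" "\<And>x. norm x < 1 \<Longrightarrow> submean_at v x"
    and w: "integrable sphere_prob w" "AE y in sphere_prob. v y = ereal (w y)"
    and x: "norm x < 1"
  shows "v x \<le> ereal (poisson_integral w x)"
proof -
  have [measurable]: "w \<in> borel_measurable borel" using w by simp
  have "usc_on (sphere 0 1) v" using usc_on_subset[OF v(1), of "sphere 0 1"] by auto
  then obtain G :: "nat \<Rightarrow> 'a \<Rightarrow> real" where G: "\<And>k. continuous_on UNIV (G k)" "\<And>k y. G (Suc k) y \<le> G k y"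
    "\<And>k y. y \<in> sphere 0 1 \<Longrightarrow> v y \<le> ereal (G k y)"
    "\<And>y. y \<in> sphere 0 1 \<Longrightarrow> (\<lambda>k. ereal (G k y)) \<longlonglongrightarrow> v y"
    by (rule usc_on_compact_approx) (use v in auto)
  have [measurable]: "G k \<in> borel_measurable borel" for k
    using G(1) by (rule borel_measurable_continuous_onI)
  have GI: "integrable sphere_prob (G k)" for k by (rule integrable_sphere_continuous) fact
  have G0: "G k y \<le> G 0 y" for k y
    by (rule decseqD[where f="\<lambda>k. G k y"]) (auto intro: decseq_SucI G(2))
  have "v x \<le> ereal (poisson_integral (G k) x)" for k
    using le_dirichlet_solution[OF v(1,2,3) G(1)[of k] G(3), of x] x by (simp add: dirichlet_solution_def)
  moreover have "(\<lambda>k. poisson_integral (G k) x) \<longlonglongrightarrow> poisson_integral w x"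
    unfolding poisson_integral_def
  proof (rule integral_dominated_convergence[where w="\<lambda>y. poisson_kernel x y * (\<bar>G 0 y\<bar> + \<bar>w y\<bar>)"])
    show "integrable sphere_prob (\<lambda>y. poisson_kernel x y * (\<bar>G 0 y\<bar> + \<bar>w y\<bar>))"
      using GI w x by (intro poisson_integrable) auto
    show "AE y in sphere_prob. (\<lambda>k. poisson_kernel x y * G k y) \<longlonglongrightarrow> poisson_kernel x y * w y"
      using AE_sphere_prob w(2)
    proof eventually_elim
      case (elim y)
      have "(\<lambda>k. ereal (G k y)) \<longlonglongrightarrow> ereal (w y)" using G(4)[of y] elim by simp
      then show ?case by (intro tendsto_intros) simp
    qed
    show "AE y in sphere_prob. norm (poisson_kernel x y * G k y) \<le> poisson_kernel x y * (\<bar>G 0 y\<bar> + \<bar>w y\<bar>)" for k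
      using AE_sphere_prob w(2)
    proof eventually_elim
      case (elim y)
      have "ereal (w y) \<le> ereal (G k y)" using G(3)[of y k] elim by simp
      then have "\<bar>G k y\<bar> \<le> \<bar>G 0 y\<bar> + \<bar>w y\<bar>" using G0[of k y] by auto
      then show ?case using poisson_kernel_nonneg[OF x, of y] by (simp add: abs_mult mult_left_mono)
    qed
  qed measurable
  then have lim: "(\<lambda>k. ereal (poisson_integral (G k) x)) \<longlonglongrightarrow> ereal (poisson_integral w x)" by simp
  ultimately show ?thesis by (intro LIMSEQ_le_const[OF lim]) blast
qed

section \<open>Polar coordinates\<close>

lemma emeasure_lborel_scale:
  fixes A :: "'a::euclidean_space set"
  assumes t: "t > 0" and A: "A \<in> sets borel"
  shows "emeasure lborel {x. x /\<^sub>R t \<in> A} = ennreal (t ^ DIM('a)) * emeasure lborel A"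
proof -
  have "emeasure lborel {x. x /\<^sub>R t \<in> A} = (\<integral>\<^sup>+x. indicator {x. x /\<^sub>R t \<in> A} x \<partial>lborel)"
    by (rule nn_integral_indicator[symmetric]) (use A in measurable)
  also have "\<dots> = (\<integral>\<^sup>+x. indicator {x. x /\<^sub>R t \<in> A} x \<partial>density (distr lborel borel (\<lambda>x. 0 + t *\<^sub>R x)) (\<lambda>_. \<bar>t\<bar> ^ DIM('a)))"
    using lborel_affine[of t "0::'a"] t by (simp only:)
  also have "\<dots> = (\<integral>\<^sup>+x. ennreal (t ^ DIM('a)) * indicator A x \<partial>lborel)"
    using A t by (subst nn_integral_density) (auto simp: nn_integral_distr indicator_def intro!: nn_integral_cong)
  also have "\<dots> = ennreal (t ^ DIM('a)) * emeasure lborel A"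
    using A by (simp add: nn_integral_cmult)
  finally show ?thesis .
qed

lemma ball_integral_affine:
  fixes f :: "'a::euclidean_space \<Rightarrow> ennreal"
  assumes [measurable]: "f \<in> borel_measurable borel" and R: "R > 0"
  shows "(\<integral>\<^sup>+x\<in>ball a R. f x \<partial>lborel) =
    ennreal (R ^ DIM('a)) * emeasure lborel (ball (0::'a) 1) * (\<integral>\<^sup>+x. f (a + R *\<^sub>R x) \<partial>unit_ball_prob)"
proof -
  let ?V = "emeasure lborel (ball (0::'a) 1)"
  have [measurable]: "ball a R \<in> sets borel" "ball (0::'a) 1 \<in> sets borel" by auto
  have ind: "indicator (ball a R) (a + R *\<^sub>R x) = (indicator (ball 0 1) x :: ennreal)" for x
    using R by (simp add: indicator_def dist_norm)
  have "(\<integral>\<^sup>+x\<in>ball a R. f x \<partial>lborel) =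
     (\<integral>\<^sup>+x. f x * indicator (ball a R) x \<partial>density (distr lborel borel (\<lambda>x. a + R *\<^sub>R x)) (\<lambda>_. \<bar>R\<bar> ^ DIM('a)))"
    using lborel_affine[of R a] R by (simp only:)
  also have "\<dots> = (\<integral>\<^sup>+x. ennreal (R ^ DIM('a)) * (f (a + R *\<^sub>R x) * indicator (ball 0 1) x) \<partial>lborel)"
    using R by (subst nn_integral_density) (auto simp: nn_integral_distr ind)
  also have "\<dots> = ennreal (R ^ DIM('a)) * (\<integral>\<^sup>+x. f (a + R *\<^sub>R x) * indicator (ball 0 1) x \<partial>lborel)"
    by (rule nn_integral_cmult) measurable
  also have "(\<integral>\<^sup>+x. f (a + R *\<^sub>R x) * indicator (ball 0 1) x \<partial>lborel) = ?V * (\<integral>\<^sup>+x. f (a + R *\<^sub>R x) \<partial>unit_ball_prob)"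
    using emeasure_unit_ball[where 'a='a]
    by (subst nn_integral_uniform_measure) (auto simp: mult.commute[of ?V] ennreal_divide_times ennreal_divide_self less_top)
  finally show ?thesis by (simp add: mult.assoc)
qed

text \<open>The set is the part in the ball of radius \<open>t\<close> of a cone, and Lebesgue measure scales with the factor
\<open>t ^ DIM('a)\<close>. So norm and direction of a uniformly distributed point of the ball are independent.\<close>

lemma norm_sgn_independent:
  fixes B :: "'a::euclidean_space set"
  assumes t: "0 < t" "t < 1" and B [measurable]: "B \<in> sets borel"
  shows "emeasure unit_ball_prob {x::'a. norm x \<le> t \<and> sgn x \<in> B} = ennreal (t ^ DIM('a)) * emeasure sphere_prob B"
proof -
  let ?V = "emeasure lborel (ball (0::'a) 1)"
  let ?A = "{x::'a. sgn x \<in> B}"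
  have [measurable]: "ball (0::'a) 1 \<in> sets borel" by simp
  have A [measurable]: "?A \<in> sets borel" by measurable
  have s: "sphere (0::'a) 1 \<in> null_sets lborel"
    using negligible_sphere[of "0::'a" 1] by (simp add: negligible_iff_null_sets null_sets_completion_iff)
  have "ball 0 1 \<inter> {x::'a. norm x \<le> t \<and> sgn x \<in> B} = {x. x /\<^sub>R t \<in> cball 0 1 \<inter> ?A}"
    using t by (auto simp: sgn_scaleR field_simps)
  from arg_cong[OF this, of "emeasure lborel"]
  have "emeasure lborel (ball 0 1 \<inter> {x::'a. norm x \<le> t \<and> sgn x \<in> B}) = ennreal (t ^ DIM('a)) * emeasure lborel (cball 0 1 \<inter> ?A)"
    by (subst (asm) emeasure_lborel_scale) (use t in auto)
  also have "emeasure lborel (cball 0 1 \<inter> ?A) = emeasure lborel (ball 0 1 \<inter> ?A)"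
  proof (rule emeasure_eq_AE)
    have "AE x in lborel. x \<notin> sphere (0::'a) 1" using s by (rule AE_not_in)
    then show "AE x in lborel. (x \<in> cball 0 1 \<inter> ?A) = (x \<in> ball 0 1 \<inter> ?A)"
      by eventually_elim auto
  qed auto
  finally have "emeasure unit_ball_prob {x::'a. norm x \<le> t \<and> sgn x \<in> B} = ennreal (t ^ DIM('a)) * (emeasure lborel (ball 0 1 \<inter> ?A) / ?V)"
    by (subst emeasure_uniform_measure) (auto simp: ennreal_times_divide)
  also have "emeasure lborel (ball 0 1 \<inter> ?A) / ?V = emeasure sphere_prob B"
    unfolding sphere_prob_def
    by (subst emeasure_distr) (auto simp: emeasure_uniform_measure vimage_def)
  finally show ?thesis .
qed

lemma polar_product:
  "distr (unit_ball_prob :: 'a measure) borel norm \<Otimes>\<^sub>M (sphere_prob :: 'a::euclidean_space measure) =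
     distr unit_ball_prob (borel \<Otimes>\<^sub>M borel) (\<lambda>x. (norm x, sgn x))"
proof -
  interpret U: prob_space "unit_ball_prob :: 'a measure" by (rule prob_space_unit_ball)
  interpret R: prob_space "distr (unit_ball_prob :: 'a measure) borel norm"
    by (rule U.prob_space_distr) simp
  show ?thesis
  proof (rule pair_measure_eqI)
    show "sigma_finite_measure (distr (unit_ball_prob :: 'a measure) borel norm)"
      "sigma_finite_measure (sphere_prob :: 'a measure)" by unfold_locales
    show "sets (distr (unit_ball_prob :: 'a measure) borel norm \<Otimes>\<^sub>M sphere_prob) =
        sets (distr (unit_ball_prob :: 'a measure) (borel \<Otimes>\<^sub>M borel) (\<lambda>x. (norm x, sgn x)))"
      by (simp cong: sets_pair_measure_cong)
    fix A B assume "A \<in> sets (distr (unit_ball_prob :: 'a measure) borel norm)" "B \<in> sets (sphere_prob :: 'a measure)"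
    then have A [measurable]: "A \<in> sets borel" and B [measurable]: "B \<in> sets borel" by auto
    define S where "S = {x::'a. sgn x \<in> B}"
    have S [measurable]: "S \<in> sets borel" unfolding S_def by measurable
    let ?M = "density (distr (unit_ball_prob :: 'a measure) borel norm) (\<lambda>_. emeasure sphere_prob B)"
    let ?N = "distr (density unit_ball_prob (indicator S)) borel norm"
    have Sp: "emeasure sphere_prob B = emeasure unit_ball_prob S"
      unfolding sphere_prob_def S_def by (subst emeasure_distr) (auto simp: vimage_def)
    have M: "emeasure ?M X = emeasure sphere_prob B * emeasure unit_ball_prob {x::'a. norm x \<in> X}" if "X \<in> sets borel" for X
      using that by (simp add: emeasure_density nn_integral_cmult emeasure_distr vimage_def)
    have N: "emeasure ?N X = emeasure unit_ball_prob (S \<inter> {x::'a. norm x \<in> X})" if [measurable]: "X \<in> sets borel" for X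
    proof -
      have "emeasure ?N X = emeasure (density unit_ball_prob (indicator S)) {x::'a. norm x \<in> X}"
        by (subst emeasure_distr) (auto simp: vimage_def)
      also have "\<dots> = emeasure unit_ball_prob (S \<inter> {x::'a. norm x \<in> X})"
        by (subst emeasure_density) (auto simp: nn_integral_indicator[symmetric] indicator_inter_arith simp del: nn_integral_indicator)
      finally show ?thesis .
    qed
    have "?M = ?N"
    proof (rule measure_eqI_lessThan)
      show "emeasure ?M {x<..} < \<infinity>" for x
      proof -
        have X: "{x<..} \<in> sets borel" by simp
        have "emeasure sphere_prob B < top" "emeasure unit_ball_prob {y::'a. norm y \<in> {x<..}} < top"
          using U.emeasure_finite sphere_prob.emeasure_finite by (metis less_top infinity_ennreal_def)+
        then show ?thesis unfolding M[OF X] infinity_ennreal_def ennreal_mult_less_top by blast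
      qed
      show "emeasure ?M {t<..} = emeasure ?N {t<..}" for t
      proof -
        have X: "{t<..} \<in> sets borel" by simp
        have AE1: "AE x in unit_ball_prob. norm (x::'a) < 1 \<and> x \<noteq> 0" by (rule AE_unit_ball)
        consider "t \<le> 0" | "0 < t" "t < 1" | "1 \<le> t" by linarith
        then show ?thesis
        proof cases
          case 1
          have AE2: "AE x in unit_ball_prob. t < norm (x::'a)"
            using AE1 by eventually_elim (use 1 zero_less_norm_iff le_less_trans in blast)
          have "emeasure unit_ball_prob {x::'a. norm x \<in> {t<..}} = emeasure (unit_ball_prob :: 'a measure) UNIV"
            by (rule emeasure_eq_AE) (use AE2 in auto)
          moreover have "emeasure unit_ball_prob (S \<inter> {x::'a. norm x \<in> {t<..}}) = emeasure unit_ball_prob S"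
            by (rule emeasure_eq_AE) (use AE2 in auto)
          ultimately show ?thesis using U.emeasure_space_1 unfolding M[OF X] N[OF X] unfolding Sp by simp
        next
          case 2
          have split: "emeasure unit_ball_prob (T \<inter> {x::'a. norm x \<in> {t<..}}) = emeasure unit_ball_prob T - emeasure unit_ball_prob (T \<inter> {x::'a. norm x \<le> t})"
            if [measurable]: "T \<in> sets borel" for T
          proof -
            have "T \<inter> {x::'a. norm x \<in> {t<..}} = T - (T \<inter> {x::'a. norm x \<le> t})" by auto
            moreover have "emeasure unit_ball_prob (T - (T \<inter> {x::'a. norm x \<le> t})) =
                emeasure unit_ball_prob T - emeasure unit_ball_prob (T \<inter> {x::'a. norm x \<le> t})"
              by (rule emeasure_Diff) (use U.emeasure_finite in \<open>auto simp del: emeasure_uniform_measure\<close>)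
            ultimately show ?thesis by (simp only:)
          qed
          have "emeasure unit_ball_prob (S \<inter> {x::'a. norm x \<le> t}) = ennreal (t ^ DIM('a)) * emeasure sphere_prob B"
            using norm_sgn_independent[OF 2 B] by (simp add: S_def Int_def conj_commute)
          moreover have "emeasure unit_ball_prob (UNIV \<inter> {x::'a. norm x \<le> t}) = ennreal (t ^ DIM('a))"
            using norm_sgn_independent[OF 2, of "UNIV :: 'a set"] sphere_prob.emeasure_space_1[where 'a='a] by simp
          moreover have "emeasure unit_ball_prob {x::'a. norm x \<in> {t<..}} = emeasure unit_ball_prob (UNIV \<inter> {x::'a. norm x \<in> {t<..}})"
            by simp
          ultimately have "emeasure ?M {t<..} = emeasure sphere_prob B * (1 - ennreal (t ^ DIM('a)))"
            "emeasure ?N {t<..} = emeasure sphere_prob B - emeasure sphere_prob B * ennreal (t ^ DIM('a))"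
            using split[of UNIV] split[OF S] U.emeasure_space_1 unfolding M[OF X] N[OF X] unfolding Sp
            by (simp_all add: mult.commute del: emeasure_uniform_measure)
          moreover have "emeasure sphere_prob B \<noteq> top"
            using sphere_prob.emeasure_finite[of B] by simp
          note ennreal_right_diff_distrib[OF this, of 1 "ennreal (t ^ DIM('a))"]
          ultimately show ?thesis by (simp only: mult_1_right)
        next
          case 3
          have "emeasure unit_ball_prob {x::'a. norm x \<in> {t<..}} = emeasure (unit_ball_prob :: 'a measure) {}"
            by (rule emeasure_eq_AE) (use AE1 3 in \<open>auto\<close>)
          moreover have "emeasure unit_ball_prob (S \<inter> {x::'a. norm x \<in> {t<..}}) = emeasure (unit_ball_prob :: 'a measure) {}"
            by (rule emeasure_eq_AE) (use AE1 3 in \<open>auto\<close>)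
          ultimately show ?thesis unfolding M[OF X] N[OF X] by (simp only: emeasure_empty mult_zero_right)
        qed
      qed
    qed auto
    then have "emeasure ?M A = emeasure ?N A" by simp
    then show "emeasure (distr (unit_ball_prob :: 'a measure) borel norm) A * emeasure sphere_prob B =
       emeasure (distr (unit_ball_prob :: 'a measure) (borel \<Otimes>\<^sub>M borel) (\<lambda>x. (norm x, sgn x))) (A \<times> B)"
      unfolding M[OF A] N[OF A]
      by (simp add: emeasure_distr vimage_def mult.commute S_def Int_def conj_commute)
  qed
qed

lemma polar_coordinates:
  fixes f :: "'a::euclidean_space \<Rightarrow> ennreal"
  assumes [measurable]: "f \<in> borel_measurable borel"
  shows "(\<integral>\<^sup>+x. f x \<partial>unit_ball_prob) =
    (\<integral>\<^sup>+r. (\<integral>\<^sup>+y. f (r *\<^sub>R y) \<partial>sphere_prob) \<partial>distr (unit_ball_prob :: 'a measure) borel norm)"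
proof -
  have "(\<integral>\<^sup>+x. f x \<partial>unit_ball_prob) = (\<integral>\<^sup>+x. f (norm x *\<^sub>R sgn x) \<partial>unit_ball_prob)"
    by (simp add: sgn_div_norm scaleR_scaleR) (rule nn_integral_cong, case_tac "x = 0", auto)
  also have "\<dots> = (\<integral>\<^sup>+p. f (fst p *\<^sub>R snd p) \<partial>distr unit_ball_prob (borel \<Otimes>\<^sub>M borel) (\<lambda>x. (norm x, sgn x)))"
    by (subst nn_integral_distr) auto
  also have "\<dots> = (\<integral>\<^sup>+p. f (fst p *\<^sub>R snd p) \<partial>(distr (unit_ball_prob :: 'a measure) borel norm \<Otimes>\<^sub>M (sphere_prob :: 'a measure)))"
    by (simp only: polar_product)
  also have "\<dots> = (\<integral>\<^sup>+r. (\<integral>\<^sup>+y. f (r *\<^sub>R y) \<partial>sphere_prob) \<partial>distr (unit_ball_prob :: 'a measure) borel norm)"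
    by (subst sphere_prob.nn_integral_fst[symmetric]) auto
  finally show ?thesis .
qed

lemma AE_radial: "AE r in distr (unit_ball_prob :: 'a::euclidean_space measure) borel norm. 0 < r \<and> r < 1"
  by (subst AE_distr_iff) (use AE_unit_ball[where 'a='a] in auto)

section \<open>Polar sets are Lebesgue null\<close>

lemma negative_part_sphere_le:
  fixes u :: "'a::euclidean_space \<Rightarrow> ereal"
  assumes c: "ereal c \<le> sphere_mean u a r" and M: "M \<ge> 0" "\<And>y. norm y = 1 \<Longrightarrow> u (a + r *\<^sub>R y) \<le> ereal M"
  shows "(\<integral>\<^sup>+ y. e2ennreal (- u (a + r *\<^sub>R y)) \<partial>sphere_prob) \<le> ennreal (M - c)"
proof -
  let ?A = "\<integral>\<^sup>+ y. e2ennreal (u (a + r *\<^sub>R y)) \<partial>sphere_prob"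
  let ?B = "\<integral>\<^sup>+ y. e2ennreal (- u (a + r *\<^sub>R y)) \<partial>sphere_prob"
  have "?A \<le> (\<integral>\<^sup>+ y. ennreal M \<partial>(sphere_prob :: 'a measure))"
  proof (rule nn_integral_mono_AE)
    show "AE y in sphere_prob. e2ennreal (u (a + r *\<^sub>R y)) \<le> ennreal M"
      using AE_sphere_prob
    proof eventually_elim
      case (elim y) then show ?case using e2ennreal_mono[OF M(2)[of y]] by simp
    qed
  qed
  also have "\<dots> = ennreal M" using sphere_prob.emeasure_space_1[where 'a='a] by simp
  finally have A: "?A \<le> ennreal M" .
  have "ereal c \<le> enn2ereal ?A - enn2ereal ?B"
    using c unfolding sphere_mean_def nn_integral_sphere_indicator .
  then show ?thesis using A M(1)
    by (cases ?A; cases ?B) (auto simp: top_unique intro!: ennreal_leI)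
qed

text \<open>The value \<open>0\<close> outside \<open>U\<close> makes the function Borel measurable on the whole space, whatever \<open>v\<close> is
outside \<open>U\<close>.\<close>

definition negative_part_on :: "'a set \<Rightarrow> ('a \<Rightarrow> ereal) \<Rightarrow> 'a \<Rightarrow> ennreal" where
  "negative_part_on U v x = e2ennreal (- (if x \<in> U then v x else 0))"

lemma negative_part_on_measurable [measurable]:
  fixes v :: "'a::euclidean_space \<Rightarrow> ereal"
  assumes "subharmonic_on U v" "open U"
  shows "negative_part_on U v \<in> borel_measurable borel"
proof -
  have [measurable]: "(\<lambda>x. if x \<in> U then v x else 0) \<in> borel_measurable borel"
    by (rule usc_on_borel) (use assms in \<open>auto simp: subharmonic_on_def\<close>)
  show ?thesis unfolding negative_part_on_def[abs_def] by measurable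
qed

text \<open>Let \<open>v \<le> M\<close> on the closed ball. By the sub-mean-value inequality at \<open>p\<close> the integral of the negative
part over each sphere with centre \<open>p\<close> in the ball is at most \<open>M - v p\<close>. Integrate over the radius.\<close>

lemma subharmonic_negative_part_integrable:
  fixes v :: "'a::euclidean_space \<Rightarrow> ereal"
  assumes v: "subharmonic_on U v" "open U" and R: "0 < R" "cball p R \<subseteq> U" and p: "v p \<noteq> - \<infinity>"
  shows "(\<integral>\<^sup>+x\<in>ball p R. negative_part_on U v x \<partial>lborel) < \<infinity>"
proof -
  note [measurable] = negative_part_on_measurable[OF v]
  have usc: "usc_on U v" and fin: "\<And>x. x \<in> U \<Longrightarrow> v x < \<infinity>"
    and sub: "\<And>a r. 0 < r \<Longrightarrow> cball a r \<subseteq> U \<Longrightarrow> v a \<le> sphere_mean v a r"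
    using v(1) unfolding subharmonic_on_def by auto
  obtain M where M: "M \<ge> 0" "\<And>x. x \<in> cball p R \<Longrightarrow> v x \<le> ereal M"
    by (rule usc_on_compact_bounded[OF usc_on_subset[OF usc R(2)]]) (use fin R(2) in auto)
  have "p \<in> cball p R" using R(1) by simp
  then have "v p < \<infinity>" using fin R(2) by blast
  then obtain c where c: "v p = ereal c" using p by (cases "v p") auto
  let ?\<rho> = "distr (unit_ball_prob :: 'a measure) borel norm"
  have rp: "prob_space ?\<rho>" by (rule prob_space.prob_space_distr[OF prob_space_unit_ball]) simp
  have "(\<integral>\<^sup>+x. negative_part_on U v (p + R *\<^sub>R x) \<partial>unit_ball_prob) =
    (\<integral>\<^sup>+s. (\<integral>\<^sup>+y. negative_part_on U v (p + R *\<^sub>R (s *\<^sub>R y)) \<partial>sphere_prob) \<partial>?\<rho>)"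
    by (rule polar_coordinates) measurable
  also have "\<dots> \<le> (\<integral>\<^sup>+s. ennreal (M - c) \<partial>?\<rho>)"
  proof (rule nn_integral_mono_AE)
    show "AE s in ?\<rho>. (\<integral>\<^sup>+y. negative_part_on U v (p + R *\<^sub>R (s *\<^sub>R y)) \<partial>sphere_prob) \<le> ennreal (M - c)"
      using AE_radial[where 'a='a]
    proof eventually_elim
      case (elim s)
      then have s: "0 < R * s" "R * s \<le> R" using R(1) by auto
      have inU: "p + (R * s) *\<^sub>R y \<in> cball p R" if "norm y = 1" for y
        using s that by (simp add: dist_norm)
      have "cball p (R * s) \<subseteq> U" using R(2) s by (auto simp: subset_iff)
      then have "ereal c \<le> sphere_mean v p (R * s)" using sub[OF s(1)] c by metis
      then have "(\<integral>\<^sup>+y. e2ennreal (- v (p + (R * s) *\<^sub>R y)) \<partial>sphere_prob) \<le> ennreal (M - c)"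
        by (rule negative_part_sphere_le[OF _ M(1)]) (use M(2) inU in auto)
      moreover have "(\<integral>\<^sup>+y. negative_part_on U v (p + R *\<^sub>R (s *\<^sub>R y)) \<partial>sphere_prob) =
          (\<integral>\<^sup>+y. e2ennreal (- v (p + (R * s) *\<^sub>R y)) \<partial>sphere_prob)"
      proof (rule nn_integral_cong_AE)
        show "AE y in sphere_prob. negative_part_on U v (p + R *\<^sub>R (s *\<^sub>R y)) = e2ennreal (- v (p + (R * s) *\<^sub>R y))"
          using AE_sphere_prob
        proof eventually_elim
          case (elim y)
          then have "p + (R * s) *\<^sub>R y \<in> U" using inU R(2) by blast
          then show ?case by (simp add: negative_part_on_def)
        qed
      qed
      ultimately show ?case by simp
    qed
  qed
  also have "\<dots> = ennreal (M - c)" using prob_space.emeasure_space_1[OF rp] by simp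
  finally have "(\<integral>\<^sup>+x. negative_part_on U v (p + R *\<^sub>R x) \<partial>unit_ball_prob) < top"
    by (rule le_less_trans) simp
  then show ?thesis
    unfolding ball_integral_affine[OF negative_part_on_measurable[OF v] R(1)]
    using emeasure_unit_ball(2)[where 'a='a] by (simp add: ennreal_mult_less_top less_top)
qed

lemma AE_ball_not_MInf:
  fixes v :: "'a::euclidean_space \<Rightarrow> ereal"
  assumes v: "subharmonic_on U v" "open U" and R: "0 < R" "cball p R \<subseteq> U" and p: "v p \<noteq> - \<infinity>"
  shows "AE x in lborel. x \<in> ball p R \<longrightarrow> v x \<noteq> - \<infinity>"
proof -
  note [measurable] = negative_part_on_measurable[OF v]
  have "AE x in lborel. negative_part_on U v x * indicator (ball p R) x \<noteq> \<infinity>"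
  proof (rule nn_integral_PInf_AE)
    have [measurable]: "ball p R \<in> sets borel" by simp
    show "(\<lambda>x. negative_part_on U v x * indicator (ball p R) x) \<in> borel_measurable lborel" by measurable
  qed (use subharmonic_negative_part_integrable[OF assms] in simp)
  then show ?thesis
  proof eventually_elim
    case (elim x)
    have "x \<in> U" if "x \<in> ball p R" using that R(2) ball_subset_cball by blast
    with elim show ?case by (auto simp: negative_part_on_def)
  qed
qed

lemma negligible_iff_AE: "negligible (S :: 'a::euclidean_space set) \<longleftrightarrow> (AE x in lborel. x \<notin> S)"
proof
  assume "negligible S"
  then have "AE x in lebesgue. x \<notin> S" unfolding negligible_iff_null_sets by (rule AE_not_in)
  then show "AE x in lborel. x \<notin> S" by (simp add: AE_completion_iff)
next
  assume "AE x in lborel. x \<notin> S"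
  then obtain N where "N \<in> null_sets lborel" "S \<subseteq> N"
    unfolding eventually_ae_filter by auto
  then show "negligible S"
    using negligible_iff_null_sets negligible_subset null_sets_completionI by blast
qed

lemma AE_ball_witness:
  fixes a :: "'a::euclidean_space"
  assumes "AE x in lborel. P x" "0 < e"
  obtains p where "p \<in> ball a e" "P p"
proof -
  have "\<not> negligible (ball a e)" using assms(2) by (simp add: open_not_negligible)
  moreover have "negligible {x. \<not> P x}" using assms(1) by (simp add: negligible_iff_AE)
  ultimately have "\<not> ball a e \<subseteq> {x. \<not> P x}" using negligible_subset by blast
  then show ?thesis using that by blast
qed

text \<open>Let \<open>N\<close> be the set where the function \<open>v\<close> of the definition of polarity is \<open>-\<infinity>\<close>. Call a point good
if \<open>N\<close> is null near it. By integrability on balls, \<open>v y \<noteq> -\<infinity>\<close> makes all points of a ball around \<open>y\<close>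
good. The set of good points is open; it is also relatively closed in \<open>U\<close>, because arbitrarily close
to a limit of good points there are points where \<open>v\<close> is finite, and the balls around these have
radii bounded below. So the good points of a component of \<open>U\<close> are none or all, and they are
not none.\<close>

lemma polar_negligible:
  fixes E :: "'a::euclidean_space set"
  assumes "polar E"
  shows "negligible E"
proof -
  obtain U v where U: "open U" "E \<subseteq> U" "subharmonic_on U v" "\<And>C. C \<in> components U \<Longrightarrow> \<exists>y\<in>C. v y \<noteq> - \<infinity>"
    "\<And>x. x \<in> E \<Longrightarrow> v x = - \<infinity>"
    using assms unfolding polar_def by blast
  define N where "N = {x\<in>U. v x = - \<infinity>}"
  define good where "good = {x. \<exists>\<delta>>0. negligible (N \<inter> ball x \<delta>)}"
  have near: "x \<in> good" if z: "z \<in> U" "v z \<noteq> - \<infinity>" "0 < R" "cball z R \<subseteq> U" "x \<in> ball z R" for x z R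
  proof -
    have "AE x in lborel. x \<in> ball z R \<longrightarrow> v x \<noteq> - \<infinity>"
      by (rule AE_ball_not_MInf[OF U(3,1) z(3,4,2)])
    then have neg: "negligible (N \<inter> ball z R)"
      unfolding negligible_iff_AE by eventually_elim (auto simp: N_def)
    obtain \<delta> where "\<delta> > 0" "ball x \<delta> \<subseteq> ball z R" using z(5) open_contains_ball open_ball by blast
    then show ?thesis unfolding good_def using negligible_subset[OF neg] by blast
  qed
  have open_good: "open good" unfolding open_contains_ball
  proof
    fix x assume "x \<in> good"
    then obtain \<delta> where \<delta>: "\<delta> > 0" "negligible (N \<inter> ball x \<delta>)" unfolding good_def by blast
    have "ball x \<delta> \<subseteq> good"
    proof
      fix y assume "y \<in> ball x \<delta>"
      then obtain e where "e > 0" "ball y e \<subseteq> ball x \<delta>" using open_contains_ball open_ball by blast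
      then show "y \<in> good" unfolding good_def using negligible_subset[OF \<delta>(2)] by blast
    qed
    then show "\<exists>e>0. ball x e \<subseteq> good" using \<delta> by blast
  qed
  have limit: "\<exists>e>0. ball x e \<inter> good = {}" if x: "x \<in> U" "x \<notin> good" for x
  proof -
    obtain \<delta> where \<delta>: "\<delta> > 0" "cball x \<delta> \<subseteq> U" using U(1) x(1) open_contains_cball by blast
    have "ball x (\<delta> / 4) \<inter> good = {}"
    proof (rule ccontr)
      assume "ball x (\<delta> / 4) \<inter> good \<noteq> {}"
      then obtain z where z: "dist x z < \<delta> / 4" "z \<in> good" by auto
      then obtain \<eta> where \<eta>: "\<eta> > 0" "negligible (N \<inter> ball z \<eta>)" unfolding good_def by blast
      have "AE y in lborel. y \<notin> N \<inter> ball z \<eta>" using \<eta>(2) negligible_iff_AE by blast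
      then obtain y where y: "y \<in> ball z (min \<eta> (\<delta> / 4))" "y \<notin> N \<inter> ball z \<eta>"
        by (rule AE_ball_witness[where e="min \<eta> (\<delta> / 4)" and a=z]) (use \<eta>(1) \<delta>(1) in auto)
      have dxy: "dist x y < \<delta> / 2" using z(1) y(1) dist_triangle[of x y z] by simp
      then have "y \<in> cball x \<delta>" using \<delta>(1) by simp
      then have "y \<in> U" using \<delta>(2) by blast
      then have "v y \<noteq> - \<infinity>" using y by (auto simp: N_def)
      moreover have "cball y (\<delta> / 2) \<subseteq> U"
      proof -
        have "cball y (\<delta> / 2) \<subseteq> cball x \<delta>"
        proof
          fix w assume "w \<in> cball y (\<delta> / 2)"
          then show "w \<in> cball x \<delta>" using dxy dist_triangle[of x w y] by simp
        qed
        then show ?thesis using \<delta>(2) by blast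
      qed
      ultimately have "x \<in> good"
        using near[of y "\<delta> / 2" x] \<open>y \<in> U\<close> \<delta>(1) dxy by (simp add: dist_commute)
      then show False using x(2) by blast
    qed
    then show ?thesis using \<delta>(1) by (intro exI[of _ "\<delta> / 4"]) auto
  qed
  have all: "x \<in> good" if x: "x \<in> U" for x
  proof -
    define C where "C = connected_component_set U x"
    have C: "C \<in> components U" "x \<in> C" using x by (auto simp: C_def componentsI)
    have CU: "C \<subseteq> U" using C(1) in_components_subset by blast
    define V where "V = \<Union> {ball z e |z e. ball z e \<inter> good = {}}"
    have "open V" unfolding V_def by auto
    have "V \<inter> good = {}" unfolding V_def by blast
    have cover: "C \<subseteq> good \<union> V"
    proof
      fix z assume "z \<in> C"
      then have "z \<in> U" using CU by blast
      then show "z \<in> good \<union> V"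
        using limit[of z] unfolding V_def by (metis (mono_tags, lifting) UnCI UnionI centre_in_ball mem_Collect_eq)
    qed
    obtain y where y: "y \<in> C" "v y \<noteq> - \<infinity>" using U(4)[OF C(1)] by blast
    then have "y \<in> U" using CU by blast
    then obtain e where "e > 0" "cball y e \<subseteq> U" using U(1) open_contains_cball by blast
    then have "y \<in> good" using near[of y e y] \<open>y \<in> U\<close> y(2) by simp
    moreover have "connected C" using C(1) in_components_connected by blast
    then have "good \<inter> C = {} \<or> V \<inter> C = {}"
      using connectedD[OF _ open_good \<open>open V\<close> _ cover] \<open>V \<inter> good = {}\<close> by blast
    ultimately have "V \<inter> C = {}" using y(1) by blast
    then show ?thesis using cover C(2) by blast
  qed
  have "negligible N"
    unfolding locally_negligible_alt[of N]
  proof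
    fix x assume "x \<in> N"
    then have "x \<in> good" using all by (simp add: N_def)
    then obtain \<delta> where "\<delta> > 0" "negligible (N \<inter> ball x \<delta>)" unfolding good_def by blast
    then show "\<exists>T. openin (top_of_set N) T \<and> x \<in> T \<and> negligible T"
      using \<open>x \<in> N\<close> by (intro exI[of _ "N \<inter> ball x \<delta>"]) (auto intro: openin_open_Int)
  qed
  moreover have "E \<subseteq> N" using U(2,5) by (auto simp: N_def)
  ultimately show ?thesis using negligible_subset by blast
qed

text \<open>Add to \<open>f\<close> the function that is \<open>\<infinity>\<close> on a null set containing all points without \<open>P\<close>. This does not
change the integral over the ball, and in polar coordinates the integral over almost every sphere is
finite.\<close>

lemma generic_radius:
  fixes f :: "'a::euclidean_space \<Rightarrow> ennreal"
  assumes f [measurable]: "f \<in> borel_measurable borel" and R: "0 < R"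
    and fin: "(\<integral>\<^sup>+x\<in>ball a R. f x \<partial>lborel) < \<infinity>" and P: "AE x in lborel. P x"
  obtains r where "0 < r" "r < R" "(\<integral>\<^sup>+y. f (a + r *\<^sub>R y) \<partial>sphere_prob) < \<infinity>"
    "AE y in sphere_prob. P (a + r *\<^sub>R y)"
proof -
  obtain N where N: "N \<in> null_sets lborel" "{x. \<not> P x} \<subseteq> N"
    using P unfolding eventually_ae_filter by auto
  have Nb [measurable]: "N \<in> sets borel" using N(1) by auto
  define g where "g = (\<lambda>x. f x + \<infinity> * indicator N x)"
  have [measurable]: "g \<in> borel_measurable borel" unfolding g_def by measurable
  let ?\<rho> = "distr (unit_ball_prob :: 'a measure) borel norm"
  have "(\<integral>\<^sup>+x\<in>ball a R. g x \<partial>lborel) = (\<integral>\<^sup>+x\<in>ball a R. f x \<partial>lborel)"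
  proof (rule nn_integral_cong_AE)
    show "AE x in lborel. g x * indicator (ball a R) x = f x * indicator (ball a R) x"
      using AE_not_in[OF N(1)] by eventually_elim (simp add: g_def)
  qed
  then have "ennreal (R ^ DIM('a)) * emeasure lborel (ball (0::'a) 1) * (\<integral>\<^sup>+x. g (a + R *\<^sub>R x) \<partial>unit_ball_prob) < \<infinity>"
    using fin by (simp add: ball_integral_affine[symmetric] R)
  then have "(\<integral>\<^sup>+x. g (a + R *\<^sub>R x) \<partial>unit_ball_prob) \<noteq> \<infinity>"
    using emeasure_unit_ball[where 'a='a] R by (auto simp: ennreal_mult_less_top ennreal_mult_eq_top_iff)
  also have "(\<integral>\<^sup>+x. g (a + R *\<^sub>R x) \<partial>unit_ball_prob) =
      (\<integral>\<^sup>+s. (\<integral>\<^sup>+y. g (a + R *\<^sub>R (s *\<^sub>R y)) \<partial>sphere_prob) \<partial>?\<rho>)"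
    by (rule polar_coordinates) measurable
  finally have "AE s in ?\<rho>. (\<integral>\<^sup>+y. g (a + R *\<^sub>R (s *\<^sub>R y)) \<partial>sphere_prob) \<noteq> \<infinity>"
    by (intro nn_integral_PInf_AE) measurable
  with AE_radial[where 'a='a] have AE: "AE s in ?\<rho>. 0 < s \<and> s < 1 \<and> (\<integral>\<^sup>+y. g (a + R *\<^sub>R (s *\<^sub>R y)) \<partial>sphere_prob) \<noteq> \<infinity>"
    by eventually_elim simp
  have "prob_space ?\<rho>" by (rule prob_space.prob_space_distr[OF prob_space_unit_ball]) simp
  then have "\<not> (AE s in ?\<rho>. False)" by (simp add: prob_space.AE_False)
  then have "\<exists>s. 0 < s \<and> s < 1 \<and> (\<integral>\<^sup>+y. g (a + R *\<^sub>R (s *\<^sub>R y)) \<partial>sphere_prob) \<noteq> \<infinity>"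
    using eventually_mono[OF AE, of "\<lambda>_. False"] by blast
  then obtain s where s: "0 < s" "s < 1" "(\<integral>\<^sup>+y. g (a + (R * s) *\<^sub>R y) \<partial>sphere_prob) \<noteq> \<infinity>"
    by (auto simp: scaleR_scaleR)
  show ?thesis
  proof (rule that[of "R * s"])
    show "0 < R * s" "R * s < R" using s R by auto
    have "(\<integral>\<^sup>+y. f (a + (R * s) *\<^sub>R y) \<partial>sphere_prob) \<le> (\<integral>\<^sup>+y. g (a + (R * s) *\<^sub>R y) \<partial>sphere_prob)"
      by (rule nn_integral_mono) (simp add: g_def)
    also have "\<dots> < \<infinity>" using s(3) by (simp add: less_top)
    finally show "(\<integral>\<^sup>+y. f (a + (R * s) *\<^sub>R y) \<partial>sphere_prob) < \<infinity>" .
    have "AE y in sphere_prob. g (a + (R * s) *\<^sub>R y) \<noteq> \<infinity>"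
      by (rule nn_integral_PInf_AE) (use s(3) in auto)
    then show "AE y in sphere_prob. P (a + (R * s) *\<^sub>R y)"
    proof eventually_elim
      case (elim y)
      then have "a + (R * s) *\<^sub>R y \<notin> N" by (auto simp: g_def)
      then show ?case using N(2) by blast
    qed
  qed
qed

section \<open>Gluing along a sphere\<close>

lemma submean_at_mono:
  assumes u: "submean_at u x" and e: "0 < e" and le: "\<And>y. dist x y < e \<Longrightarrow> u y \<le> v y" and eq: "v x = u x"
  shows "submean_at v x"
proof -
  obtain C d where Cd: "0 < d" "\<And>\<rho> G. 0 < \<rho> \<Longrightarrow> \<rho> < d \<Longrightarrow> integrable sphere_prob G \<Longrightarrow>
     (\<And>y. norm y = 1 \<Longrightarrow> u (x + \<rho> *\<^sub>R y) \<le> ereal (G y)) \<Longrightarrow>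
     u x \<le> ereal ((\<integral>y. G y \<partial>sphere_prob) + C * \<rho> ^ 3)"
    using u unfolding submean_at_def by metis
  show ?thesis unfolding submean_at_def
  proof (rule exI[of _ C], rule exI[of _ "min d e"], intro conjI allI impI)
    show "0 < min d e" using Cd e by simp
    fix \<rho> G assume \<rho>: "0 < \<rho>" "\<rho> < min d e" and G: "integrable sphere_prob G"
      "\<forall>y. norm y = 1 \<longrightarrow> v (x + \<rho> *\<^sub>R y) \<le> ereal (G y)"
    have "u (x + \<rho> *\<^sub>R y) \<le> ereal (G y)" if "norm y = 1" for y
      using le[of "x + \<rho> *\<^sub>R y"] G(2) \<rho> that by (auto simp: dist_norm intro: order_trans)
    then show "v x \<le> ereal ((\<integral>y. G y \<partial>sphere_prob) + C * \<rho> ^ 3)"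
      unfolding eq using \<rho> by (intro Cd(2) G(1)) auto
  qed
qed

text \<open>If \<open>G\<close> is a majorant of \<open>V\<close> minus the Poisson integral on a sphere, then \<open>G\<close> plus the Poisson integral
is a real majorant of \<open>V\<close>; no difference of infinite values occurs.\<close>

lemma submean_at_diff_poisson:
  fixes x :: "'a::euclidean_space"
  assumes V: "submean_at V x" and g: "integrable sphere_prob g" and x: "norm x < 1"
  shows "submean_at (\<lambda>z. V z - ereal (poisson_integral g z)) x"
proof -
  obtain C d where Cd: "0 < d" "\<And>\<rho> G. 0 < \<rho> \<Longrightarrow> \<rho> < d \<Longrightarrow> integrable sphere_prob G \<Longrightarrow>
     (\<And>y. norm y = 1 \<Longrightarrow> V (x + \<rho> *\<^sub>R y) \<le> ereal (G y)) \<Longrightarrow>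
     V x \<le> ereal ((\<integral>y. G y \<partial>sphere_prob) + C * \<rho> ^ 3)"
    using V unfolding submean_at_def by metis
  obtain C' d' where Cd': "0 < d'" 
    "\<And>\<rho>. 0 < \<rho> \<Longrightarrow> \<rho> < d' \<Longrightarrow> integrable sphere_prob (\<lambda>\<theta>. poisson_integral g (x + \<rho> *\<^sub>R \<theta>))"
    "\<And>\<rho>. 0 < \<rho> \<Longrightarrow> \<rho> < d' \<Longrightarrow>
      \<bar>(\<integral>\<theta>. poisson_integral g (x + \<rho> *\<^sub>R \<theta>) \<partial>sphere_prob) - poisson_integral g x\<bar> \<le> C' * \<rho> ^ 3"
    by (rule poisson_integral_local_mean[OF g x]) (rule that)
  show ?thesis unfolding submean_at_def
  proof (rule exI[of _ "C + C'"], rule exI[of _ "min d d'"], intro conjI allI impI)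
    show "0 < min d d'" using Cd Cd' by simp
    fix \<rho> G assume \<rho>: "0 < \<rho>" "\<rho> < min d d'" and G: "integrable sphere_prob G"
      "\<forall>y. norm y = 1 \<longrightarrow> V (x + \<rho> *\<^sub>R y) - ereal (poisson_integral g (x + \<rho> *\<^sub>R y)) \<le> ereal (G y)"
    have PI: "integrable sphere_prob (\<lambda>\<theta>. poisson_integral g (x + \<rho> *\<^sub>R \<theta>))" using Cd'(2) \<rho> by simp
    have "V x \<le> ereal ((\<integral>y. G y + poisson_integral g (x + \<rho> *\<^sub>R y) \<partial>sphere_prob) + C * \<rho> ^ 3)"
    proof (rule Cd(2))
      show "integrable sphere_prob (\<lambda>y. G y + poisson_integral g (x + \<rho> *\<^sub>R y))" using G(1) PI by simp
      fix y :: 'a assume "norm y = 1"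
      with G(2) have "V (x + \<rho> *\<^sub>R y) - ereal (poisson_integral g (x + \<rho> *\<^sub>R y)) \<le> ereal (G y)" by blast
      then show "V (x + \<rho> *\<^sub>R y) \<le> ereal (G y + poisson_integral g (x + \<rho> *\<^sub>R y))"
        by (cases "V (x + \<rho> *\<^sub>R y)") auto
    qed (use \<rho> in auto)
    also have "(\<integral>y. G y + poisson_integral g (x + \<rho> *\<^sub>R y) \<partial>sphere_prob) =
       (\<integral>y. G y \<partial>sphere_prob) + (\<integral>y. poisson_integral g (x + \<rho> *\<^sub>R y) \<partial>sphere_prob)"
      by (rule Bochner_Integration.integral_add[OF G(1) PI])
    also have "ereal (\<dots> + C * \<rho> ^ 3) \<le> ereal ((\<integral>y. G y \<partial>sphere_prob) + (poisson_integral g x + C' * \<rho> ^ 3) + C * \<rho> ^ 3)"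
      using Cd'(3)[of \<rho>] \<rho> by (simp add: abs_le_iff)
    finally show "V x - ereal (poisson_integral g x) \<le> ereal ((\<integral>y. G y \<partial>sphere_prob) + (C + C') * \<rho> ^ 3)"
      by (cases "V x") (auto simp: algebra_simps)
  qed
qed

lemma poisson_integral_mono:
  assumes "integrable sphere_prob f" "integrable sphere_prob g" "AE y in sphere_prob. f y \<le> g y" "norm x < 1"
  shows "poisson_integral f x \<le> poisson_integral g x"
  unfolding poisson_integral_def
proof (rule integral_mono_AE)
  show "AE y in sphere_prob. poisson_kernel x y * f y \<le> poisson_kernel x y * g y"
    using assms(3) by eventually_elim (use poisson_kernel_nonneg[OF assms(4)] in \<open>auto intro: mult_left_mono\<close>)
qed (use assms poisson_integrable in auto)

text \<open>Let \<open>h\<close> be the Poisson integral of \<open>w - \<omega>\<close>, transplanted to the ball, and let \<open>v\<close> be the maximum of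
\<open>u\<close> and \<open>W - h\<close> in the ball and \<open>u\<close> outside. In the ball \<open>W - h\<close> is at most the Poisson integral of
any continuous majorant \<open>G\<close> of \<open>u\<close> on the sphere, and this tends to \<open>G \<xi>\<close> at a boundary point \<open>\<xi>\<close>;
choosing \<open>G \<xi>\<close> close to \<open>u \<xi>\<close> gives upper semicontinuity across the sphere. The sub-mean-value
inequality only has to be checked on small spheres: where \<open>v = u\<close> it is inherited from \<open>u \<le> v\<close>, and
elsewhere from \<open>W - h\<close>.\<close>

theorem subharmonic_poisson_gluing:
  fixes W u :: "'a::euclidean_space \<Rightarrow> ereal" and w \<omega> :: "'a \<Rightarrow> real"
  assumes \<Omega>: "open \<Omega>" and r: "0 < r" "cball a r \<subseteq> \<Omega>"
    and W: "subharmonic_on \<Omega> W" and u: "subharmonic_on \<Omega> u" and le: "\<And>x. x \<in> \<Omega> \<Longrightarrow> u x \<le> W x"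
    and w: "integrable sphere_prob w" "AE y in sphere_prob. W (a + r *\<^sub>R y) = ereal (w y)"
    and \<omega>: "integrable sphere_prob \<omega>" "AE y in sphere_prob. u (a + r *\<^sub>R y) = ereal (\<omega> y)"
  obtains v where "subharmonic_on \<Omega> v" "\<And>x. x \<in> \<Omega> \<Longrightarrow> u x \<le> v x" "\<And>x. x \<in> \<Omega> \<Longrightarrow> v x \<le> W x"
    "\<And>x. x \<notin> ball a r \<Longrightarrow> v x = u x"
    "W a - ereal (\<integral>y. w y - \<omega> y \<partial>sphere_prob) \<le> v a"
proof -
  \<comment> \<open>mutually inverse maps between the unit ball and the ball of the statement; the second is
    spelled out as an affine map to match \<open>submean_at_affine\<close>\<close>
  define pt where "pt = (\<lambda>y. a + r *\<^sub>R y)"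
  define unit_pt where "unit_pt = (\<lambda>x. (- (1 / r)) *\<^sub>R a + (1 / r) *\<^sub>R x)"
  have pt_unit: "pt (unit_pt x) = x" for x using r(1) by (simp add: pt_def unit_pt_def algebra_simps)
  have norm_unit_pt: "norm (unit_pt x) = dist a x / r" for x
  proof -
    have "unit_pt x = (1 / r) *\<^sub>R (x - a)" by (simp add: unit_pt_def algebra_simps)
    then show ?thesis using r(1) by (simp add: dist_norm norm_minus_commute divide_inverse mult.commute)
  qed
  have dist_unit_pt: "dist (unit_pt x) (unit_pt y) = dist x y / r" for x y
  proof -
    have "unit_pt x - unit_pt y = (1 / r) *\<^sub>R (x - y)" by (simp add: unit_pt_def algebra_simps)
    then show ?thesis using r(1) by (simp add: dist_norm divide_inverse mult.commute)
  qed
  have unit_pt_ball: "norm (unit_pt x) < 1 \<longleftrightarrow> x \<in> ball a r" for x using r(1) by (simp add: norm_unit_pt)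
  have unit_pt_cont: "continuous_on S unit_pt" for S unfolding unit_pt_def by (intro continuous_intros)
  have pt_\<Omega>: "pt y \<in> \<Omega>" if "norm y \<le> 1" for y
    using r that by (auto simp: pt_def subset_iff dist_norm intro!: mult_left_le)
  have pt_cont: "continuous_on S pt" for S unfolding pt_def by (intro continuous_intros)
  have usc: "usc_on \<Omega> W" "usc_on \<Omega> u" and fin: "\<And>x. x \<in> \<Omega> \<Longrightarrow> W x < \<infinity>" "\<And>x. x \<in> \<Omega> \<Longrightarrow> u x < \<infinity>"
    using W u unfolding subharmonic_on_def by auto
  define g where "g = (\<lambda>y. w y - \<omega> y)"
  have g: "integrable sphere_prob g" unfolding g_def using w \<omega> by simp
  define h where "h = poisson_integral g"
  have g0: "AE y in sphere_prob. 0 \<le> g y"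
    using w(2) \<omega>(2) AE_sphere_prob
  proof eventually_elim
    case (elim y)
    then have "ereal (\<omega> y) \<le> ereal (w y)" using le[of "pt y"] pt_\<Omega>[of y] by (simp add: pt_def)
    then show ?case by (simp add: g_def)
  qed
  have h0: "0 \<le> h x" if "norm x < 1" for x
    unfolding h_def using poisson_integral_mono[OF _ g _ that, of "\<lambda>_. 0"] g0 by (simp add: poisson_integral_def)
  have ha: "h 0 = (\<integral>y. w y - \<omega> y \<partial>sphere_prob)"
  proof -
    have [measurable]: "g \<in> borel_measurable borel" using g by simp
    have "h 0 = (\<integral>y. g y \<partial>sphere_prob)" unfolding h_def poisson_integral_def
      by (rule integral_cong_AE) (use AE_sphere_prob in \<open>auto simp: poisson_kernel_0\<close>)
    then show ?thesis by (simp add: g_def)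
  qed
  have usc': "usc_on (cball 0 1) (\<lambda>y. W (pt y))" "usc_on (sphere 0 1) (\<lambda>y. u (pt y))"
    by (rule usc_on_compose[OF usc(1) pt_cont] usc_on_compose[OF usc(2) pt_cont]; use pt_\<Omega> in auto)+
  have subW: "submean_at (\<lambda>y. W (pt y)) x" if "norm x < 1" for x
    unfolding pt_def
    by (rule submean_at_affine[OF subharmonic_on_submean_at[OF W \<Omega>] r(1)]) (use pt_\<Omega>[of x] that in \<open>auto simp: pt_def\<close>)
  have key: "W x - ereal (h (unit_pt x)) \<le> ereal (poisson_integral G (unit_pt x))"
    if x: "x \<in> ball a r" and G: "continuous_on UNIV G" "\<And>y. norm y = 1 \<Longrightarrow> u (pt y) \<le> ereal (G y)" for x G
  proof -
    have n: "norm (unit_pt x) < 1" using x unit_pt_ball by blast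
    have "W (pt (unit_pt x)) \<le> ereal (poisson_integral w (unit_pt x))"
      by (rule le_poisson_integral[OF usc'(1) _ subW w(1) _ n]) (use fin pt_\<Omega> w(2) in \<open>auto simp: pt_def\<close>)
    moreover have "poisson_integral w (unit_pt x) = h (unit_pt x) + poisson_integral \<omega> (unit_pt x)"
      unfolding h_def poisson_integral_def g_def right_diff_distrib
      using poisson_integrable[OF w(1) n] poisson_integrable[OF \<omega>(1) n]
      by (simp add: Bochner_Integration.integral_diff)
    moreover have "poisson_integral \<omega> (unit_pt x) \<le> poisson_integral G (unit_pt x)"
    proof (rule poisson_integral_mono[OF \<omega>(1) integrable_sphere_continuous[OF G(1)] _ n])
      show "AE y in sphere_prob. \<omega> y \<le> G y"
        using \<omega>(2) AE_sphere_prob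
      proof eventually_elim
        case (elim y)
        then show ?case using G(2)[of y] by (simp add: pt_def)
      qed
    qed
    ultimately have "W x \<le> ereal (h (unit_pt x) + poisson_integral G (unit_pt x))"
      unfolding pt_unit by (metis (no_types, opaque_lifting) add_left_mono ereal_less_eq(3) order_trans)
    then show ?thesis by (cases "W x") auto
  qed
  define v where "v = (\<lambda>x. if x \<in> ball a r then max (u x) (W x - ereal (h (unit_pt x))) else u x)"
  have uv: "u x \<le> v x" for x by (simp add: v_def)
  have vW: "v x \<le> W x" if "x \<in> \<Omega>" for x
  proof (cases "x \<in> ball a r")
    case True
    then have "0 \<le> h (unit_pt x)" using h0 unit_pt_ball by blast
    then have "W x - ereal (h (unit_pt x)) \<le> W x" by (cases "W x") auto
    then show ?thesis using True le[OF that] by (simp add: v_def)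
  qed (use le[OF that] in \<open>simp add: v_def\<close>)
  have "continuous_on (ball a r) (\<lambda>x. h (unit_pt x))"
    unfolding h_def
    by (rule continuous_on_compose2[OF continuous_on_poisson_integral[OF g] unit_pt_cont]) (use unit_pt_ball in auto)
  then have "usc_on (ball a r) (\<lambda>x. W x + ereal (- h (unit_pt x)))"
    using r(2) by (intro usc_on_add_continuous usc_on_subset[OF usc(1)] continuous_on_minus) auto
  then have usc_in: "usc_on (ball a r) (\<lambda>x. max (u x) (W x - ereal (h (unit_pt x))))"
    using r(2) by (intro usc_on_max usc_on_subset[OF usc(2)]) (auto simp: minus_ereal_def)
  have "usc_on \<Omega> v"
    unfolding usc_on_iff
  proof (intro ballI allI impI)
    fix x c assume x: "x \<in> \<Omega>" and c: "v x < c"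
    show "\<exists>d>0. \<forall>y\<in>\<Omega>. dist y x < d \<longrightarrow> v y < c"
    proof (cases "x \<in> ball a r")
      case True
      then have "max (u x) (W x - ereal (h (unit_pt x))) < c" using c by (simp add: v_def)
      then obtain d where d: "d > 0" "\<And>y. y \<in> ball a r \<Longrightarrow> dist y x < d \<Longrightarrow> max (u y) (W y - ereal (h (unit_pt y))) < c"
        using usc_in True unfolding usc_on_iff by blast
      obtain e where e: "e > 0" "ball x e \<subseteq> ball a r" using True open_contains_ball open_ball by blast
      show ?thesis
      proof (intro exI[of _ "min d e"] conjI ballI impI)
        fix y assume "dist y x < min d e"
        then have "y \<in> ball a r" "dist y x < d" using e(2) by (auto simp: dist_commute)
        then show "v y < c" using d(2)[of y] by (simp add: v_def)
      qed (use d e in auto)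
    next
      case False
      then have "u x < c" using c by (simp add: v_def)
      then obtain d where d: "d > 0" "\<And>y. y \<in> \<Omega> \<Longrightarrow> dist y x < d \<Longrightarrow> u y < c"
        using usc(2) x unfolding usc_on_iff by blast
      have "\<exists>e>0. \<forall>y\<in>ball a r. dist y x < e \<longrightarrow> W y - ereal (h (unit_pt y)) < c"
      proof (cases "dist a x = r")
        case out: False
        then have "dist a x > r" using False by simp
        moreover have "\<not> dist y x < dist a x - r" if "y \<in> ball a r" for y
          using that dist_triangle[of a x y] by simp
        ultimately show ?thesis by (intro exI[of _ "dist a x - r"]) auto
      next
        case bd: True
        define \<xi> where "\<xi> = unit_pt x"
        have \<xi>: "norm \<xi> = 1" using bd r(1) by (simp add: \<xi>_def norm_unit_pt)
        obtain G :: "nat \<Rightarrow> 'a \<Rightarrow> real" where G: "\<And>k. continuous_on UNIV (G k)" "\<And>k y. G (Suc k) y \<le> G k y"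
          "\<And>k y. y \<in> sphere 0 1 \<Longrightarrow> u (pt y) \<le> ereal (G k y)"
          "\<And>y. y \<in> sphere 0 1 \<Longrightarrow> (\<lambda>k. ereal (G k y)) \<longlonglongrightarrow> u (pt y)"
          by (rule usc_on_compact_approx[OF usc'(2)]) (use fin pt_\<Omega> in auto)
        have "(\<lambda>k. ereal (G k \<xi>)) \<longlonglongrightarrow> u x" using G(4)[of \<xi>] \<xi> by (simp add: \<xi>_def pt_unit)
        then have "\<forall>\<^sub>F k in sequentially. ereal (G k \<xi>) < c" using \<open>u x < c\<close> by (rule order_tendstoD)
        then obtain k where k: "ereal (G k \<xi>) < c" by (auto simp: eventually_sequentially)
        then obtain b where b: "G k \<xi> < b" "ereal b < c" using ereal_dense2 by (metis ereal_less_eq(3) less_ereal.simps(1))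
        have "continuous_on (cball 0 1) (dirichlet_solution (G k))" by (rule continuous_on_dirichlet_solution[OF G(1)])
        moreover have "\<xi> \<in> cball 0 1" using \<xi> by simp
        moreover have "0 < b - G k \<xi>" using b by simp
        ultimately obtain e where e: "e > 0" "\<And>z. z \<in> cball 0 1 \<Longrightarrow> dist z \<xi> < e \<Longrightarrow>
            dist (dirichlet_solution (G k) z) (dirichlet_solution (G k) \<xi>) < b - G k \<xi>"
          unfolding continuous_on_iff by metis
        show ?thesis
        proof (intro exI[of _ "r * e"] conjI ballI impI)
          show "0 < r * e" using r(1) e(1) by simp
          fix y assume y: "y \<in> ball a r" "dist y x < r * e"
          have n: "norm (unit_pt y) < 1" using y(1) unit_pt_ball by blast
          have "dist (unit_pt y) \<xi> < e" using y(2) r(1) by (simp add: \<xi>_def dist_unit_pt divide_less_eq mult.commute)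
          then have "dirichlet_solution (G k) (unit_pt y) < b"
            using e(2)[of "unit_pt y"] n \<xi> by (simp add: dirichlet_solution_def dist_real_def abs_less_iff)
          then have "poisson_integral (G k) (unit_pt y) < b" using n by (simp add: dirichlet_solution_def)
          moreover have "W y - ereal (h (unit_pt y)) \<le> ereal (poisson_integral (G k) (unit_pt y))"
            by (rule key[OF y(1) G(1)]) (use G(3) in auto)
          ultimately show "W y - ereal (h (unit_pt y)) < c"
            using b(2) by (meson ereal_less_eq(3) less_imp_le order_le_less_trans)
        qed
      qed
      then obtain e where e: "e > 0" "\<And>y. y \<in> ball a r \<Longrightarrow> dist y x < e \<Longrightarrow> W y - ereal (h (unit_pt y)) < c" by blast
      show ?thesis
      proof (intro exI[of _ "min d e"] conjI ballI impI)
        fix y assume y: "y \<in> \<Omega>" "dist y x < min d e"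
        then show "v y < c" using d(2)[of y] e(2)[of y] by (simp add: v_def)
      qed (use d e in auto)
    qed
  qed
  moreover have "v x < \<infinity>" if "x \<in> \<Omega>" for x using vW[OF that] fin(1)[OF that] by (rule le_less_trans)
  moreover have "submean_at v x" if x: "x \<in> \<Omega>" for x
  proof (cases "v x = u x")
    case True
    show ?thesis
      by (rule submean_at_mono[OF subharmonic_on_submean_at[OF u \<Omega> x], of 1]) (use uv True in auto)
  next
    case False
    then have xb: "x \<in> ball a r" and vx: "v x = W x - ereal (h (unit_pt x))"
      by (auto simp: v_def max_def split: if_splits)
    have n: "norm (unit_pt x) < 1" using xb unit_pt_ball by blast
    have "submean_at (\<lambda>z. W (pt z) - ereal (h z)) (unit_pt x)"
      unfolding h_def by (rule submean_at_diff_poisson[OF subW[OF n] g n])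
    then have "submean_at (\<lambda>x. W (pt (unit_pt x)) - ereal (h (unit_pt x))) x"
      unfolding unit_pt_def by (rule submean_at_affine) (use r(1) in simp)
    then have s: "submean_at (\<lambda>x. W x - ereal (h (unit_pt x))) x" unfolding pt_unit .
    obtain e where e: "e > 0" "ball x e \<subseteq> ball a r" using xb open_contains_ball open_ball by blast
    show ?thesis
    proof (rule submean_at_mono[where v=v, OF s e(1)])
      fix y assume "dist x y < e"
      then have "y \<in> ball a r" using e(2) by auto
      then show "W y - ereal (h (unit_pt y)) \<le> v y" by (simp add: v_def)
    qed (rule vx)
  qed
  ultimately have "subharmonic_on \<Omega> v" by (rule subharmonic_on_local)
  moreover have "W a - ereal (\<integral>y. w y - \<omega> y \<partial>sphere_prob) \<le> v a"
  proof -
    have "unit_pt a = 0" by (simp add: unit_pt_def)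
    then show ?thesis using ha r(1) by (simp add: v_def)
  qed
  moreover have "v x = u x" if "x \<notin> ball a r" for x using that by (simp add: v_def)
  ultimately show ?thesis using that uv vW by blast
qed

section \<open>Approximation from below at a point\<close>

text \<open>The gluing is carried out on a sphere around \<open>x0\<close> on which almost everywhere \<open>u\<^sub>j \<rightarrow> W > -\<infinity>\<close> and on
which some \<open>u\<^sub>j\<close> is integrable. The bound \<open>B\<close> is an upper bound of \<open>W\<close> near \<open>x0\<close>.\<close>

lemma approximation_at_point:
  fixes \<Omega> :: "'a::euclidean_space set"
  assumes \<Omega>: "open \<Omega>" and W: "subharmonic_on \<Omega> W" and u: "\<And>j. subharmonic_on \<Omega> (u j)"
    and inc: "\<And>j x. x \<in> \<Omega> \<Longrightarrow> u j x \<le> u (Suc j) x" and le: "\<And>j x. x \<in> \<Omega> \<Longrightarrow> u j x \<le> W x"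
    and conv: "quasi_everywhere_on \<Omega> (\<lambda>x. (\<lambda>j. u j x) \<longlonglongrightarrow> W x)"
    and x0: "x0 \<in> \<Omega>" and c: "c < W x0"
  obtains j v B where "subharmonic_on \<Omega> v" "\<And>x. x \<in> \<Omega> \<Longrightarrow> u j x \<le> v x" "\<And>x. x \<in> \<Omega> \<Longrightarrow> v x \<le> W x"
    "\<And>x. x \<in> \<Omega> \<Longrightarrow> v x \<le> max (u j x) (ereal B)" "c < v x0"
proof -
  have usc: "usc_on \<Omega> W" "\<And>j. usc_on \<Omega> (u j)" and fin: "\<And>x. x \<in> \<Omega> \<Longrightarrow> W x < \<infinity>" "\<And>j x. x \<in> \<Omega> \<Longrightarrow> u j x < \<infinity>"
    using W u unfolding subharmonic_on_def by auto
  obtain R where R: "0 < R" "cball x0 R \<subseteq> \<Omega>" using \<Omega> x0 open_contains_cball by blast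
  obtain M where M: "M \<ge> 0" "\<And>x. x \<in> cball x0 R \<Longrightarrow> W x \<le> ereal M"
    by (rule usc_on_compact_bounded[OF usc_on_subset[OF usc(1) R(2)]]) (use fin R(2) in auto)
  have W0: "W x0 \<noteq> - \<infinity>" using c by auto
  then obtain t where t: "W x0 = ereal t" using fin(1)[OF x0] by (cases "W x0") auto
  obtain q where q: "c < ereal q" "q < t" using c ereal_dense2 unfolding t by (metis less_ereal.simps(1))
  have mono: "u i x \<le> u j x" if "x \<in> \<Omega>" "i \<le> j" for i j x
    using lift_Suc_mono_le[of "\<lambda>j. u j x" i j] inc[OF that(1)] that(2) by simp
  define P where "P = (\<lambda>x. (x \<in> \<Omega> \<longrightarrow> (\<lambda>j. u j x) \<longlonglongrightarrow> W x) \<and> (x \<in> ball x0 R \<longrightarrow> W x \<noteq> - \<infinity>))"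
  have P: "AE x in lborel. P x"
  proof -
    obtain E where E: "polar E" "\<And>x. x \<in> \<Omega> - E \<Longrightarrow> (\<lambda>j. u j x) \<longlonglongrightarrow> W x"
      using conv unfolding quasi_everywhere_on_def by blast
    have "AE x in lborel. x \<notin> E" using polar_negligible[OF E(1)] negligible_iff_AE by blast
    then show ?thesis using AE_ball_not_MInf[OF W \<Omega> R W0]
      by eventually_elim (use E(2) in \<open>auto simp: P_def\<close>)
  qed
  obtain p where p: "p \<in> ball x0 (R / 4)" "P p" by (rule AE_ball_witness[OF P, of "R / 4" x0]) (use R in auto)
  have pR: "p \<in> ball x0 R" using p(1) R(1) by simp
  then have p\<Omega>: "p \<in> \<Omega>" using R(2) ball_subset_cball by blast
  \<comment> \<open>some \<open>u j0\<close> is finite at a point \<open>p\<close> so near \<open>x0\<close> that integrability around \<open>p\<close> covers a ball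
    around \<open>x0\<close>\<close>
  have "\<exists>j. u j p \<noteq> - \<infinity>"
  proof (rule ccontr)
    assume "\<nexists>j. u j p \<noteq> - \<infinity>"
    then have "(\<lambda>j. u j p) = (\<lambda>_. - \<infinity>)" by auto
    moreover have "(\<lambda>j. u j p) \<longlonglongrightarrow> W p" "W p \<noteq> - \<infinity>" using p pR p\<Omega> by (auto simp: P_def)
    ultimately show False using LIMSEQ_unique tendsto_const by metis
  qed
  then obtain j0 where j0: "u j0 p \<noteq> - \<infinity>" by blast
  have "cball p (R / 2) \<subseteq> cball x0 R"
  proof
    fix y assume "y \<in> cball p (R / 2)"
    then show "y \<in> cball x0 R" using p(1) R(1) dist_triangle[of x0 y p] by simp
  qed
  then have pc: "cball p (R / 2) \<subseteq> \<Omega>" using R(2) by blast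
  have sub: "ball x0 (R / 4) \<subseteq> ball p (R / 2)"
  proof
    fix y assume "y \<in> ball x0 (R / 4)"
    then show "y \<in> ball p (R / 2)" using p(1) dist_triangle[of p y x0] by (simp add: dist_commute)
  qed
  note [measurable] = negative_part_on_measurable[OF u \<Omega>]
  have "(\<integral>\<^sup>+x\<in>ball x0 (R / 4). negative_part_on \<Omega> (u j0) x \<partial>lborel) \<le> (\<integral>\<^sup>+x\<in>ball p (R / 2). negative_part_on \<Omega> (u j0) x \<partial>lborel)"
    by (rule nn_integral_mono) (use sub in \<open>auto simp: indicator_def\<close>)
  also have "\<dots> < \<infinity>"
    by (rule subharmonic_negative_part_integrable[OF u \<Omega> _ pc j0]) (use R in simp)
  finally obtain r where r: "0 < r" "r < R / 4" "(\<integral>\<^sup>+y. negative_part_on \<Omega> (u j0) (x0 + r *\<^sub>R y) \<partial>sphere_prob) < \<infinity>"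
    "AE y in sphere_prob. P (x0 + r *\<^sub>R y)"
    by (rule generic_radius[OF negative_part_on_measurable[OF u \<Omega>] _ _ P, rotated]) (use R in auto)
  define pt where "pt = (\<lambda>y. x0 + r *\<^sub>R y)"
  have pt_in: "pt y \<in> ball x0 R" "pt y \<in> \<Omega>" if "norm y = 1" for y
  proof -
    show "pt y \<in> ball x0 R" using r R that by (simp add: pt_def dist_norm)
    then show "pt y \<in> \<Omega>" using R(2) ball_subset_cball by blast
  qed
  have [measurable]: "pt \<in> borel_measurable borel" unfolding pt_def by measurable
  \<comment> \<open>real boundary values, set to \<open>0\<close> off \<open>\<Omega>\<close> to make them Borel measurable on the whole space\<close>
  define real_on where "real_on = (\<lambda>f y. real_of_ereal (if pt y \<in> \<Omega> then f (pt y) else (0::ereal)))"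
  have real_on_borel: "real_on f \<in> borel_measurable borel" if "usc_on \<Omega> f" for f
  proof -
    have [measurable]: "(\<lambda>x. if x \<in> \<Omega> then f x else 0) \<in> borel_measurable borel"
      by (rule usc_on_borel[OF that]) (use \<Omega> in simp)
    have "(\<lambda>y. (\<lambda>x. if x \<in> \<Omega> then f x else 0) (pt y)) \<in> borel_measurable borel" by measurable
    then show ?thesis unfolding real_on_def by measurable
  qed
  define w where "w = real_on W"
  define \<omega> where "\<omega> = (\<lambda>k. real_on (u (k + j0)))"
  have [measurable]: "w \<in> borel_measurable borel" "\<And>k. \<omega> k \<in> borel_measurable borel"
    unfolding w_def \<omega>_def using real_on_borel usc by auto
  have "AE y in sphere_prob. negative_part_on \<Omega> (u j0) (pt y) \<noteq> \<infinity>"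
    by (rule nn_integral_PInf_AE) (use r(3) in \<open>auto simp: pt_def\<close>)
  then have AE: "AE y in sphere_prob. W (pt y) = ereal (w y) \<and> (\<forall>k. u (k + j0) (pt y) = ereal (\<omega> k y)) \<and> (\<lambda>k. \<omega> k y) \<longlonglongrightarrow> w y
      \<and> w y \<le> M \<and> (\<forall>k. \<omega> 0 y \<le> \<omega> k y \<and> \<omega> k y \<le> w y) \<and> negative_part_on \<Omega> (u j0) (pt y) = ennreal (- \<omega> 0 y)"
    using r(4) AE_sphere_prob
  proof eventually_elim
    case (elim y)
    note y = pt_in[OF elim(3)]
    have Wy: "W (pt y) = ereal (w y)"
      using elim(2) y fin(1)[OF y(2)] unfolding P_def w_def real_on_def pt_def
      by (cases "W (pt y)") (auto simp: pt_def)
    have u0: "u j0 (pt y) \<noteq> - \<infinity>" using elim(1) y by (auto simp: negative_part_on_def)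
    have uy: "u (k + j0) (pt y) = ereal (\<omega> k y)" for k
    proof -
      have "u (k + j0) (pt y) \<noteq> - \<infinity>" using u0 mono[OF y(2), of j0 "k + j0"] by auto
      then show ?thesis using y fin(2)[OF y(2), of "k + j0"] unfolding \<omega>_def real_on_def
        by (cases "u (k + j0) (pt y)") auto
    qed
    have "(\<lambda>k. u (k + j0) (pt y)) \<longlonglongrightarrow> W (pt y)"
      using elim(2) y by (intro LIMSEQ_ignore_initial_segment) (simp add: P_def pt_def)
    then have lim: "(\<lambda>k. \<omega> k y) \<longlonglongrightarrow> w y" unfolding Wy uy by simp
    have "w y \<le> M" using M(2)[of "pt y"] y Wy by simp
    moreover have "\<omega> 0 y \<le> \<omega> k y" for k using mono[OF y(2), of "0 + j0" "k + j0"] unfolding uy by simp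
    moreover have "\<omega> k y \<le> w y" for k using le[OF y(2), of "k + j0"] unfolding uy Wy by simp
    moreover have "negative_part_on \<Omega> (u j0) (pt y) = ennreal (- \<omega> 0 y)"
      using y uy[of 0] by (simp add: negative_part_on_def)
    ultimately show ?case using Wy uy lim by blast
  qed
  have I0: "integrable sphere_prob (\<omega> 0)"
    unfolding real_integrable_def
  proof (intro conjI)
    have "(\<integral>\<^sup>+y. ennreal (\<omega> 0 y) \<partial>sphere_prob) \<le> (\<integral>\<^sup>+y. ennreal M \<partial>(sphere_prob :: 'a measure))"
    proof (rule nn_integral_mono_AE)
      show "AE y in sphere_prob. ennreal (\<omega> 0 y) \<le> ennreal M"
        using AE by eventually_elim (auto intro!: ennreal_leI intro: order_trans)
    qed
    then show "(\<integral>\<^sup>+y. ennreal (\<omega> 0 y) \<partial>sphere_prob) \<noteq> \<infinity>"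
      using sphere_prob.emeasure_space_1[where 'a='a] by (auto simp: top_unique)
    have "(\<integral>\<^sup>+y. ennreal (- \<omega> 0 y) \<partial>sphere_prob) = (\<integral>\<^sup>+y. negative_part_on \<Omega> (u j0) (x0 + r *\<^sub>R y) \<partial>sphere_prob)"
    proof (rule nn_integral_cong_AE)
      show "AE y in sphere_prob. ennreal (- \<omega> 0 y) = negative_part_on \<Omega> (u j0) (x0 + r *\<^sub>R y)"
        using AE by eventually_elim (simp add: pt_def)
    qed
    then show "(\<integral>\<^sup>+y. ennreal (- \<omega> 0 y) \<partial>sphere_prob) \<noteq> \<infinity>" using r(3) by simp
  qed simp
  have bound: "integrable sphere_prob (\<lambda>y. \<bar>\<omega> 0 y\<bar> + M)" using I0 by simp
  have Iw: "integrable sphere_prob w"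
  proof (rule Bochner_Integration.integrable_bound[OF bound])
    show "AE y in sphere_prob. norm (w y) \<le> norm (\<bar>\<omega> 0 y\<bar> + M)"
      using AE by eventually_elim (use M(1) in \<open>smt (verit) real_norm_def\<close>)
  qed simp
  have bd: "AE y in sphere_prob. norm (\<omega> k y) \<le> \<bar>\<omega> 0 y\<bar> + M" for k
    using AE
  proof eventually_elim
    case (elim y)
    then have "\<omega> 0 y \<le> \<omega> k y" "\<omega> k y \<le> w y" "w y \<le> M" by blast+
    then show ?case using M(1) by simp
  qed
  have I\<omega>: "integrable sphere_prob (\<omega> k)" for k
  proof (rule Bochner_Integration.integrable_bound[OF bound])
    show "AE y in sphere_prob. norm (\<omega> k y) \<le> norm (\<bar>\<omega> 0 y\<bar> + M)"
      using bd[of k] by eventually_elim simp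
  qed simp
  have "(\<lambda>k. \<integral>y. \<omega> k y \<partial>sphere_prob) \<longlonglongrightarrow> (\<integral>y. w y \<partial>sphere_prob)"
  proof (rule integral_dominated_convergence[OF _ _ bound])
    show "AE y in sphere_prob. (\<lambda>k. \<omega> k y) \<longlonglongrightarrow> w y" using AE by eventually_elim blast
  qed (use bd in auto)
  then have "(\<lambda>k. (\<integral>y. w y \<partial>sphere_prob) - (\<integral>y. \<omega> k y \<partial>sphere_prob)) \<longlonglongrightarrow> 0"
    using tendsto_diff[OF tendsto_const[of "\<integral>y. w y \<partial>sphere_prob"]] by force
  then have "\<forall>\<^sub>F k in sequentially. (\<integral>y. w y \<partial>sphere_prob) - (\<integral>y. \<omega> k y \<partial>sphere_prob) < t - q"
    by (rule order_tendstoD) (use q in simp)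
  then obtain k where "(\<integral>y. w y \<partial>sphere_prob) - (\<integral>y. \<omega> k y \<partial>sphere_prob) < t - q"
    by (auto simp: eventually_sequentially)
  then have k: "(\<integral>y. w y - \<omega> k y \<partial>sphere_prob) < t - q" using Iw I\<omega> by simp
  have cr: "cball x0 r \<subseteq> \<Omega>" using R r by (auto simp: subset_iff)
  have AEw: "AE y in sphere_prob. W (x0 + r *\<^sub>R y) = ereal (w y)"
    using AE by eventually_elim (simp add: pt_def)
  have AE\<omega>: "AE y in sphere_prob. u (k + j0) (x0 + r *\<^sub>R y) = ereal (\<omega> k y)"
    using AE by eventually_elim (simp add: pt_def)
  obtain v where v: "subharmonic_on \<Omega> v" "\<And>x. x \<in> \<Omega> \<Longrightarrow> u (k + j0) x \<le> v x" "\<And>x. x \<in> \<Omega> \<Longrightarrow> v x \<le> W x"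
    "\<And>x. x \<notin> ball x0 r \<Longrightarrow> v x = u (k + j0) x"
    "W x0 - ereal (\<integral>y. w y - \<omega> k y \<partial>sphere_prob) \<le> v x0"
    by (rule subharmonic_poisson_gluing[OF \<Omega> r(1) cr W u le Iw AEw I\<omega> AE\<omega>]) (assumption, rule that)
  show ?thesis
  proof (rule that[OF v(1-3)])
    fix x assume x: "x \<in> \<Omega>"
    show "v x \<le> max (u (k + j0) x) (ereal M)"
    proof (cases "x \<in> ball x0 r")
      case True
      then have "x \<in> cball x0 R" using r R by simp
      then show ?thesis using v(3)[OF x] M(2)[of x] by (auto simp: le_max_iff_disj)
    qed (simp add: v(4))
  next
    have "ereal q < W x0 - ereal (\<integral>y. w y - \<omega> k y \<partial>sphere_prob)" using k t by simp
    then show "c < v x0" using q(1) v(5) by (meson less_le_trans less_trans)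
  qed
qed

theorem corollary2p1:
  fixes \<Omega> :: "(real ^ 'n) set"
    and W :: "real ^ 'n \<Rightarrow> ereal"
    and u :: "nat \<Rightarrow> real ^ 'n \<Rightarrow> ereal"
  assumes "2 \<le> CARD('n)"
    and "open \<Omega>" and "connected \<Omega>" and "\<Omega> \<noteq> {}"
    and "subharmonic_on \<Omega> W"
    and "\<And>j. subharmonic_on \<Omega> (u j)"
    and "\<And>j. bdd_above_on \<Omega> (u j)"
    and "\<And>j x. x \<in> \<Omega> \<Longrightarrow> u j x \<le> u (Suc j) x"
    and "\<And>j x. x \<in> \<Omega> \<Longrightarrow> u j x \<le> W x"
    and "quasi_everywhere_on \<Omega> (\<lambda>x. (\<lambda>j. u j x) \<longlonglongrightarrow> W x)"
  shows "(\<forall>x\<in>\<Omega>. W x =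
            Sup {v x | v. subharmonic_on \<Omega> v \<and> (\<forall>y\<in>\<Omega>. v y \<le> W y) \<and> bdd_above_on \<Omega> v}) \<and>
         ((\<forall>j. bdd_below_on \<Omega> (u j)) \<longrightarrow>
          (\<forall>x\<in>\<Omega>. W x =
            Sup {v x | v. subharmonic_on \<Omega> v \<and> (\<forall>y\<in>\<Omega>. v y \<le> W y) \<and>
                          bdd_above_on \<Omega> v \<and> bdd_below_on \<Omega> v}))"
proof -
  have approx: "\<exists>v. subharmonic_on \<Omega> v \<and> (\<forall>y\<in>\<Omega>. v y \<le> W y) \<and> bdd_above_on \<Omega> v \<and>
      ((\<forall>j. bdd_below_on \<Omega> (u j)) \<longrightarrow> bdd_below_on \<Omega> v) \<and> c < v x"
    if x: "x \<in> \<Omega>" and c: "c < W x" for x c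
  proof -
    obtain j v B where v: "subharmonic_on \<Omega> v" "\<And>y. y \<in> \<Omega> \<Longrightarrow> u j y \<le> v y" "\<And>y. y \<in> \<Omega> \<Longrightarrow> v y \<le> W y"
      "\<And>y. y \<in> \<Omega> \<Longrightarrow> v y \<le> max (u j y) (ereal B)" "c < v x"
      using approximation_at_point[OF assms(2,5,6,8,9,10) x c] by metis
    have "(SUP y\<in>\<Omega>. v y) \<le> max (SUP y\<in>\<Omega>. u j y) (ereal B)"
    proof (rule SUP_least)
      fix y assume y: "y \<in> \<Omega>"
      have "u j y \<le> (SUP y\<in>\<Omega>. u j y)" using y by (rule SUP_upper)
      then show "v y \<le> max (SUP y\<in>\<Omega>. u j y) (ereal B)" using v(4)[OF y] by (auto simp: le_max_iff_disj)
    qed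
    also have "\<dots> < \<infinity>" using assms(7)[of j] by (simp add: bdd_above_on_def max_def)
    finally have "bdd_above_on \<Omega> v" by (simp add: bdd_above_on_def)
    moreover have "bdd_below_on \<Omega> v" if "bdd_below_on \<Omega> (u j)"
    proof -
      have "(INF y\<in>\<Omega>. u j y) \<le> (INF y\<in>\<Omega>. v y)" using v(2) by (intro INF_mono) auto
      then show ?thesis using that unfolding bdd_below_on_def by (rule less_le_trans[rotated])
    qed
    ultimately show ?thesis using v by blast
  qed
  have sup: "W x = Sup {v x | v. subharmonic_on \<Omega> v \<and> (\<forall>y\<in>\<Omega>. v y \<le> W y) \<and> Q v}"
    if x: "x \<in> \<Omega>" and Q: "\<And>v. bdd_above_on \<Omega> v \<Longrightarrow> ((\<forall>j. bdd_below_on \<Omega> (u j)) \<longrightarrow> bdd_below_on \<Omega> v) \<Longrightarrow> Q v"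
    for x Q
  proof (rule antisym)
    show "W x \<le> Sup {v x | v. subharmonic_on \<Omega> v \<and> (\<forall>y\<in>\<Omega>. v y \<le> W y) \<and> Q v}"
    proof (rule dense_le)
      fix c assume "c < W x"
      from approx[OF x this] obtain v where "subharmonic_on \<Omega> v" "\<forall>y\<in>\<Omega>. v y \<le> W y" "Q v" "c < v x"
        using Q by blast
      then have "v x \<le> Sup {v x | v. subharmonic_on \<Omega> v \<and> (\<forall>y\<in>\<Omega>. v y \<le> W y) \<and> Q v}"
        by (intro Sup_upper) blast
      then show "c \<le> Sup {v x | v. subharmonic_on \<Omega> v \<and> (\<forall>y\<in>\<Omega>. v y \<le> W y) \<and> Q v}"
        using \<open>c < v x\<close> by simp
    qed
    show "Sup {v x | v. subharmonic_on \<Omega> v \<and> (\<forall>y\<in>\<Omega>. v y \<le> W y) \<and> Q v} \<le> W x"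
      by (rule Sup_least) (use x in blast)
  qed
  show ?thesis
    using sup[where Q="bdd_above_on \<Omega>"] sup[where Q="\<lambda>v. bdd_above_on \<Omega> v \<and> bdd_below_on \<Omega> v"]
    by blast
qed

end
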